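(* For all $f\in\mathcal R$ homogeneous of weight $k$, the modified $q$-bracket $$\langle f\rangle_q^\star\;=\;\langle T_{-1}\,f\rangle_q-\langle T_{-1}\rangle_q\,\langle f\rangle_q-\frac1{24}\,\langle\partial_2(f)\rangle_q$$ is a quasimodular form of weight $k$. More precisely, $$\langle f\rangle_q^\star\;=\;\sum_{i\ge2,\ j\ge0}G_i^{(j)}\,\langle\rho^\star_{i,j}(f)\rangle_q,\qquad\text{where}\quad\rho^\star_{i,j}=\rho_{i,j}+\delta_{i,2}\,\rho_{0,j+1}.$$
   Context: Define $\beta_k\in\mathbb Q$ by $\frac{z/2}{\sinh(z/2)}=\sum_{k\ge0}\beta_kz^k$. For a partition $\lambda$ put $Q_0(\lambda)=1$ and $Q_k(\lambda)=\frac{1}{(k-1)!}\sum_{i\ge1}\bigl[(\lambda_i-i+\tfrac12)^{k-1}-(-i+\tfrac12)^{k-1}\bigr]+\beta_k$ for $k\ge1$. Let $\mathcal R=\mathbb Q[Q_1,Q_2,\dots]$ be the polynomial ring in these symbols ($Q_0=1$), graded by giving $Q_k$ weight $k$; its elements are regarded as functions on the set of all partitions. Put $p_\ell=\ell!\,Q_{\ell+1}$ for $\ell\ge1$, so $\frac{\partial}{\partial p_\ell}=\frac1{\ell!}\frac{\partial}{\partial Q_{\ell+1}}$. $\partial_2$ is the derivation of $\mathcal R$ sending $Q_k$ to $Q_{k-2}$ (with $Q_m=0$ for $m<0$). The $q$-bracket of a function $f$ on partitions is $\langle f\rangle_q=\sum_\lambda f(\lambda)q^{|\lambda|}\big/\sum_\lambda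 q^{|\lambda|}\in\mathbb Q[[q]]$. $T_{-1}(\lambda)=\sum_{\xi\in Y_\lambda}h(\xi)^{-2}$, where $Y_\lambda$ is the Young diagram of $\lambda$ and $h(\xi)$ the hook-length of the cell $\xi$. $G_k=-\frac{B_k}{2k}+\sum_{n\ge1}\sigma_{k-1}(n)q^n$ for $k\ge2$ even, $G_k=0$ for $k$ odd, and $G_k^{(j)}=\bigl(q\frac d{dq}\bigr)^jG_k$. Quasimodular forms of weight $k$ (for $\mathrm{SL}(2,\mathbb Z)$) are the weight $k$ elements of the graded ring $\mathbb Q[G_2,G_4,G_6]$, $G_k$ having weight $k$. The operators $\rho_{i,j}:\mathcal R\to\mathcal R$: define power series $\rho^{(k)}(\mathbf u)$ in $\mathbf u=(u_1,u_2,\dots)$ by $\sum_{k\ge0}\rho^{(k)}(\mathbf u)\frac{v^k}{k!}=\int_v^{v+1}e^{U(t)-U(t-1)}dt$ with $U(t)=\sum_{n\ge1}u_nt^n$; let $\rho_{i,j}^{(k)}$ be the part of $\rho^{(k)}$ of degree $j$ and weight $i+2j+k$, where $u_\ell$ has degree $1$ and weight $\ell+1$; then $\rho_{i,j}=\sum_{k\ge0}Q_k\,\rho_{i,j}^{(k)}\bigl(\frac\partial{\partial p_1},\frac\partial{\partial p_2},\dots\bigr)$ (multiplication by $Q_k$ after the derivations). *)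

theory Defs
  imports
    "HOL-Library.Poly_Mapping"
    "HOL-Computational_Algebra.Polynomial"
    "HOL-Computational_Algebra.Formal_Power_Series"
begin

text \<open>
  A monomial is a finitely supported exponent vector. In the ring \<open>R = \<rat>[Q\<^sub>1, Q\<^sub>2, \<dots>]\<close> the
  variable with index \<open>n\<close> is \<open>Q\<close> with subscript \<open>n + 1\<close>, so that there is no variable for
  \<open>Q\<^sub>0 = 1\<close>; it has weight \<open>n + 1\<close>. In power series in \<open>u = (u\<^sub>1, u\<^sub>2, \<dots>)\<close> the index \<open>l \<ge> 1\<close> stands
  for \<open>u\<close> with subscript \<open>l\<close>, which has weight \<open>l + 1\<close>. Hence one weight function serves both.
\<close>

type_synonym monom = "nat \<Rightarrow>\<^sub>0 nat"
type_synonym shsym = "monom \<Rightarrow>\<^sub>0 rat"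

definition mon_degree :: "monom \<Rightarrow> nat" where
  "mon_degree m = (\<Sum>l\<in>Poly_Mapping.keys m. Poly_Mapping.lookup m l)"

definition mon_weight :: "monom \<Rightarrow> nat" where
  "mon_weight m = (\<Sum>l\<in>Poly_Mapping.keys m. (l + 1) * Poly_Mapping.lookup m l)"

definition cst :: "rat \<Rightarrow> shsym" where
  "cst c = Poly_Mapping.single 0 c"

definition Q :: "nat \<Rightarrow> shsym" where
  "Q k = (case k of 0 \<Rightarrow> 1 | Suc n \<Rightarrow> Poly_Mapping.single (Poly_Mapping.single n 1) 1)"

definition homogeneous :: "nat \<Rightarrow> shsym \<Rightarrow> bool" where
  "homogeneous k f \<longleftrightarrow> (\<forall>m\<in>Poly_Mapping.keys f. mon_weight m = k)"

text \<open>Partial derivative with respect to the variable with index \<open>n\<close>, i.e. \<open>\<partial>/\<partial>Q\<^bsub>n+1\<^esub>\<close>.\<close>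

definition pd :: "nat \<Rightarrow> shsym \<Rightarrow> shsym" where
  "pd n f = (\<Sum>m\<in>Poly_Mapping.keys f.
     Poly_Mapping.single (m - Poly_Mapping.single n 1) (of_nat (Poly_Mapping.lookup m n) * Poly_Mapping.lookup f m))"

text \<open>\<open>\<partial>/\<partial>p\<^sub>l\<close>, where \<open>p\<^sub>l = l! Q\<^bsub>l+1\<^esub>\<close>, for \<open>l \<ge> 1\<close>.\<close>

definition dp :: "nat \<Rightarrow> shsym \<Rightarrow> shsym" where
  "dp l f = cst (1 / fact l) * pd l f"

text \<open>
  The derivation with \<open>Q\<^sub>k \<mapsto> Q\<^bsub>k-2\<^esub>\<close>, by the chain rule. The variable with index 0 is \<open>Q\<^sub>1\<close>, which
  is mapped to \<open>0\<close>; for \<open>n \<ge> 1\<close> the index \<open>n\<close> is \<open>Q\<^bsub>n+1\<^esub>\<close>, mapped to \<open>Q\<^bsub>n-1\<^esub>\<close>. The lemmas \<open>del2_add\<close>, \<open>del2_mult\<close>, \<open>del2_cst\<close> and \<open>del2_Q\<close> below characterise it.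
\<close>

definition del2 :: "shsym \<Rightarrow> shsym" where
  "del2 f = (\<Sum>n\<in>(\<Union>m\<in>Poly_Mapping.keys f. Poly_Mapping.keys m) - {0}. Q (n - 1) * pd n f)"

text \<open>A partition is the weakly decreasing list of its positive parts.\<close>

definition partitions_of :: "nat \<Rightarrow> nat list set" where
  "partitions_of n = {xs. sorted_wrt (\<ge>) xs \<and> 0 \<notin> set xs \<and> sum_list xs = n}"

definition beta :: "nat \<Rightarrow> rat" where
  "beta k = fps_nth ((fps_const (1/2) * fps_X) /
                     (fps_const (1/2) * (fps_exp (1/2) - fps_exp (- 1/2)))) k"

text \<open>
  The part \<open>\<lambda>\<^sub>i\<close> is \<open>xs ! (i - 1)\<close>. The summands with \<open>i\<close> beyond the length vanish, because
  \<open>\<lambda>\<^sub>i = 0\<close> there.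
\<close>

definition Qfun :: "nat \<Rightarrow> nat list \<Rightarrow> rat" where
  "Qfun k xs = (if k = 0 then 1 else
     1 / fact (k - 1) * (\<Sum>i=1..length xs.
        (of_nat (xs ! (i - 1)) - of_nat i + 1/2) ^ (k - 1) - (- of_nat i + 1/2) ^ (k - 1))
     + beta k)"

text \<open>The function on partitions given by an element of \<open>R\<close>.\<close>

definition sheval :: "shsym \<Rightarrow> nat list \<Rightarrow> rat" where
  "sheval f xs = (\<Sum>m\<in>Poly_Mapping.keys f. Poly_Mapping.lookup f m * (\<Prod>n\<in>Poly_Mapping.keys m. Qfun (n + 1) xs ^ Poly_Mapping.lookup m n))"

definition young :: "nat list \<Rightarrow> (nat \<times> nat) set" where
  "young xs = {(i, j). i < length xs \<and> j < xs ! i}"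

definition hook_length :: "nat list \<Rightarrow> nat \<times> nat \<Rightarrow> nat" where
  "hook_length xs c = card {d \<in> young xs.
     fst d = fst c \<and> snd c \<le> snd d \<or> snd d = snd c \<and> fst c \<le> fst d}"

definition T_minus1 :: "nat list \<Rightarrow> rat" where
  "T_minus1 xs = (\<Sum>c\<in>young xs. 1 / of_nat (hook_length xs c) ^ 2)"

definition qbracket :: "(nat list \<Rightarrow> rat) \<Rightarrow> rat fps" where
  "qbracket F = Abs_fps (\<lambda>n. \<Sum>xs\<in>partitions_of n. F xs)
              / Abs_fps (\<lambda>n. \<Sum>xs\<in>partitions_of n. 1)"

definition qbracket_star :: "shsym \<Rightarrow> rat fps" where
  "qbracket_star f =
     qbracket (\<lambda>xs. T_minus1 xs * sheval f xs)
     - qbracket T_minus1 * qbracket (sheval f)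
     - fps_const (1/24) * qbracket (sheval (del2 f))"

text \<open>Bernoulli numbers, \<open>z / (exp z - 1) = \<Sum> B\<^sub>k z\<^sup>k / k!\<close>.\<close>

definition bernoulli_num :: "nat \<Rightarrow> rat" where
  "bernoulli_num k = fact k * fps_nth (fps_X / (fps_exp 1 - 1)) k"

definition sigma :: "nat \<Rightarrow> nat \<Rightarrow> nat" where
  "sigma r n = (\<Sum>d | d dvd n. d ^ r)"

text \<open>Only \<open>k \<ge> 2\<close> is relevant.\<close>

definition Eis :: "nat \<Rightarrow> rat fps" where
  "Eis k = (if even k
     then Abs_fps (\<lambda>n. if n = 0 then - bernoulli_num k / (2 * of_nat k)
                                 else of_nat (sigma (k - 1) n))
     else 0)"

text \<open>\<open>fps_XD\<close> is \<open>q d/dq\<close>.\<close>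

definition Eis_deriv :: "nat \<Rightarrow> nat \<Rightarrow> rat fps" where
  "Eis_deriv k j = (fps_XD ^^ j) (Eis k)"

definition quasimodular :: "nat \<Rightarrow> rat fps set" where
  "quasimodular k =
     {\<Sum>(a, b, c) \<in> {(a, b, c). 2 * a + 4 * b + 6 * c = k}.
        fps_const (r a b c) * Eis 2 ^ a * Eis 4 ^ b * Eis 6 ^ c | r. True}"

text \<open>
  A power series in \<open>u\<close> is given by its coefficients on monomials. The coefficients are
  polynomials in \<open>t\<close> (later \<open>v\<close>).
\<close>

type_synonym 'a mfps = "monom \<Rightarrow> 'a"

definition mfps_one :: "'a::comm_semiring_1 mfps" where
  "mfps_one m = (if m = 0 then 1 else 0)"

definition mfps_mult :: "'a::comm_semiring_1 mfps \<Rightarrow> 'a mfps \<Rightarrow> 'a mfps" where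
  "mfps_mult F G m = (\<Sum>(a, b) \<in> {(a, b). a + b = m}. F a * G b)"

text \<open>
  Exponential of a series without constant term; the \<open>j\<close>-th power of such a series has no
  terms of degree below \<open>j\<close>, so the exponential series may be cut off at the degree of \<open>m\<close>.
\<close>

definition mfps_exp :: "rat poly mfps \<Rightarrow> rat poly mfps" where
  "mfps_exp F m = (\<Sum>j\<le>mon_degree m. smult (1 / fact j) ((mfps_mult F ^^ j) mfps_one m))"

text \<open>\<open>U(x) = \<Sum>\<^bsub>n\<ge>1\<^esub> u\<^sub>n x\<^sup>n\<close>\<close>

definition Useries :: "rat poly \<Rightarrow> rat poly mfps" where
  "Useries x m = (\<Sum>n\<in>Poly_Mapping.keys m. if 1 \<le> n \<and> m = Poly_Mapping.single n 1 then x ^ n else 0)"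

definition antiderivative :: "rat poly \<Rightarrow> rat poly" where
  "antiderivative p = (\<Sum>i\<le>Polynomial.degree p. Polynomial.monom (coeff p i / of_nat (i + 1)) (i + 1))"

text \<open>\<open>p(t) \<mapsto> \<integral> p(t) dt\<close> from \<open>v\<close> to \<open>v + 1\<close>, as a polynomial in \<open>v\<close>\<close>

definition unit_integral :: "rat poly \<Rightarrow> rat poly" where
  "unit_integral p = pcompose (antiderivative p) [:1, 1:] - antiderivative p"

definition rho_series :: "nat \<Rightarrow> rat mfps" where
  "rho_series k m = fact k *
     coeff (unit_integral (mfps_exp (\<lambda>a. Useries [:0, 1:] a - Useries [:- 1, 1:] a) m)) k"

text \<open>\<open>m(\<partial>/\<partial>p\<^sub>1, \<partial>/\<partial>p\<^sub>2, \<dots>)\<close>; the order of composition is immaterial.\<close>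

definition mon_diff :: "monom \<Rightarrow> shsym \<Rightarrow> shsym" where
  "mon_diff m = fold (\<lambda>l. dp l ^^ Poly_Mapping.lookup m l) (sorted_list_of_set (Poly_Mapping.keys m))"

text \<open>
  The part of \<open>\<rho>\<^sup>(\<^sup>k\<^sup>)\<close> of degree \<open>j\<close> and weight \<open>i + 2 j + k\<close>, evaluated at the \<open>\<partial>/\<partial>p\<^sub>l\<close>. Monomials
  containing the index 0 do not contribute, as their coefficient in \<open>rho_series\<close> is \<open>0\<close>.
\<close>

definition rho_part :: "nat \<Rightarrow> nat \<Rightarrow> nat \<Rightarrow> shsym \<Rightarrow> shsym" where
  "rho_part i j k f =
     (\<Sum>m | mon_degree m = j \<and> mon_weight m = i + 2 * j + k. cst (rho_series k m) * mon_diff m f)"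

text \<open>
  \<open>Sum_any\<close> is the sum over all \<open>k\<close> with nonzero summand; by \<open>finite_rho_part\<close> below there are
  only finitely many.
\<close>

definition rho :: "nat \<Rightarrow> nat \<Rightarrow> shsym \<Rightarrow> shsym" where
  "rho i j f = Sum_any (\<lambda>k. Q k * rho_part i j k f)"

definition rho_star :: "nat \<Rightarrow> nat \<Rightarrow> shsym \<Rightarrow> shsym" where
  "rho_star i j f = rho i j f + (if i = 2 then rho 0 (j + 1) f else 0)"

lemma poly_mapping_sum_singles:
  "f = (\<Sum>m\<in>Poly_Mapping.keys f. Poly_Mapping.single m (Poly_Mapping.lookup f m))"
proof (rule poly_mapping_eqI)
  fix a
  have "Poly_Mapping.lookup (\<Sum>m\<in>Poly_Mapping.keys f. Poly_Mapping.single m (Poly_Mapping.lookup f m)) a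
     = (\<Sum>m\<in>Poly_Mapping.keys f. if m = a then Poly_Mapping.lookup f a else 0)"
    unfolding lookup_sum by (intro sum.cong) (auto simp: lookup_single when_def)
  also have "\<dots> = Poly_Mapping.lookup f a"
    by (auto simp: in_keys_iff)
  finally show "Poly_Mapping.lookup f a = Poly_Mapping.lookup
      (\<Sum>m\<in>Poly_Mapping.keys f. Poly_Mapping.single m (Poly_Mapping.lookup f m)) a" by simp
qed

lemma pd_superset:
  assumes "finite S" "Poly_Mapping.keys f \<subseteq> S"
  shows "pd n f = (\<Sum>m\<in>S. Poly_Mapping.single (m - Poly_Mapping.single n 1)
           (of_nat (Poly_Mapping.lookup m n) * Poly_Mapping.lookup f m))"
  unfolding pd_def using assms
  by (intro sum.mono_neutral_left) (auto simp: in_keys_iff)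

lemma pd_add: "pd n (f + g) = pd n f + pd n g"
proof -
  let ?S = "Poly_Mapping.keys f \<union> Poly_Mapping.keys g"
  have S: "finite ?S" "Poly_Mapping.keys f \<subseteq> ?S" "Poly_Mapping.keys g \<subseteq> ?S"
    "Poly_Mapping.keys (f + g) \<subseteq> ?S"
    using keys_add[of f g] by auto
  show ?thesis
    unfolding pd_superset[OF S(1,2)] pd_superset[OF S(1,3)] pd_superset[OF S(1,4)]
    by (simp add: sum.distrib[symmetric] single_add[symmetric] lookup_add distrib_left)
qed

lemma pd_zero [simp]: "pd n 0 = 0"
  by (simp add: pd_def)

lemma pd_sum: "pd n (sum F A) = (\<Sum>a\<in>A. pd n (F a))"
  by (induction A rule: infinite_finite_induct) (auto simp: pd_add)

lemma pd_single:
  "pd n (Poly_Mapping.single m c) =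
     Poly_Mapping.single (m - Poly_Mapping.single n 1) (of_nat (Poly_Mapping.lookup m n) * c)"
  using pd_superset[of "{m}" "Poly_Mapping.single m c" n] by simp

lemma monom_minus_var:
  fixes a b :: monom
  assumes "Poly_Mapping.lookup a n \<noteq> 0"
  shows "a - Poly_Mapping.single n 1 + b = a + b - Poly_Mapping.single n 1"
proof (rule poly_mapping_eqI)
  fix k
  show "Poly_Mapping.lookup (a - Poly_Mapping.single n 1 + b) k
      = Poly_Mapping.lookup (a + b - Poly_Mapping.single n 1) k"
    using assms by (cases "k = n") (auto simp: lookup_add lookup_minus lookup_single)
qed

lemma pd_mult_single:
  "pd n (Poly_Mapping.single a c * Poly_Mapping.single b d) =
     pd n (Poly_Mapping.single a c) * Poly_Mapping.single b d
     + Poly_Mapping.single a c * pd n (Poly_Mapping.single b d)"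
proof -
  let ?e = "Poly_Mapping.single n 1 :: monom"
  have 1: "pd n (Poly_Mapping.single a c) * Poly_Mapping.single b d
      = Poly_Mapping.single (a + b - ?e) (of_nat (Poly_Mapping.lookup a n) * c * d)"
    using monom_minus_var[of a n b]
    by (cases "Poly_Mapping.lookup a n = 0") (simp_all add: pd_single mult_single)
  have 2: "Poly_Mapping.single a c * pd n (Poly_Mapping.single b d)
      = Poly_Mapping.single (a + b - ?e) (of_nat (Poly_Mapping.lookup b n) * c * d)"
    using monom_minus_var[of b n a]
    by (cases "Poly_Mapping.lookup b n = 0") (simp_all add: pd_single mult_single add.commute mult_ac)
  show ?thesis
    unfolding 1 2 by (simp add: mult_single pd_single single_add[symmetric] lookup_add algebra_simps)
qed

lemma pd_mult: "pd n (f * g) = pd n f * g + f * pd n g"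
proof -
  define F where "F = (\<lambda>m. Poly_Mapping.single m (Poly_Mapping.lookup f m))"
  define G where "G = (\<lambda>m. Poly_Mapping.single m (Poly_Mapping.lookup g m))"
  have f: "f = (\<Sum>a\<in>Poly_Mapping.keys f. F a)" and g: "g = (\<Sum>b\<in>Poly_Mapping.keys g. G b)"
    unfolding F_def G_def by (rule poly_mapping_sum_singles)+
  have "pd n (sum F A * sum G B) = pd n (sum F A) * sum G B + sum F A * pd n (sum G B)" for A B
  proof -
    have "pd n (sum F A * sum G B) = (\<Sum>a\<in>A. \<Sum>b\<in>B. pd n (F a) * G b + F a * pd n (G b))"
      unfolding sum_product pd_sum by (simp add: F_def G_def pd_mult_single)
    then show ?thesis
      by (simp add: pd_sum sum_product sum.distrib)
  qed
  then show ?thesis using f g by metis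
qed

lemma pd_cst [simp]: "pd n (cst c) = 0"
  by (simp add: cst_def pd_single)

lemma pd_Q: "pd n (Q k) = (if k = Suc n then 1 else 0)"
proof (cases k)
  case 0
  then show ?thesis using pd_cst[of n 1] by (simp add: Q_def cst_def)
next
  case (Suc l)
  then show ?thesis by (auto simp: Q_def pd_single lookup_single)
qed

lemma pd_eq_0:
  assumes "n \<notin> (\<Union>m\<in>Poly_Mapping.keys f. Poly_Mapping.keys m)"
  shows "pd n f = 0"
  using assms unfolding pd_def by (intro sum.neutral) (auto simp: in_keys_iff)

lemma del2_superset:
  assumes "finite V" "(\<Union>m\<in>Poly_Mapping.keys f. Poly_Mapping.keys m) \<subseteq> V"
  shows "del2 f = (\<Sum>n\<in>V - {0}. Q (n - 1) * pd n f)"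
  unfolding del2_def using assms
  by (intro sum.mono_neutral_left) (auto intro: pd_eq_0)

lemma del2_add: "del2 (f + g) = del2 f + del2 g"
proof -
  let ?v = "\<lambda>f :: shsym. \<Union>m\<in>Poly_Mapping.keys f. Poly_Mapping.keys m"
  let ?V = "?v f \<union> ?v g"
  have V: "finite ?V" "?v f \<subseteq> ?V" "?v g \<subseteq> ?V" by auto
  have V': "?v (f + g) \<subseteq> ?V" using keys_add[of f g] by blast
  show ?thesis
    unfolding del2_superset[OF V(1,2)] del2_superset[OF V(1,3)] del2_superset[OF V(1) V']
    by (simp add: pd_add distrib_left sum.distrib)
qed

lemma del2_mult: "del2 (f * g) = del2 f * g + f * del2 g"
proof -
  let ?v = "\<lambda>f :: shsym. \<Union>m\<in>Poly_Mapping.keys f. Poly_Mapping.keys m"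
  let ?V = "?v f \<union> ?v g"
  have V: "finite ?V" "?v f \<subseteq> ?V" "?v g \<subseteq> ?V" by auto
  have V': "?v (f * g) \<subseteq> ?V"
  proof
    fix x assume "x \<in> ?v (f * g)"
    then obtain m where m: "m \<in> Poly_Mapping.keys (f * g)" "x \<in> Poly_Mapping.keys m" by blast
    then obtain a b where "a \<in> Poly_Mapping.keys f" "b \<in> Poly_Mapping.keys g" "m = a + b"
      using keys_mult[of f g] by blast
    with m(2) show "x \<in> ?V" using keys_add[of a b] by blast
  qed
  show ?thesis
    unfolding del2_superset[OF V(1,2)] del2_superset[OF V(1,3)] del2_superset[OF V(1) V']
    by (simp add: pd_mult distrib_left sum.distrib sum_distrib_left sum_distrib_right mult_ac)
qed

lemma del2_cst: "del2 (cst c) = 0"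
  unfolding del2_def by simp

lemma del2_Q: "del2 (Q k) = (if 2 \<le> k then Q (k - 2) else 0)"
proof -
  have v: "(\<Union>m\<in>Poly_Mapping.keys (Q k). Poly_Mapping.keys m) \<subseteq> {k - 1}"
    by (cases k) (auto simp: Q_def split: if_splits)
  show ?thesis
    using del2_superset[OF _ v] by (cases k) (auto simp: pd_Q split: if_splits)
qed

lemma pderiv_sum: "pderiv (sum F A) = (\<Sum>a\<in>A. pderiv (F a :: rat poly))"
  by (induction A rule: infinite_finite_induct) (auto simp: pderiv_add)

lemma pderiv_antiderivative: "pderiv (antiderivative p) = p"
proof -
  have "pderiv (antiderivative p) = (\<Sum>i\<le>Polynomial.degree p. Polynomial.monom (coeff p i) i)"
    unfolding antiderivative_def pderiv_sum
    by (intro sum.cong) (auto simp: pderiv_monom)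
  then show ?thesis by (simp add: poly_as_sum_of_monoms)
qed

lemma finite_partitions_of: "finite (partitions_of n)"
proof -
  have "partitions_of n \<subseteq> {xs. set xs \<subseteq> {..n} \<and> length xs \<le> n}"
  proof
    fix xs assume xs: "xs \<in> partitions_of n"
    have "length ys \<le> sum_list ys" if "0 \<notin> set ys" for ys :: "nat list"
      using that by (induction ys) auto
    with xs show "xs \<in> {xs. set xs \<subseteq> {..n} \<and> length xs \<le> n}"
      using member_le_sum_list[of _ xs] by (auto simp: partitions_of_def)
  qed
  then show ?thesis by (rule finite_subset) (rule finite_lists_length_le, simp)
qed

lemma fps_beta:
  "Abs_fps beta * (fps_const (1/2) * (fps_exp (1/2) - fps_exp (- 1/2))) = fps_const (1/2) * fps_X"
proof -
  let ?s = "fps_const (1/2) * (fps_exp (1/2) - fps_exp (- 1/2)) :: rat fps"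
  have n: "fps_nth ?s 1 \<noteq> 0" "fps_nth ?s 0 = 0" by simp_all
  then have "subdegree ?s = 1" by (intro subdegreeI) auto
  moreover have "subdegree (fps_const (1/2) * fps_X :: rat fps) = 1"
    by (intro subdegreeI) auto
  moreover have "?s \<noteq> 0" using n by (metis fps_zero_nth)
  ultimately have "?s dvd fps_const (1/2) * fps_X" by (subst fps_dvd_iff) auto
  moreover have "Abs_fps beta = fps_const (1/2) * fps_X / ?s"
    by (rule fps_ext) (simp add: beta_def)
  ultimately show ?thesis by simp
qed

lemma mon_weight_superset:
  assumes "finite S" "Poly_Mapping.keys m \<subseteq> S"
  shows "mon_weight m = (\<Sum>l\<in>S. (l + 1) * Poly_Mapping.lookup m l)"
  unfolding mon_weight_def using assms
  by (intro sum.mono_neutral_left) (auto simp: in_keys_iff)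

lemma mon_weight_add: "mon_weight (a + b) = mon_weight a + mon_weight b"
proof -
  let ?S = "Poly_Mapping.keys a \<union> Poly_Mapping.keys b"
  have S: "finite ?S" "Poly_Mapping.keys a \<subseteq> ?S" "Poly_Mapping.keys b \<subseteq> ?S"
    "Poly_Mapping.keys (a + b) \<subseteq> ?S"
    using keys_add[of a b] by auto
  show ?thesis
    unfolding mon_weight_superset[OF S(1,2)] mon_weight_superset[OF S(1,3)]
      mon_weight_superset[OF S(1,4)]
    by (simp add: lookup_add sum.distrib[symmetric] distrib_left)
qed

lemma lookup_le_mon_weight: "(l + 1) * Poly_Mapping.lookup m l \<le> mon_weight m"
proof (cases "l \<in> Poly_Mapping.keys m")
  case True
  then show ?thesis unfolding mon_weight_def
    by (intro member_le_sum[of l _ "\<lambda>l. (l + 1) * Poly_Mapping.lookup m l"]) auto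
qed (simp add: in_keys_iff)

lemma finite_mon_weight_le: "finite {m. mon_weight m \<le> w}"
proof -
  let ?F = "{g :: nat \<Rightarrow> nat. (\<forall>x. (x \<in> {..w} \<longrightarrow> g x \<in> {..w}) \<and> (x \<notin> {..w} \<longrightarrow> g x = 0))}"
  have "Poly_Mapping.lookup ` {m. mon_weight m \<le> w} \<subseteq> ?F"
  proof clarify
    fix m x assume m: "mon_weight m \<le> w"
    have le: "(x + 1) * Poly_Mapping.lookup m x \<le> w"
      using lookup_le_mon_weight[of x m] m by linarith
    have "Poly_Mapping.lookup m x \<le> (x + 1) * Poly_Mapping.lookup m x" by simp
    moreover have "x < w" if "Poly_Mapping.lookup m x \<noteq> 0"
    proof -
      have "x + 1 \<le> (x + 1) * Poly_Mapping.lookup m x"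
        using that mult_le_mono2[of 1 "Poly_Mapping.lookup m x" "x + 1"] by simp
      with le show ?thesis by linarith
    qed
    ultimately show "(x \<in> {..w} \<longrightarrow> Poly_Mapping.lookup m x \<in> {..w})
        \<and> (x \<notin> {..w} \<longrightarrow> Poly_Mapping.lookup m x = 0)"
      using le by fastforce
  qed
  moreover have "finite ?F" by (rule finite_set_of_finite_funs) auto
  ultimately have "finite (Poly_Mapping.lookup ` {m. mon_weight m \<le> w})" by (rule finite_subset)
  then show ?thesis
    by (rule finite_imageD) (auto intro!: inj_onI poly_mapping_eqI)
qed

lemma finite_mfps_mult: "finite {(a, b). a + b = (m :: monom)}"
proof (rule finite_subset)
  show "{(a, b). a + b = m} \<subseteq>
      {a. mon_weight a \<le> mon_weight m} \<times> {b. mon_weight b \<le> mon_weight m}"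
    by (auto simp: mon_weight_add)
qed (simp add: finite_mon_weight_le)

lemma pd_weight:
  assumes "\<forall>m\<in>Poly_Mapping.keys f. int (mon_weight m) \<le> w"
    and "m \<in> Poly_Mapping.keys (pd n f)"
  shows "int (mon_weight m) \<le> w - int (n + 1)"
proof -
  let ?e = "Poly_Mapping.single n 1 :: monom"
  obtain a where a: "a \<in> Poly_Mapping.keys f" "m = a - ?e" "Poly_Mapping.lookup a n \<noteq> 0"
    using assms(2) keys_sum[of "\<lambda>m. Poly_Mapping.single (m - ?e)
      (of_nat (Poly_Mapping.lookup m n) * Poly_Mapping.lookup f m)" "Poly_Mapping.keys f"]
    unfolding pd_def by (force split: if_splits)
  have "m + ?e = a"
    unfolding a(2) monom_minus_var[OF a(3)] by simp
  then have "mon_weight a = mon_weight m + mon_weight ?e" by (metis mon_weight_add)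
  moreover have "mon_weight ?e = n + 1" by (simp add: mon_weight_def)
  ultimately show ?thesis using assms(1) a(1) by force
qed

lemma dp_weight:
  assumes "\<forall>m\<in>Poly_Mapping.keys f. int (mon_weight m) \<le> w"
  shows "\<forall>m\<in>Poly_Mapping.keys (dp n f). int (mon_weight m) \<le> w - int (n + 1)"
proof
  fix m assume "m \<in> Poly_Mapping.keys (dp n f)"
  then obtain a b where "a \<in> Poly_Mapping.keys (cst (1 / fact n))"
    "b \<in> Poly_Mapping.keys (pd n f)" "m = a + b"
    unfolding dp_def using keys_mult by blast
  then have "m \<in> Poly_Mapping.keys (pd n f)" by (auto simp: cst_def split: if_splits)
  then show "int (mon_weight m) \<le> w - int (n + 1)" using assms pd_weight by blast
qed

lemma dp_power_weight:
  assumes "\<forall>m\<in>Poly_Mapping.keys f. int (mon_weight m) \<le> w"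
  shows "\<forall>m\<in>Poly_Mapping.keys ((dp n ^^ r) f). int (mon_weight m) \<le> w - int ((n + 1) * r)"
proof (induction r)
  case (Suc r)
  from dp_weight[OF this, of n] show ?case by (simp add: algebra_simps)
qed (use assms in simp)

lemma mon_diff_eq_0:
  assumes "\<forall>a\<in>Poly_Mapping.keys f. int (mon_weight a) \<le> w" and "w < int (mon_weight m)"
  shows "mon_diff m f = 0"
proof -
  have "\<forall>a\<in>Poly_Mapping.keys (fold (\<lambda>l. dp l ^^ Poly_Mapping.lookup m l) ls f).
     int (mon_weight a) \<le> w - int (\<Sum>l\<leftarrow>ls. (l + 1) * Poly_Mapping.lookup m l)" for ls
    using assms(1)
  proof (induction ls arbitrary: f w)
    case (Cons l ls)
    from Cons.IH[OF dp_power_weight[OF Cons.prems, where n = l and r = "Poly_Mapping.lookup m l"]]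
    show ?case by (simp add: algebra_simps)
  qed simp
  from this[of "sorted_list_of_set (Poly_Mapping.keys m)"]
  have "\<forall>a\<in>Poly_Mapping.keys (mon_diff m f). int (mon_weight a) \<le> w - int (mon_weight m)"
    by (simp add: mon_diff_def mon_weight_def sum_list_distinct_conv_sum_set)
  with assms(2) have "Poly_Mapping.keys (mon_diff m f) = {}" by force
  then show ?thesis by simp
qed

lemma finite_rho_part: "finite {k. Q k * rho_part i j k f \<noteq> 0}"
proof (rule finite_subset)
  let ?w = "\<Sum>a\<in>Poly_Mapping.keys f. mon_weight a"
  have w: "\<forall>a\<in>Poly_Mapping.keys f. int (mon_weight a) \<le> int ?w"
    by (auto simp del: of_nat_sum intro!: member_le_sum)
  show "{k. Q k * rho_part i j k f \<noteq> 0} \<subseteq> {..?w}"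
  proof (rule subsetI, rule ccontr)
    fix k assume nz: "k \<in> {k. Q k * rho_part i j k f \<noteq> 0}" and k: "k \<notin> {..?w}"
    have "rho_part i j k f = 0"
      unfolding rho_part_def
    proof (intro sum.neutral ballI)
      fix m assume "m \<in> {m. mon_degree m = j \<and> mon_weight m = i + 2 * j + k}"
      with k have "int ?w < int (mon_weight m)" by (auto simp del: of_nat_sum)
      from mon_diff_eq_0[OF w this] show "cst (rho_series k m) * mon_diff m f = 0" by simp
    qed
    with nz show False by simp
  qed
qed simp

end

theory Submission
  imports Defs "HOL-Library.FuncSet"
begin

text \<open>
  A partition is encoded by its bead set \<open>S = {\<lambda>\<^sub>i - i}\<close>. A hook of length \<open>m\<close> is a bead at \<open>z + m\<close> with \<open>z\<close>
  empty; moving that bead to \<open>z\<close> yields a partition of \<open>n - m\<close> and lowers each \<open>p\<^sub>l\<close> by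
  \<open>(b + m)\<^sup>l - b\<^sup>l\<close>, where \<open>b = z + 1/2\<close>. Hence the sum over all hooks of length \<open>m\<close> of partitions of \<open>n\<close>
  equals a sum over addable hooks of partitions of \<open>n - m\<close>, with the argument of \<open>f\<close> shifted. For a
  polynomial summand, addable minus removable hooks contribute a linear form in the \<open>Q\<^sub>k\<close>. Iterating
  \<open>t\<close> times and rescaling by \<open>m\<close> produces the operators \<open>\<rho>\<^bsub>i,j\<^esub>\<close>, and summing over \<open>t\<close> and \<open>m\<close> with the
  weight \<open>m\<^sup>-\<^sup>2\<close> produces the derivatives of Eisenstein series.

  Quasimodularity rests on the Bloch-Okounkov theorem, proved here by weight induction: flipping the
  occupation of site \<open>0\<close> gives \<open>\<Sum>\<^sub>c (-1)\<^sup>c q\<^bsup>c(c-1)/2\<^esup> \<langle>exp ((c - 1/2) \<partial>) f\<rangle> = 0\<close>, where \<open>\<partial>\<close> sends \<open>Q\<^sub>k\<close> to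
  \<open>Q\<^bsub>k-1\<^esub>\<close>. This expresses \<open>\<langle>\<partial> f\<rangle>\<close> through brackets of smaller weight, and modulo \<open>Q\<^sub>1\<close> every multiple of
  some \<open>Q\<^sub>a\<close> with \<open>a \<ge> 2\<close> is of the form \<open>\<partial> f\<close>. That the \<open>G\<^sub>k\<close> and their derivatives are polynomials in
  \<open>G\<^sub>2, G\<^sub>4, G\<^sub>6\<close> follows from two elementary identities of Liouville type for the solutions of \<open>a x + b y = n\<close>.
\<close>

section \<open>Evaluation homomorphisms and Taylor expansion\<close>

text \<open>The weight h^(-2) in T_(-1) is the exponent that fits: a term of degree j and weight i +
  2j + k contributes t^j m^(i+j+1) at the t-th iteration, and division by m^2 leaves (m t)^j
  m^(i-1), the pattern of the j-th derivative of G_i. The row i = 0 explains all corrections in the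
  theorem. Its entry j = 0 is <T_(-1)> <f>. For j > 0 its terms are (m t)^(j-1) t, which by the
  symmetry between m and t give a derivative of G_2; hence the summand rho_(0,j+1) at i = 2. Only
  for j = 1 does the constant -1/24 of G_2 matter, and it accounts for the term with
  \<open>del2\<close>. Odd i drop out because the integral defining rho has a parity in v.

  Closure of Q[G_2, G_4, G_6] under q d/dq is the delicate point on the modular side: the general
  family of convolution identities expresses the derivative of G_6 through G_8, so one identity
  outside the family, G_8 = 120 G_4^2, has to start the induction.\<close>

definition rat_hom :: "(rat \<Rightarrow> 'r::comm_ring_1) \<Rightarrow> bool" where
  "rat_hom \<kappa> \<longleftrightarrow> \<kappa> 0 = 0 \<and> \<kappa> 1 = 1 \<and> (\<forall>a b. \<kappa> (a + b) = \<kappa> a + \<kappa> b) \<and> (\<forall>a b. \<kappa> (a * b) = \<kappa> a * \<kappa> b)"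

definition mon_val :: "(nat \<Rightarrow> 'r::comm_semiring_1) \<Rightarrow> monom \<Rightarrow> 'r" where
  "mon_val x m = (\<Prod>n\<in>Poly_Mapping.keys m. x n ^ Poly_Mapping.lookup m n)"

text \<open>The coefficient map \<open>\<kappa>\<close> is a parameter because the target ring
  varies: rationals when evaluating on bead sets, polynomials over \<open>shsym\<close> when
  defining \<open>shift_poly\<close>.\<close>

definition hev :: "(rat \<Rightarrow> 'r::comm_ring_1) \<Rightarrow> (nat \<Rightarrow> 'r) \<Rightarrow> shsym \<Rightarrow> 'r" where
  "hev \<kappa> x f = (\<Sum>m\<in>Poly_Mapping.keys f. \<kappa> (Poly_Mapping.lookup f m) * mon_val x m)"

lemma rat_hom_id: "rat_hom (\<lambda>c. c)"
  by (simp add: rat_hom_def)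

lemma mon_val_superset:
  assumes "finite S" "Poly_Mapping.keys m \<subseteq> S"
  shows "mon_val x m = (\<Prod>n\<in>S. x n ^ Poly_Mapping.lookup m n)"
  unfolding mon_val_def using assms
  by (intro prod.mono_neutral_left) (auto simp: in_keys_iff)

lemma mon_val_0 [simp]: "mon_val x 0 = 1"
  by (simp add: mon_val_def)

lemma mon_val_single [simp]: "mon_val x (Poly_Mapping.single n k) = x n ^ k"
  using mon_val_superset[of "{n}" "Poly_Mapping.single n k" x] by simp

lemma mon_val_add: "mon_val x (a + b) = mon_val x a * mon_val x b"
proof -
  let ?S = "Poly_Mapping.keys a \<union> Poly_Mapping.keys b"
  have S: "finite ?S" "Poly_Mapping.keys a \<subseteq> ?S" "Poly_Mapping.keys b \<subseteq> ?S"
    "Poly_Mapping.keys (a + b) \<subseteq> ?S"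
    using keys_add[of a b] by auto
  show ?thesis
    unfolding mon_val_superset[OF S(1,2)] mon_val_superset[OF S(1,3)] mon_val_superset[OF S(1,4)]
    by (simp add: lookup_add power_add prod.distrib)
qed

lemma hev_superset:
  assumes "rat_hom \<kappa>" "finite S" "Poly_Mapping.keys f \<subseteq> S"
  shows "hev \<kappa> x f = (\<Sum>m\<in>S. \<kappa> (Poly_Mapping.lookup f m) * mon_val x m)"
  unfolding hev_def using assms
  by (intro sum.mono_neutral_left) (auto simp: in_keys_iff rat_hom_def)

lemma hev_zero [simp]: "hev \<kappa> x 0 = 0"
  by (simp add: hev_def)

lemma hev_add:
  assumes "rat_hom \<kappa>"
  shows "hev \<kappa> x (f + g) = hev \<kappa> x f + hev \<kappa> x g"
proof -
  let ?S = "Poly_Mapping.keys f \<union> Poly_Mapping.keys g"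
  have S: "finite ?S" "Poly_Mapping.keys f \<subseteq> ?S" "Poly_Mapping.keys g \<subseteq> ?S"
    "Poly_Mapping.keys (f + g) \<subseteq> ?S"
    using keys_add[of f g] by auto
  show ?thesis
    unfolding hev_superset[OF assms S(1,2)] hev_superset[OF assms S(1,3)] hev_superset[OF assms S(1,4)]
    using assms by (simp add: lookup_add sum.distrib[symmetric] rat_hom_def algebra_simps)
qed

lemma hev_sum:
  assumes "rat_hom \<kappa>"
  shows "hev \<kappa> x (sum F A) = (\<Sum>a\<in>A. hev \<kappa> x (F a))"
  by (induction A rule: infinite_finite_induct) (auto simp: hev_add[OF assms])

lemma hev_single:
  assumes "rat_hom \<kappa>"
  shows "hev \<kappa> x (Poly_Mapping.single m c) = \<kappa> c * mon_val x m"
  using hev_superset[OF assms, of "{m}" "Poly_Mapping.single m c" x] by simp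

lemma hev_mult:
  assumes "rat_hom \<kappa>"
  shows "hev \<kappa> x (f * g) = hev \<kappa> x f * hev \<kappa> x g"
proof -
  define F where "F = (\<lambda>m. Poly_Mapping.single m (Poly_Mapping.lookup f m))"
  define G where "G = (\<lambda>m. Poly_Mapping.single m (Poly_Mapping.lookup g m))"
  have f: "f = (\<Sum>a\<in>Poly_Mapping.keys f. F a)" and g: "g = (\<Sum>b\<in>Poly_Mapping.keys g. G b)"
    unfolding F_def G_def by (rule poly_mapping_sum_singles)+
  have "hev \<kappa> x (sum F A * sum G B) = hev \<kappa> x (sum F A) * hev \<kappa> x (sum G B)" for A B
  proof -
    have "hev \<kappa> x (F a * G b) = hev \<kappa> x (F a) * hev \<kappa> x (G b)" for a b
      using assms by (simp add: F_def G_def mult_single hev_single mon_val_add rat_hom_def algebra_simps)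
    then show ?thesis
      unfolding sum_product hev_sum[OF assms] by simp
  qed
  then show ?thesis using f g by metis
qed

lemma hev_cst: "rat_hom \<kappa> \<Longrightarrow> hev \<kappa> x (cst c) = \<kappa> c"
  by (simp add: cst_def hev_single)

lemma cst_1: "cst 1 = 1"
  by (simp add: cst_def)

lemma hev_one: "rat_hom \<kappa> \<Longrightarrow> hev \<kappa> x 1 = 1"
  using hev_cst[of \<kappa> x 1] by (simp add: cst_1 rat_hom_def)

lemma hev_Q_Suc: "rat_hom \<kappa> \<Longrightarrow> hev \<kappa> x (Q (Suc n)) = x n"
  by (simp add: Q_def hev_single rat_hom_def)

lemma sheval_hev: "sheval f xs = hev (\<lambda>c. c) (\<lambda>n. Qfun (n + 1) xs) f"
  by (simp add: sheval_def hev_def mon_val_def)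

lemma sheval_add: "sheval (f + g) xs = sheval f xs + sheval g xs"
  and sheval_mult: "sheval (f * g) xs = sheval f xs * sheval g xs"
  and sheval_cst: "sheval (cst c) xs = c"
  and sheval_zero: "sheval 0 xs = 0"
  and sheval_one: "sheval 1 xs = 1"
  by (simp_all add: sheval_hev hev_add hev_mult hev_cst hev_one rat_hom_id)

lemma dp_single:
  "dp l (Poly_Mapping.single a c) =
     Poly_Mapping.single (a - Poly_Mapping.single l 1) (of_nat (Poly_Mapping.lookup a l) * c / fact l)"
  by (simp add: dp_def cst_def pd_single mult_single)

lemma dp_power_single:
  "(dp l ^^ k) (Poly_Mapping.single a c) =
     Poly_Mapping.single (a - Poly_Mapping.single l k)
       (c * (fact k * of_nat (Poly_Mapping.lookup a l choose k) / fact l ^ k))"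
proof (induction k)
  case 0
  then show ?case by simp
next
  case (Suc k)
  let ?a = "Poly_Mapping.lookup a l"
  have 1: "a - Poly_Mapping.single l k - Poly_Mapping.single l (Suc 0) = a - Poly_Mapping.single l (Suc k)"
    by (rule poly_mapping_eqI) (auto simp: lookup_minus lookup_single when_def)
  have "(?a - k) * (?a choose k) = Suc k * (?a choose Suc k)"
    by (metis binomial_absorption binomial_absorb_comp)
  then have 2: "rat_of_nat (?a - k) * of_nat (?a choose k) = of_nat (Suc k) * of_nat (?a choose Suc k)"
    by (metis of_nat_mult)
  have 3: "of_nat (?a - k) * (c * (fact k * of_nat (?a choose k) / fact l ^ k)) / fact l
     = c * (fact (Suc k) * of_nat (?a choose Suc k) / fact l ^ (Suc k))"
  proof -
    have "of_nat (?a - k) * (c * (fact k * of_nat (?a choose k) / fact l ^ k)) / fact l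
       = c * fact k * (of_nat (?a - k) * of_nat (?a choose k)) / fact l ^ Suc k" by (simp add: mult_ac)
    also have "\<dots> = c * (fact (Suc k) * of_nat (?a choose Suc k) / fact l ^ (Suc k))"
      unfolding 2 by (simp add: algebra_simps)
    finally show ?thesis .
  qed
  show ?case
    using 1 3 by (simp add: Suc.IH dp_single lookup_minus)
qed

lemma mon_diff_single:
  "mon_diff m (Poly_Mapping.single a c) =
     Poly_Mapping.single (a - m)
       (c * (\<Prod>l\<in>Poly_Mapping.keys m. fact (Poly_Mapping.lookup m l)
          * of_nat (Poly_Mapping.lookup a l choose Poly_Mapping.lookup m l) / fact l ^ Poly_Mapping.lookup m l))"
proof -
  \<comment> \<open>Stated for any distinct list, so that the head can be split off; the derivations
    already applied leave the exponents of the remaining indices untouched.\<close>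
  have "fold (\<lambda>l. dp l ^^ Poly_Mapping.lookup m l) ls (Poly_Mapping.single a c) =
     Poly_Mapping.single (a - (\<Sum>l\<in>set ls. Poly_Mapping.single l (Poly_Mapping.lookup m l)))
       (c * (\<Prod>l\<in>set ls. fact (Poly_Mapping.lookup m l)
          * of_nat (Poly_Mapping.lookup a l choose Poly_Mapping.lookup m l) / fact l ^ Poly_Mapping.lookup m l))"
    if "distinct ls" for ls
    using that
  proof (induction ls arbitrary: a c)
    case Nil
    then show ?case by simp
  next
    case (Cons l ls)
    have 1: "a - Poly_Mapping.single l (Poly_Mapping.lookup m l) - (\<Sum>l\<in>set ls. Poly_Mapping.single l (Poly_Mapping.lookup m l))
      = a - (Poly_Mapping.single l (Poly_Mapping.lookup m l) + (\<Sum>l\<in>set ls. Poly_Mapping.single l (Poly_Mapping.lookup m l)))"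
      by (rule poly_mapping_eqI) (auto simp: lookup_minus lookup_add)
    have 2: "(\<Prod>k\<in>set ls. fact (Poly_Mapping.lookup m k)
          * of_nat (Poly_Mapping.lookup (a - Poly_Mapping.single l (Poly_Mapping.lookup m l)) k choose Poly_Mapping.lookup m k) / fact k ^ Poly_Mapping.lookup m k)
      = (\<Prod>k\<in>set ls. fact (Poly_Mapping.lookup m k)
          * of_nat (Poly_Mapping.lookup a k choose Poly_Mapping.lookup m k) / fact k ^ Poly_Mapping.lookup m k :: rat)"
      using Cons.prems by (intro prod.cong) (auto simp: lookup_minus lookup_single when_def)
    show ?case
      using Cons.prems Cons.IH by (simp add: dp_power_single 1 2 mult_ac)
  qed
  from this[of "sorted_list_of_set (Poly_Mapping.keys m)"]
  show ?thesis
    using poly_mapping_sum_singles[of m] unfolding mon_diff_def by simp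
qed

lemma mon_diff_add: "mon_diff m (f + g) = mon_diff m f + mon_diff m g"
proof -
  have 1: "dp l (f + g) = dp l f + dp l g" for l f g
    by (simp add: dp_def pd_add algebra_simps)
  have 2: "(dp l ^^ k) (f + g) = (dp l ^^ k) f + (dp l ^^ k) g" for l k f g
    by (induction k) (auto simp: 1)
  have "fold (\<lambda>l. dp l ^^ Poly_Mapping.lookup m l) ls (f + g) =
     fold (\<lambda>l. dp l ^^ Poly_Mapping.lookup m l) ls f + fold (\<lambda>l. dp l ^^ Poly_Mapping.lookup m l) ls g" for ls
    by (induction ls arbitrary: f g) (auto simp: 2)
  then show ?thesis by (simp add: mon_diff_def)
qed

lemma mon_diff_zero [simp]: "mon_diff m 0 = 0"
  using mon_diff_add[of m 0 0] by (metis add_cancel_right_right)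

lemma mon_diff_sum: "mon_diff m (sum F A) = (\<Sum>a\<in>A. mon_diff m (F a))"
  by (induction A rule: infinite_finite_induct) (auto simp: mon_diff_add)

lemma mon_weight_mono:
  assumes "\<And>l. Poly_Mapping.lookup m l \<le> Poly_Mapping.lookup a l"
  shows "mon_weight m \<le> mon_weight a"
proof -
  have "a = m + (a - m)"
    using assms by (intro poly_mapping_eqI) (simp add: lookup_add lookup_minus)
  then show ?thesis by (metis mon_weight_add le_add1)
qed

text \<open>Multiplying out one binomial theorem per variable sums over choice functions on the
  support of \<open>a\<close>; these are the monomials dividing \<open>a\<close>.\<close>

lemma mon_val_binomial:
  fixes x y :: "nat \<Rightarrow> 'r::comm_ring_1"
  shows "mon_val (\<lambda>n. x n + y n) a =
    (\<Sum>m | \<forall>l. Poly_Mapping.lookup m l \<le> Poly_Mapping.lookup a l.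
       (\<Prod>l\<in>Poly_Mapping.keys a. of_nat (Poly_Mapping.lookup a l choose Poly_Mapping.lookup m l)
          * y l ^ Poly_Mapping.lookup m l * x l ^ (Poly_Mapping.lookup a l - Poly_Mapping.lookup m l)))"
proof -
  let ?K = "Poly_Mapping.keys a"
  let ?t = "\<lambda>l j. of_nat (Poly_Mapping.lookup a l choose j) * y l ^ j * x l ^ (Poly_Mapping.lookup a l - j)"
  \<comment> \<open>A choice function is undefined off the support, an exponent vector is 0 there;
    \<open>?inv\<close> translates.\<close>
  let ?inv = "\<lambda>g. Abs_poly_mapping (\<lambda>l. if l \<in> ?K then g l else (0::nat))"
  have lk: "Poly_Mapping.lookup (?inv g) = (\<lambda>l. if l \<in> ?K then g l else 0)" for g
  proof (rule lookup_Abs_poly_mapping)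
    show "finite {l. (if l \<in> ?K then g l else 0) \<noteq> 0}"
      by (rule finite_subset[of _ ?K]) auto
  qed
  have "mon_val (\<lambda>n. x n + y n) a = (\<Prod>l\<in>?K. \<Sum>j\<in>{..Poly_Mapping.lookup a l}. ?t l j)"
    unfolding mon_val_def by (intro prod.cong refl) (subst add.commute, simp add: binomial_ring)
  also have "\<dots> = (\<Sum>g\<in>PiE ?K (\<lambda>l. {..Poly_Mapping.lookup a l}). \<Prod>l\<in>?K. ?t l (g l))"
    by (rule prod_sum_PiE) auto
  also have "\<dots> = (\<Sum>m | \<forall>l. Poly_Mapping.lookup m l \<le> Poly_Mapping.lookup a l. \<Prod>l\<in>?K. ?t l (Poly_Mapping.lookup m l))"
  proof (rule sum.reindex_bij_witness[of _ "\<lambda>m. restrict (Poly_Mapping.lookup m) ?K" ?inv])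
    fix g assume g: "g \<in> PiE ?K (\<lambda>l. {..Poly_Mapping.lookup a l})"
    show "restrict (Poly_Mapping.lookup (?inv g)) ?K = g"
      using g by (auto simp: lk fun_eq_iff restrict_def PiE_def extensional_def)
    show "?inv g \<in> {m. \<forall>l. Poly_Mapping.lookup m l \<le> Poly_Mapping.lookup a l}"
      using g by (auto simp: lk PiE_def Pi_def)
    show "(\<Prod>l\<in>?K. ?t l (Poly_Mapping.lookup (?inv g) l)) = (\<Prod>l\<in>?K. ?t l (g l))"
      by (intro prod.cong) (auto simp: lk)
  next
    fix m assume m: "m \<in> {m. \<forall>l. Poly_Mapping.lookup m l \<le> Poly_Mapping.lookup a l}"
    show "?inv (restrict (Poly_Mapping.lookup m) ?K) = m"
    proof (rule poly_mapping_eqI)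
      fix l
      show "Poly_Mapping.lookup (?inv (restrict (Poly_Mapping.lookup m) ?K)) l = Poly_Mapping.lookup m l"
        using m by (auto simp: lk in_keys_iff) (metis le_zero_eq)
    qed
    show "restrict (Poly_Mapping.lookup m) ?K \<in> PiE ?K (\<lambda>l. {..Poly_Mapping.lookup a l})"
      using m by (auto simp: PiE_def Pi_def)
  qed
  finally show ?thesis .
qed

text \<open>As p_n = n! Q_(n+1), shifting variable n by \<open>y n / fact n\<close> shifts p_n by
  \<open>y n\<close>, so the derivatives are those of \<open>mon_diff\<close>. The cut at
  \<open>w\<close> loses nothing, since a monomial of weight above \<open>w\<close> divides no
  monomial of \<open>f\<close>.\<close>

lemma taylor:
  fixes x y :: "nat \<Rightarrow> rat"
  assumes "\<forall>m\<in>Poly_Mapping.keys f. mon_weight m \<le> w"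
  shows "hev (\<lambda>c. c) (\<lambda>n. x n + y n / fact n) f =
    (\<Sum>m | mon_weight m \<le> w. (\<Prod>l\<in>Poly_Mapping.keys m. y l ^ Poly_Mapping.lookup m l / fact (Poly_Mapping.lookup m l))
        * hev (\<lambda>c. c) x (mon_diff m f))"
proof -
  let ?ev = "hev (\<lambda>c. c)" and ?L = "Poly_Mapping.lookup"
  let ?c = "\<lambda>m. \<Prod>l\<in>Poly_Mapping.keys m. y l ^ ?L m l / fact (?L m l)"
  have single: "?ev (\<lambda>n. x n + y n / fact n) (Poly_Mapping.single a c) =
    (\<Sum>m | mon_weight m \<le> w. ?c m * ?ev x (mon_diff m (Poly_Mapping.single a c)))"
    if a: "mon_weight a \<le> w" for a c
  proof -
    let ?A = "{m. \<forall>l. ?L m l \<le> ?L a l}"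
    let ?t = "\<lambda>m. \<Prod>l\<in>Poly_Mapping.keys a. of_nat (?L a l choose ?L m l)
          * (y l / fact l) ^ ?L m l * x l ^ (?L a l - ?L m l)"
    have t: "?c m * ?ev x (mon_diff m (Poly_Mapping.single a c)) = (if m \<in> ?A then c * ?t m else 0)" for m
    proof -
      have e: "?c m * ?ev x (mon_diff m (Poly_Mapping.single a c)) =
         c * (\<Prod>l\<in>Poly_Mapping.keys m. of_nat (?L a l choose ?L m l) * (y l / fact l) ^ ?L m l) * mon_val x (a - m)"
        by (simp add: mon_diff_single hev_single rat_hom_id prod.distrib prod_dividef power_divide field_simps)
      show ?thesis
      proof (cases "m \<in> ?A")
        case True
        then have s: "Poly_Mapping.keys m \<subseteq> Poly_Mapping.keys a"
          by (auto simp: in_keys_iff) (metis less_le_trans)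
        have "(\<Prod>l\<in>Poly_Mapping.keys m. of_nat (?L a l choose ?L m l) * (y l / fact l) ^ ?L m l)
           = (\<Prod>l\<in>Poly_Mapping.keys a. of_nat (?L a l choose ?L m l) * (y l / fact l) ^ ?L m l)"
          using s by (intro prod.mono_neutral_left) (auto simp: in_keys_iff)
        moreover have "mon_val x (a - m) = (\<Prod>l\<in>Poly_Mapping.keys a. x l ^ (?L a l - ?L m l))"
          by (subst mon_val_superset[of "Poly_Mapping.keys a"]) (auto simp: lookup_minus in_keys_iff)
        ultimately show ?thesis using True e by (simp add: prod.distrib)
      next
        case False
        then obtain l where l: "?L m l > ?L a l" by (auto simp: not_le)
        then have "l \<in> Poly_Mapping.keys m" by (auto simp: in_keys_iff)
        then have "(\<Prod>l\<in>Poly_Mapping.keys m. of_nat (?L a l choose ?L m l) * (y l / fact l) ^ ?L m l) = (0::rat)"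
          using l by (intro prod_zero) auto
        then show ?thesis using False e by auto
      qed
    qed
    have sub: "?A \<subseteq> {m. mon_weight m \<le> w}"
      using a mon_weight_mono order_trans by blast
    have "(\<Sum>m | mon_weight m \<le> w. ?c m * ?ev x (mon_diff m (Poly_Mapping.single a c)))
       = (\<Sum>m\<in>?A. c * ?t m)"
      unfolding t using sub finite_mon_weight_le[of w]
      by (intro sum.mono_neutral_cong_right) auto
    also have "\<dots> = c * mon_val (\<lambda>n. x n + y n / fact n) a"
      by (simp add: mon_val_binomial sum_distrib_left)
    finally show ?thesis by (simp add: hev_single rat_hom_id)
  qed
  let ?F = "\<lambda>m. Poly_Mapping.single m (?L f m)"
  have "?ev (\<lambda>n. x n + y n / fact n) (\<Sum>a\<in>Poly_Mapping.keys f. ?F a) =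
     (\<Sum>a\<in>Poly_Mapping.keys f. \<Sum>m | mon_weight m \<le> w. ?c m * ?ev x (mon_diff m (?F a)))"
    unfolding hev_sum[OF rat_hom_id] using assms by (intro sum.cong refl single) auto
  also have "\<dots> = (\<Sum>m | mon_weight m \<le> w. ?c m * ?ev x (mon_diff m (\<Sum>a\<in>Poly_Mapping.keys f. ?F a)))"
    unfolding mon_diff_sum hev_sum[OF rat_hom_id] sum_distrib_left by (rule sum.swap)
  finally show ?thesis
    using poly_mapping_sum_singles[of f] by simp
qed

section \<open>The coefficients of the series \<open>\<rho>\<^bsup>(k)\<^esup>\<close>\<close>

definition ifact :: "monom \<Rightarrow> rat" where
  "ifact m = (\<Prod>l\<in>Poly_Mapping.keys m. 1 / fact (Poly_Mapping.lookup m l))"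

definition lin_series :: "(nat \<Rightarrow> rat poly) \<Rightarrow> rat poly mfps" where
  "lin_series c a = (\<Sum>n\<in>Poly_Mapping.keys a. if a = Poly_Mapping.single n 1 then c n else 0)"

text \<open>
  The coefficient of \<open>u\<^sub>l\<close> in \<open>U(t) - U(t - 1)\<close>, as a polynomial in \<open>t\<close>.
\<close>

definition cpoly :: "nat \<Rightarrow> rat poly" where
  "cpoly l = [:0, 1:] ^ l - [:- 1, 1:] ^ l"

text \<open>The coefficient of the monomial \<open>m\<close> in exp(U(t) - U(t - 1)), a polynomial
  in t.\<close>

definition mpoly :: "monom \<Rightarrow> rat poly" where
  "mpoly m = smult (ifact m) (mon_val cpoly m)"

lemma mon_degree_superset:
  assumes "finite S" "Poly_Mapping.keys m \<subseteq> S"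
  shows "mon_degree m = (\<Sum>l\<in>S. Poly_Mapping.lookup m l)"
  unfolding mon_degree_def using assms
  by (intro sum.mono_neutral_left) (auto simp: in_keys_iff)

lemma mon_degree_add: "mon_degree (a + b) = mon_degree a + mon_degree b"
proof -
  let ?S = "Poly_Mapping.keys a \<union> Poly_Mapping.keys b"
  have S: "finite ?S" "Poly_Mapping.keys a \<subseteq> ?S" "Poly_Mapping.keys b \<subseteq> ?S"
    "Poly_Mapping.keys (a + b) \<subseteq> ?S"
    using keys_add[of a b] by auto
  show ?thesis
    unfolding mon_degree_superset[OF S(1,2)] mon_degree_superset[OF S(1,3)]
      mon_degree_superset[OF S(1,4)]
    by (simp add: lookup_add sum.distrib)
qed

lemma mon_degree_0 [simp]: "mon_degree 0 = 0"
  and mon_weight_0 [simp]: "mon_weight 0 = 0"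
  and mon_degree_single [simp]: "mon_degree (Poly_Mapping.single n k) = k"
  and mon_weight_single [simp]: "mon_weight (Poly_Mapping.single n k) = (n + 1) * k"
  by (auto simp: mon_degree_def mon_weight_def)

lemma mon_degree_eq_0_iff: "mon_degree m = 0 \<longleftrightarrow> m = 0"
proof
  assume "mon_degree m = 0"
  then have "Poly_Mapping.lookup m l = 0" for l
    by (cases "l \<in> Poly_Mapping.keys m") (auto simp: mon_degree_def in_keys_iff)
  then show "m = 0" by (intro poly_mapping_eqI) simp
qed simp

lemma monom_decompose:
  fixes m :: monom
  assumes "n \<in> Poly_Mapping.keys m"
  shows "Poly_Mapping.single n 1 + (m - Poly_Mapping.single n 1) = m"
  using assms by (intro poly_mapping_eqI) (auto simp: lookup_add lookup_minus lookup_single when_def in_keys_iff)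

lemma ifact_superset:
  assumes "finite S" "Poly_Mapping.keys m \<subseteq> S"
  shows "ifact m = (\<Prod>l\<in>S. 1 / fact (Poly_Mapping.lookup m l))"
  unfolding ifact_def using assms
  by (intro prod.mono_neutral_left) (auto simp: in_keys_iff)

lemma ifact_decompose:
  assumes "n \<in> Poly_Mapping.keys m"
  shows "ifact (m - Poly_Mapping.single n 1) = of_nat (Poly_Mapping.lookup m n) * ifact m"
proof -
  let ?K = "Poly_Mapping.keys m"
  obtain k where k: "Poly_Mapping.lookup m n = Suc k"
    using assms by (auto simp: in_keys_iff gr0_conv_Suc)
  have 1: "ifact (m - Poly_Mapping.single n 1) = (\<Prod>l\<in>?K. 1 / fact (Poly_Mapping.lookup m l - (if l = n then 1 else 0)))"
  proof (subst ifact_superset[of ?K])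
    show "Poly_Mapping.keys (m - Poly_Mapping.single n 1) \<subseteq> ?K"
      by (auto simp: in_keys_iff lookup_minus)
  qed (auto simp: lookup_minus lookup_single when_def intro!: prod.cong)
  have 2: "(\<Prod>l\<in>?K - {n}. 1 / fact (Poly_Mapping.lookup m l - (if l = n then 1 else 0)))
     = (\<Prod>l\<in>?K - {n}. 1 / fact (Poly_Mapping.lookup m l) :: rat)"
    by (intro prod.cong) auto
  have 3: "1 / fact k = (of_nat (Suc k) / fact (Suc k) :: rat)"
    by (simp add: field_simps del: of_nat_Suc)
  show ?thesis
    unfolding 1 ifact_def[of m] prod.remove[OF finite_keys assms] 2 using 3 by (simp add: k)
qed

lemma mfps_mult_lin:
  "mfps_mult (lin_series c) G m = (\<Sum>n\<in>Poly_Mapping.keys m. c n * G (m - Poly_Mapping.single n 1))"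
proof -
  let ?K = "Poly_Mapping.keys m"
  let ?h = "\<lambda>n. (Poly_Mapping.single n 1 :: monom, m - Poly_Mapping.single n 1)"
  have sinj: "x = y" if "Poly_Mapping.single x (Suc 0) = (Poly_Mapping.single y (Suc 0) :: monom)" for x y :: nat
    using arg_cong[OF that, of Poly_Mapping.keys] by simp
  have lin1: "lin_series c (Poly_Mapping.single n 1) = c n" for n
    by (simp add: lin_series_def)
  have "mfps_mult (lin_series c) G m = (\<Sum>(a, b)\<in>?h ` ?K. lin_series c a * G b)"
    unfolding mfps_mult_def
  proof (rule sum.mono_neutral_right)
    show "?h ` ?K \<subseteq> {(a, b). a + b = m}"
      by (auto simp: monom_decompose[unfolded One_nat_def])
    show "\<forall>i\<in>{(a, b). a + b = m} - ?h ` ?K. (case i of (a, b) \<Rightarrow> lin_series c a * G b) = 0"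
    proof
      fix i assume i: "i \<in> {(a, b). a + b = m} - ?h ` ?K"
      obtain a b where ab: "i = (a, b)" by (cases i)
      with i have m: "m = a + b" by auto
      have "lin_series c a = 0"
      proof (rule ccontr)
        assume "lin_series c a \<noteq> 0"
        moreover have "lin_series c a = 0" if "\<And>n. a \<noteq> Poly_Mapping.single n 1"
          unfolding lin_series_def using that by (intro sum.neutral) auto
        ultimately obtain n where a: "a = Poly_Mapping.single n 1" by blast
        have "i = ?h n" unfolding ab m a by (simp only: add_diff_cancel_left')
        moreover have "n \<in> ?K" unfolding m a by (simp add: in_keys_iff lookup_add)
        ultimately have "i \<in> ?h ` ?K" by (rule image_eqI)
        with i show False by (rule DiffD2)
      qed
      then show "(case i of (a, b) \<Rightarrow> lin_series c a * G b) = 0" by (simp add: ab)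
    qed
  qed (rule finite_mfps_mult)
  also have "\<dots> = (\<Sum>n\<in>?K. lin_series c (Poly_Mapping.single n 1) * G (m - Poly_Mapping.single n 1))"
    by (subst sum.reindex) (auto simp: inj_on_def dest: sinj)
  finally show ?thesis by (simp add: lin1[unfolded One_nat_def])
qed

text \<open>The multinomial theorem, by peeling off one variable: each n in the support contributes
  in proportion to its exponent, and the exponents add up to \<open>Suc j\<close>.\<close>

lemma lin_series_power:
  "(mfps_mult (lin_series c) ^^ j) mfps_one m =
     (if mon_degree m = j then smult (fact j * ifact m) (mon_val c m) else 0)"
proof (induction j arbitrary: m)
  case 0
  then show ?case
    by (auto simp: mfps_one_def mon_degree_eq_0_iff ifact_def)
next
  case (Suc j)
  let ?e = "\<lambda>n. Poly_Mapping.single n 1 :: monom"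
  have deg: "mon_degree m = Suc (mon_degree (m - ?e n))" if "n \<in> Poly_Mapping.keys m" for n
    using mon_degree_add[of "?e n" "m - ?e n"] unfolding monom_decompose[OF that] by simp
  have val: "mon_val c m = c n * mon_val c (m - ?e n)" if "n \<in> Poly_Mapping.keys m" for n
    using mon_val_add[of c "?e n" "m - ?e n"] unfolding monom_decompose[OF that] by simp
  have "(mfps_mult (lin_series c) ^^ Suc j) mfps_one m
     = (\<Sum>n\<in>Poly_Mapping.keys m. c n * ((mfps_mult (lin_series c) ^^ j) mfps_one (m - ?e n)))"
    by (simp add: mfps_mult_lin)
  also have "\<dots> = (\<Sum>n\<in>Poly_Mapping.keys m. if mon_degree m = Suc j
        then smult (of_nat (Poly_Mapping.lookup m n) * (fact j * ifact m)) (mon_val c m) else 0)"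
  proof (rule sum.cong[OF refl])
    fix n assume n: "n \<in> Poly_Mapping.keys m"
    show "c n * ((mfps_mult (lin_series c) ^^ j) mfps_one (m - ?e n)) =
      (if mon_degree m = Suc j
        then smult (of_nat (Poly_Mapping.lookup m n) * (fact j * ifact m)) (mon_val c m) else 0)"
      unfolding Suc.IH using deg[OF n] val[OF n] ifact_decompose[OF n] by (simp add: mult_ac)
  qed
  also have "\<dots> = (if mon_degree m = Suc j then smult (fact (Suc j) * ifact m) (mon_val c m) else 0)"
  proof (cases "mon_degree m = Suc j")
    case True
    have "(\<Sum>n\<in>Poly_Mapping.keys m. smult (of_nat (Poly_Mapping.lookup m n) * (fact j * ifact m)) (mon_val c m))
       = smult ((\<Sum>n\<in>Poly_Mapping.keys m. of_nat (Poly_Mapping.lookup m n)) * (fact j * ifact m)) (mon_val c m)"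
      by (simp add: smult_sum sum_distrib_right)
    also have "(\<Sum>n\<in>Poly_Mapping.keys m. of_nat (Poly_Mapping.lookup m n)) = (of_nat (Suc j) :: rat)"
      using True unfolding mon_degree_def of_nat_sum[symmetric] by simp
    finally show ?thesis using True by (simp add: algebra_simps)
  qed simp
  finally show ?case .
qed

lemma mfps_exp_lin: "mfps_exp (lin_series c) m = smult (ifact m) (mon_val c m)"
proof -
  have "mfps_exp (lin_series c) m = (\<Sum>j\<le>mon_degree m. if j = mon_degree m then smult (ifact m) (mon_val c m) else 0)"
    unfolding mfps_exp_def lin_series_power by (intro sum.cong) auto
  then show ?thesis by simp
qed

lemma rho_series_mpoly: "rho_series k m = fact k * coeff (unit_integral (mpoly m)) k"
proof -
  \<comment> \<open>\<open>Useries\<close> has no variable of index 0; \<open>cpoly 0 = 0\<close>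
    makes both sides agree there.\<close>
  have "(\<lambda>a. Useries [:0, 1:] a - Useries [:- 1, 1:] a) = lin_series cpoly"
    unfolding Useries_def lin_series_def cpoly_def sum_subtractf[symmetric]
    by (intro ext sum.cong refl) (auto simp: not_le)
  then show ?thesis by (simp add: rho_series_def mfps_exp_lin mpoly_def)
qed

lemma coeff_linear_power_all:
  "coeff ([:a, b:] ^ n) i = of_nat (n choose i) * b ^ i * (a :: rat) ^ (n - i)"
proof (cases "i \<le> n")
  case False
  have "Polynomial.degree ([:a, b:] ^ n) \<le> Polynomial.degree [:a, b:] * n"
    by (rule degree_power_le)
  also have "\<dots> \<le> 1 * n" by (intro mult_le_mono1) simp
  finally show ?thesis using False by (simp add: coeff_eq_0 binomial_eq_0)
qed (rule coeff_linear_poly_power)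

text \<open>The integral of t^n is ((v + 1)^(n+1) - v^(n+1)) / (n+1), and the guard
  \<open>k \<le> n\<close> reflects that its coefficient at v^(n+1) cancels.\<close>

lemma coeff_unit_integral:
  "coeff (unit_integral p) k =
     (\<Sum>n\<le>Polynomial.degree p. coeff p n * (if k \<le> n then of_nat (Suc n choose k) / of_nat (Suc n) else 0))"
proof -
  have m: "pcompose (Polynomial.monom c n) [:1, 1:] = smult c ([:1, 1:] ^ n)" for c :: rat and n
    by (induction n) (simp_all add: monom_0 monom_Suc pcompose_pCons algebra_simps)
  have "unit_integral p = (\<Sum>i\<le>Polynomial.degree p.
      smult (coeff p i / of_nat (Suc i)) ([:1, 1:] ^ Suc i) - Polynomial.monom (coeff p i / of_nat (Suc i)) (Suc i))"
    unfolding unit_integral_def antiderivative_def pcompose_sum m sum_subtractf Suc_eq_plus1 ..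
  then have "coeff (unit_integral p) k = (\<Sum>i\<le>Polynomial.degree p.
      coeff p i / of_nat (Suc i) * of_nat (Suc i choose k) - (if Suc i = k then coeff p i / of_nat (Suc i) else 0))"
    by (simp only: coeff_sum coeff_diff coeff_smult coeff_linear_power_all coeff_monom power_one mult_1_right)
  also have "\<dots> = (\<Sum>n\<le>Polynomial.degree p. coeff p n * (if k \<le> n then of_nat (Suc n choose k) / of_nat (Suc n) else 0))"
  proof (intro sum.cong refl)
    fix i
    show "coeff p i / of_nat (Suc i) * of_nat (Suc i choose k) - (if Suc i = k then coeff p i / of_nat (Suc i) else 0)
      = coeff p i * (if k \<le> i then of_nat (Suc i choose k) / of_nat (Suc i) else 0)"
      by (cases "k \<le> i"; cases "k = Suc i") (simp_all add: binomial_eq_0 del: binomial_Suc_Suc)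
  qed
  finally show ?thesis .
qed

lemma coeff_cpoly: "coeff (cpoly l) i = (if i = l then 1 else 0) - of_nat (l choose i) * (-1) ^ (l - i)"
  by (auto simp: cpoly_def coeff_linear_power_all power_0_left binomial_eq_0)

lemma cpoly_0 [simp]: "cpoly 0 = 0"
  by (simp add: cpoly_def)

lemma degree_cpoly: "Polynomial.degree (cpoly l) \<le> l - 1"
  by (rule degree_le) (auto simp: coeff_cpoly binomial_eq_0)

lemma mpoly_eq_0: "0 \<in> Poly_Mapping.keys m \<Longrightarrow> mpoly m = 0"
proof -
  assume k: "0 \<in> Poly_Mapping.keys m"
  then have "cpoly 0 ^ Poly_Mapping.lookup m 0 = 0" by (simp add: in_keys_iff)
  with k have "mon_val cpoly m = 0"
    unfolding mon_val_def by (intro prod_zero[OF finite_keys] bexI[of _ 0])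
  then show ?thesis by (simp add: mpoly_def)
qed

text \<open>t^l - (t - 1)^l loses its leading term, so a variable of weight l + 1 contributes degree
  at most l - 1: two less per variable. This is the origin of the summand 2j in the weight i + 2j +
  k. Index 0 is excluded because there l - 1 is truncated.\<close>

lemma degree_mpoly:
  assumes "0 \<notin> Poly_Mapping.keys m"
  shows "Polynomial.degree (mpoly m) + 2 * mon_degree m \<le> mon_weight m"
proof -
  have "Polynomial.degree (mpoly m) \<le> Polynomial.degree (mon_val cpoly m)"
    unfolding mpoly_def by (rule degree_smult_le)
  also have "\<dots> \<le> (\<Sum>l\<in>Poly_Mapping.keys m. Polynomial.degree (cpoly l ^ Poly_Mapping.lookup m l))"
    unfolding mon_val_def using degree_prod_sum_le[OF finite_keys] by (simp add: o_def)
  also have "\<dots> \<le> (\<Sum>l\<in>Poly_Mapping.keys m. (l - 1) * Poly_Mapping.lookup m l)"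
  proof (rule sum_mono)
    fix l
    have "Polynomial.degree (cpoly l ^ Poly_Mapping.lookup m l) \<le> Polynomial.degree (cpoly l) * Poly_Mapping.lookup m l"
      by (rule degree_power_le)
    also have "\<dots> \<le> (l - 1) * Poly_Mapping.lookup m l"
      using degree_cpoly by (rule mult_le_mono1)
    finally show "Polynomial.degree (cpoly l ^ Poly_Mapping.lookup m l) \<le> (l - 1) * Poly_Mapping.lookup m l" .
  qed
  also have "\<dots> + 2 * mon_degree m = mon_weight m"
    unfolding mon_degree_def mon_weight_def sum_distrib_left sum.distrib[symmetric]
  proof (rule sum.cong[OF refl])
    fix l assume "l \<in> Poly_Mapping.keys m"
    with assms have "l \<noteq> 0" by metis
    then obtain k where "l = Suc k" by (cases l) auto
    then show "(l - 1) * Poly_Mapping.lookup m l + 2 * Poly_Mapping.lookup m l = (l + 1) * Poly_Mapping.lookup m l"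
      by simp
  qed
  finally show ?thesis by simp
qed

text \<open>Guarantees i \<ge> 0 when the weight is written as i + 2j + k, so that later
  subtractions of natural numbers are not truncated.\<close>

lemma rho_series_weight:
  assumes "rho_series k m \<noteq> 0"
  shows "k + 2 * mon_degree m \<le> mon_weight m"
proof -
  have "coeff (unit_integral (mpoly m)) k \<noteq> 0"
    using assms by (auto simp: rho_series_mpoly)
  moreover have "coeff (unit_integral (mpoly m)) k = 0"
    if "\<And>n. n \<le> Polynomial.degree (mpoly m) \<Longrightarrow> k \<le> n \<Longrightarrow> coeff (mpoly m) n = 0"
    unfolding coeff_unit_integral using that by (intro sum.neutral) auto
  ultimately obtain n where n: "n \<le> Polynomial.degree (mpoly m)" "k \<le> n" "coeff (mpoly m) n \<noteq> 0"
    by blast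
  then have "0 \<notin> Poly_Mapping.keys m" using mpoly_eq_0 by force
  from degree_mpoly[OF this] n show ?thesis by linarith
qed

lemma poly_cpoly: "poly (cpoly l) x = x ^ l - (x - 1) ^ l"
  by (simp add: cpoly_def poly_power)

lemma poly_cpoly_reflect: "poly (cpoly l) (1 - x) = (-1) ^ (l + 1) * poly (cpoly l) x"
proof -
  have "(1 - x) ^ l = (-1) ^ l * (x - 1) ^ l" "(- x) ^ l = (-1) ^ l * x ^ l"
    by (simp_all flip: power_mult_distrib)
  then show ?thesis by (simp add: poly_cpoly algebra_simps)
qed

lemma poly_mpoly:
  "poly (mpoly m) x = ifact m * (\<Prod>l\<in>Poly_Mapping.keys m. poly (cpoly l) x ^ Poly_Mapping.lookup m l)"
  by (simp add: mpoly_def mon_val_def poly_prod poly_power)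

lemma poly_mpoly_reflect: "poly (mpoly m) (1 - x) = (-1) ^ mon_weight m * poly (mpoly m) x"
proof -
  have "((-1) :: rat) ^ mon_weight m = (\<Prod>l\<in>Poly_Mapping.keys m. ((-1) ^ (l + 1)) ^ Poly_Mapping.lookup m l)"
    unfolding mon_weight_def power_sum power_mult ..
  then show ?thesis
    unfolding poly_mpoly poly_cpoly_reflect power_mult_distrib prod.distrib by simp
qed

text \<open>The reflection t -> 1 - t maps [-v, 1 - v] onto [v, v + 1]; a parity of the integrand
  about 1/2 becomes a parity of the integral in v.\<close>

lemma poly_unit_integral_reflect:
  assumes "\<And>x. poly p (1 - x) = s * poly p x"
  shows "poly (unit_integral p) (- v) = s * poly (unit_integral p) v"
proof -
  let ?A = "antiderivative p"
  have "pcompose p [:1, -1:] = smult s p"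
    using assms by (intro poly_eq_poly_eq_iff[THEN iffD1] ext) (simp add: poly_pcompose)
  then have "pderiv (pcompose ?A [:1, -1:] + smult s ?A) = 0"
    by (simp add: pderiv_add pderiv_pcompose pderiv_antiderivative pderiv_smult pderiv_pCons)
  then obtain h where h: "pcompose ?A [:1, -1:] + smult s ?A = [:h:]"
    using pderiv_iszero by blast
  have A: "poly ?A (1 - x) = h - s * poly ?A x" for x
    using arg_cong[OF h, of "\<lambda>q. poly q x"] by (simp add: poly_pcompose)
  show ?thesis
    using A[of v] A[of "v + 1"] by (simp add: unit_integral_def poly_pcompose algebra_simps)
qed

text \<open>For weight i + 2j + k this forces i to be even, which later makes \<open>rho i j\<close>
  vanish for odd i.\<close>

lemma rho_series_parity:
  assumes "rho_series k m \<noteq> 0"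
  shows "even (mon_weight m + k)"
proof -
  let ?I = "unit_integral (mpoly m)"
  have "pcompose ?I [:0, -1:] = smult ((-1) ^ mon_weight m) ?I"
    using poly_unit_integral_reflect[OF poly_mpoly_reflect, of m]
    by (intro poly_eq_poly_eq_iff[THEN iffD1] ext) (simp add: poly_pcompose)
  from arg_cong[OF this, of "\<lambda>q. coeff q k"]
  have "(-1) ^ k * coeff ?I k = (-1) ^ mon_weight m * coeff ?I k"
    by (simp add: coeff_pcompose_linear)
  moreover have "coeff ?I k \<noteq> 0" using assms by (auto simp: rho_series_mpoly)
  ultimately have "((-1) :: rat) ^ k = (-1) ^ mon_weight m" by simp
  then show ?thesis by (cases "even k"; cases "even (mon_weight m)") auto
qed

lemma rho_series_0: "rho_series k 0 = (if k = 0 then 1 else 0)"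
proof -
  have "mpoly 0 = 1" by (simp add: mpoly_def ifact_def)
  then have "rho_series k 0 = fact k * (\<Sum>n\<le>0. coeff (1 :: rat poly) n * (if k \<le> n then of_nat (Suc n choose k) / of_nat (Suc n) else 0))"
    by (simp only: rho_series_mpoly coeff_unit_integral degree_1)
  also have "\<dots> = (if k = 0 then 1 else 0)"
    by (cases k) simp_all
  finally show ?thesis .
qed

text \<open>The factorial compensates the 1/l! in \<open>dp\<close>; this is what turns
  \<open>rho 0 1\<close> into \<open>del2\<close>.\<close>

lemma rho_series_single: "rho_series k (Poly_Mapping.single (Suc k) 1) = fact (Suc k)"
proof -
  have p: "mpoly (Poly_Mapping.single (Suc k) 1) = cpoly (Suc k)"
    unfolding mpoly_def mon_val_single ifact_def by simp
  have d: "Polynomial.degree (cpoly (Suc k)) \<le> k" using degree_cpoly[of "Suc k"] by simp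
  have b: "Suc k choose k = Suc k" by (rule binomial_Suc_n)
  have c: "coeff (cpoly (Suc k)) k = of_nat (Suc k)"
    unfolding coeff_cpoly b by simp
  define F where "F = (\<lambda>n. coeff (cpoly (Suc k)) n * (if k \<le> n then of_nat (Suc n choose k) / of_nat (Suc n) else 0))"
  have "coeff (unit_integral (cpoly (Suc k))) k = (\<Sum>n\<le>k. F n)"
    unfolding coeff_unit_integral F_def using d
    by (intro sum.mono_neutral_left) (auto simp: coeff_eq_0)
  also have "\<dots> = (\<Sum>n\<in>{k}. F n)"
    by (rule sum.mono_neutral_right) (auto simp: F_def)
  also have "\<dots> = F k" by simp
  also have "\<dots> = of_nat (Suc k)"
    unfolding F_def b c by simp
  finally show ?thesis
    unfolding rho_series_mpoly p fact_Suc by simp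
qed

section \<open>Convolutions of divisor sums\<close>

definition quads :: "nat \<Rightarrow> (nat \<times> nat \<times> nat \<times> nat) set" where
  "quads n = {(a, b, x, y). 0 < a \<and> 0 < b \<and> 0 < x \<and> 0 < y \<and> a * x + b * y = n}"

lemma finite_quads: "finite (quads n)"
proof (rule finite_subset)
  show "quads n \<subseteq> {..n} \<times> {..n} \<times> {..n} \<times> {..n}"
  proof
    fix p assume "p \<in> quads n"
    then obtain a b x y where p: "p = (a, b, x, y)" "0 < a" "0 < b" "0 < x" "0 < y" "a * x + b * y = n"
      by (auto simp: quads_def)
    have "a \<le> a * x" "x \<le> a * x" "b \<le> b * y" "y \<le> b * y" using p by auto
    then have "a \<le> n" "b \<le> n" "x \<le> n" "y \<le> n" using p(6) by linarith+
    then show "p \<in> {..n} \<times> {..n} \<times> {..n} \<times> {..n}" using p(1) by simp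
  qed
qed simp

text \<open>The weight sees only a and b while the condition may involve x and y: the shear trades y
  < x for a < b at the price of changing the weight.\<close>

definition qsum :: "nat \<Rightarrow> (nat \<Rightarrow> nat \<Rightarrow> nat \<Rightarrow> nat \<Rightarrow> bool) \<Rightarrow> (nat \<Rightarrow> nat \<Rightarrow> rat) \<Rightarrow> rat" where
  "qsum n P g = (\<Sum>(a, b, x, y) \<in> {q \<in> quads n. case q of (a, b, x, y) \<Rightarrow> P a b x y}. g a b)"

lemma qsum_split3:
  assumes "\<And>a b x y. P1 a b x y \<Longrightarrow> \<not> P2 a b x y" "\<And>a b x y. P1 a b x y \<Longrightarrow> \<not> P3 a b x y"
    "\<And>a b x y. P2 a b x y \<Longrightarrow> \<not> P3 a b x y" "\<And>a b x y. P1 a b x y \<or> P2 a b x y \<or> P3 a b x y"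
  shows "qsum n (\<lambda>_ _ _ _. True) g = qsum n P1 g + qsum n P2 g + qsum n P3 g"
proof -
  let ?A = "\<lambda>P. {q \<in> quads n. case q of (a, b, x, y) \<Rightarrow> P a b x y}"
  have 1: "?A (\<lambda>_ _ _ _. True) = ?A P1 \<union> ?A P2 \<union> ?A P3"
    using assms(4) by fastforce
  have 2: "(?A P1 \<union> ?A P2) \<inter> ?A P3 = {}" "?A P1 \<inter> ?A P2 = {}"
    using assms(1-3) by auto
  show ?thesis
    unfolding qsum_def 1
    by (simp add: sum.union_disjoint[OF _ _ 2(1)] sum.union_disjoint[OF _ _ 2(2)] finite_quads)
qed

lemma qsum_cong:
  assumes "\<And>a b x y. P a b x y \<Longrightarrow> 0 < a \<Longrightarrow> 0 < b \<Longrightarrow> g a b = h a b"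
  shows "qsum n P g = qsum n P h"
  unfolding qsum_def using assms by (intro sum.cong) (auto simp: quads_def)

lemma qsum_swap: "qsum n P g = qsum n (\<lambda>a b x y. P b a y x) (\<lambda>a b. g b a)"
  unfolding qsum_def
  by (rule sum.reindex_bij_witness[of _ "\<lambda>(a, b, x, y). (b, a, y, x)" "\<lambda>(a, b, x, y). (b, a, y, x)"])
     (auto simp: quads_def add.commute)

lemma qsum_shear:
  "qsum n (\<lambda>a b x y. y < x) g = qsum n (\<lambda>a b x y. a < b) (\<lambda>a b. g a (b - a))"
  unfolding qsum_def
proof (rule sum.reindex_bij_witness[of _ "\<lambda>(a, b, x, y). (a, b - a, x + y, y)" "\<lambda>(a, b, x, y). (a, a + b, x - y, y)"])
  fix q assume "q \<in> {q \<in> quads n. case q of (a, b, x, y) \<Rightarrow> y < x}"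
  then obtain a b x y where q: "q = (a, b, x, y)" "0 < a" "0 < b" "0 < x" "0 < y" "a * x + b * y = n" "y < x"
    by (auto simp: quads_def)
  then obtain z where "x = y + z" "0 < z" by (metis less_imp_add_positive)
  with q show "(case q of (a, b, x, y) \<Rightarrow> (a, a + b, x - y, y)) \<in> {q \<in> quads n. case q of (a, b, x, y) \<Rightarrow> a < b}"
    by (auto simp: quads_def algebra_simps)
next
  fix q assume "q \<in> {q \<in> quads n. case q of (a, b, x, y) \<Rightarrow> a < b}"
  then obtain a b x y where q: "q = (a, b, x, y)" "0 < a" "0 < b" "0 < x" "0 < y" "a * x + b * y = n" "a < b"
    by (auto simp: quads_def)
  then obtain z where "b = a + z" "0 < z" by (metis less_imp_add_positive)
  with q show "(case q of (a, b, x, y) \<Rightarrow> (a, b - a, x + y, y)) \<in> {q \<in> quads n. case q of (a, b, x, y) \<Rightarrow> y < x}"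
    by (auto simp: quads_def algebra_simps)
qed auto

lemma qsum_diff: "qsum n P (\<lambda>a b. g a b - h a b) = qsum n P g - qsum n P h"
  by (simp add: qsum_def sum_subtractf split_def)

lemma qsum_mult: "qsum n P (\<lambda>a b. c * g a b) = c * qsum n P g"
  by (simp add: qsum_def sum_distrib_left split_def)

text \<open>
  The substitution \<open>(a, b, x, y) \<mapsto> (a, a + b, x - y, y)\<close> evaluates a sum over all solutions of
  \<open>a x + b y = n\<close> in terms of the diagonals \<open>a = b\<close> and \<open>x = y\<close>, which are divisor sums.
\<close>

lemma qsum_symmetric_shear:
  assumes sym: "\<And>a b. g a b = g b a" and h: "\<And>a b. 0 < a \<Longrightarrow> a < b \<Longrightarrow> h a b = 2 * (g a (b - a) - g a b)"
    and hs: "\<And>a b. h a b = h b a"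
  shows "qsum n (\<lambda>_ _ _ _. True) h =
    2 * (qsum n (\<lambda>a b x y. a = b) g - qsum n (\<lambda>a b x y. x = y) g) + qsum n (\<lambda>a b x y. a = b) h"
proof -
  have ab: "qsum n (\<lambda>_ _ _ _. True) f = 2 * qsum n (\<lambda>a b x y. a < b) f + qsum n (\<lambda>a b x y. a = b) f"
    if "\<And>a b. f a b = f b a" for f
  proof -
    have e: "(\<lambda>a b. f b a) = f" using that by (intro ext)
    have "qsum n (\<lambda>_ _ _ _. True) f = qsum n (\<lambda>a b x y. a < b) f + qsum n (\<lambda>a b x y. b < a) f
      + qsum n (\<lambda>a b x y. a = b) f"
      by (rule qsum_split3) auto
    with qsum_swap[of n "\<lambda>a b x y. b < a" f] show ?thesis unfolding e by simp
  qed
  have xy: "qsum n (\<lambda>_ _ _ _. True) g = 2 * qsum n (\<lambda>a b x y. y < x) g + qsum n (\<lambda>a b x y. x = y) g"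
  proof -
    have e: "(\<lambda>a b. g b a) = g" using sym by (intro ext)
    have "qsum n (\<lambda>_ _ _ _. True) g = qsum n (\<lambda>a b x y. x < y) g + qsum n (\<lambda>a b x y. y < x) g
      + qsum n (\<lambda>a b x y. x = y) g"
      by (rule qsum_split3) auto
    with qsum_swap[of n "\<lambda>a b x y. x < y" g] show ?thesis unfolding e by simp
  qed
  have "qsum n (\<lambda>a b x y. a < b) h = 2 * (qsum n (\<lambda>a b x y. a < b) (\<lambda>a b. g a (b - a)) - qsum n (\<lambda>a b x y. a < b) g)"
    unfolding qsum_diff[symmetric] qsum_mult[symmetric] using h by (intro qsum_cong) auto
  moreover have "Sh = 2 * (Da - Dx) + Dh"
    if "Ah = 2 * (As - Ag)" "Sh = 2 * Ah + Dh" "Sg = 2 * Ag + Da" "Sg = 2 * As + Dx"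
    for Ah As Ag Sh Dh Sg Da Dx :: rat using that by (simp add: algebra_simps)
  ultimately show ?thesis
    using ab[of h, OF hs] ab[of g, OF sym] xy unfolding qsum_shear by blast
qed

section \<open>Divisor pairs, diagonals and convolutions\<close>

definition pairs :: "nat \<Rightarrow> (nat \<times> nat) set" where
  "pairs m = {(a, x). 0 < a \<and> 0 < x \<and> a * x = m}"

lemma finite_pairs: "finite (pairs n)"
proof (rule finite_subset)
  show "pairs n \<subseteq> {..n} \<times> {..n}"
    by (auto simp: pairs_def)
qed simp

lemma sum_pairs_le:
  "(\<Sum>m=1..n. \<Sum>t | 0 < t \<and> t * m \<le> n. F m t) = (\<Sum>i=0..n. \<Sum>(m, t)\<in>pairs i. F m t)"
proof -
  have le: "t \<le> n" if "0 < m" "t * m \<le> n" for m t :: nat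
    using that by (metis Suc_leI le_trans mult.right_neutral mult_le_mono2 One_nat_def)
  have fin: "finite {t. 0 < t \<and> t * m \<le> n}" if "0 < m" for m
    by (rule finite_subset[of _ "{..n}"]) (use le[OF that] in auto)
  have "(\<Sum>m=1..n. \<Sum>t | 0 < t \<and> t * m \<le> n. F m t) = (\<Sum>(m, t)\<in>(SIGMA m:{1..n}. {t. 0 < t \<and> t * m \<le> n}). F m t)"
    using fin by (subst sum.Sigma) auto
  also have "\<dots> = (\<Sum>(i, m, t)\<in>(SIGMA i:{0..n}. pairs i). F m t)"
    by (rule sum.reindex_bij_witness[of _ "\<lambda>(i, m, t). (m, t)" "\<lambda>(m, t). (m * t, m, t)"])
      (auto simp: pairs_def mult.commute intro: le)
  also have "\<dots> = (\<Sum>i=0..n. \<Sum>(m, t)\<in>pairs i. F m t)"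
    by (subst sum.Sigma) (auto simp: finite_pairs split_def)
  finally show ?thesis .
qed

lemma sum_pairs:
  assumes "0 < n"
  shows "(\<Sum>(a, x)\<in>pairs n. f a) = (\<Sum>d | d dvd n. f d)"
  using assms by (intro sum.reindex_bij_witness[of _ "\<lambda>d. (d, n div d)" fst])
    (auto simp: pairs_def dvd_def intro!: Nat.gr0I)

lemma sum_pairs':
  assumes "0 < n"
  shows "(\<Sum>(a, x)\<in>pairs n. f x) = (\<Sum>d | d dvd n. f d)"
  using assms by (intro sum.reindex_bij_witness[of _ "\<lambda>d. (n div d, d)" snd])
    (auto simp: pairs_def dvd_def intro!: Nat.gr0I)

text \<open>For a = b the equation reads a (x + y) = n, and n/a splits as x + y in n/a - 1
  ways.\<close>

lemma qsum_diag_a: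
  assumes "0 < n"
  shows "qsum n (\<lambda>a b x y. a = b) g = (\<Sum>d | d dvd n. (of_nat n / of_nat d - 1) * g d d)"
proof -
  have k: "a * x + a * (z - x) = a * z" if "x < z" for a x z :: nat
    using that by (metis add_mult_distrib2 le_add_diff_inverse less_imp_le)
  have "qsum n (\<lambda>a b x y. a = b) g = (\<Sum>((a, z), x)\<in>(SIGMA p:pairs n. {0<..<snd p}). g a a)"
    unfolding qsum_def
    by (rule sum.reindex_bij_witness[of _ "\<lambda>((a, z), x). (a, a, x, z - x)" "\<lambda>(a, b, x, y). ((a, x + y), x)"])
       (auto simp: quads_def pairs_def k distrib_left)
  also have "\<dots> = (\<Sum>p\<in>pairs n. \<Sum>x\<in>{0<..<snd p}. g (fst p) (fst p))"
    by (subst sum.Sigma) (auto simp: finite_pairs split_def)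
  also have "\<dots> = (\<Sum>(a, z)\<in>pairs n. (of_nat n / of_nat a - 1) * g a a)"
    by (intro sum.cong) (auto simp: pairs_def of_nat_diff Suc_leI)
  finally show ?thesis using sum_pairs[OF assms] by simp
qed

text \<open>For x = y the equation reads (a + b) x = n, so d = a + b runs over the divisors of
  n.\<close>

lemma qsum_diag_x:
  assumes "0 < n"
  shows "qsum n (\<lambda>a b x y. x = y) g = (\<Sum>d | d dvd n. \<Sum>a\<in>{0<..<d}. g a (d - a))"
proof -
  have k: "a * x + (z - a) * x = z * x" if "a < z" for a x z :: nat
    using that by (metis add_mult_distrib le_add_diff_inverse less_imp_le)
  have "qsum n (\<lambda>a b x y. x = y) g = (\<Sum>((z, x), a)\<in>(SIGMA p:pairs n. {0<..<fst p}). g a (z - a))"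
    unfolding qsum_def
    by (rule sum.reindex_bij_witness[of _ "\<lambda>((z, x), a). (a, z - a, x, x)" "\<lambda>(a, b, x, y). ((a + b, x), a)"])
       (auto simp: quads_def pairs_def k distrib_right)
  also have "\<dots> = (\<Sum>p\<in>pairs n. \<Sum>a\<in>{0<..<fst p}. g a (fst p - a))"
    by (subst sum.Sigma) (auto simp: finite_pairs split_def)
  also have "\<dots> = (\<Sum>(z, x)\<in>pairs n. \<Sum>a\<in>{0<..<z}. g a (z - a))"
    by (simp add: split_def)
  finally show ?thesis using sum_pairs[OF assms] by simp
qed

definition sigma_fps :: "nat \<Rightarrow> rat fps" where
  "sigma_fps r = Abs_fps (\<lambda>n. if n = 0 then 0 else of_nat (sigma r n))"

lemma sigma_fps_nth: "fps_nth (sigma_fps r) m = (\<Sum>(a, x)\<in>pairs m. of_nat a ^ r)"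
proof (cases "m = 0")
  case True
  have "pairs 0 = {}" by (auto simp: pairs_def)
  with True show ?thesis by (simp add: sigma_fps_def)
next
  case False
  then show ?thesis using sum_pairs[of m "\<lambda>a. of_nat a ^ r :: rat"]
    by (simp add: sigma_fps_def sigma_def)
qed

lemma qsum_convolution:
  "qsum n (\<lambda>_ _ _ _. True) (\<lambda>a b. of_nat a ^ r * of_nat b ^ s) = fps_nth (sigma_fps r * sigma_fps s) n"
proof -
  have "fps_nth (sigma_fps r * sigma_fps s) n
     = (\<Sum>i=0..n. \<Sum>(p, q)\<in>pairs i \<times> pairs (n - i). of_nat (fst p) ^ r * of_nat (fst q) ^ s)"
    unfolding fps_mult_nth sigma_fps_nth sum_product sum.cartesian_product by (simp add: split_def)
  also have "\<dots> = (\<Sum>(i, p, q)\<in>(SIGMA i:{0..n}. pairs i \<times> pairs (n - i)). of_nat (fst p) ^ r * of_nat (fst q) ^ s)"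
    by (subst sum.Sigma) (auto simp: finite_pairs split_def)
  also have "\<dots> = qsum n (\<lambda>_ _ _ _. True) (\<lambda>a b. of_nat a ^ r * of_nat b ^ s)"
    unfolding qsum_def
    by (rule sum.reindex_bij_witness[of _ "\<lambda>(a, b, x, y). (a * x, (a, x), (b, y))" "\<lambda>(i, (a, x), (b, y)). (a, b, x, y)"])
       (auto simp: quads_def pairs_def)
  finally show ?thesis by simp
qed

lemma qsum_sum: "qsum n P (\<lambda>a b. \<Sum>j\<in>J. g j a b) = (\<Sum>j\<in>J. qsum n P (g j))"
  unfolding qsum_def split_def by (rule sum.swap)

section \<open>Bernoulli numbers and sums of powers\<close>

text \<open>
  \<open>bern\<close> is \<open>z / (exp z - 1)\<close>, and \<open>bernc\<close> is \<open>(z/2) coth (z/2)\<close>.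
\<close>

definition bern :: "rat fps" where
  "bern = fps_X / (fps_exp 1 - 1)"

definition bernc :: "rat fps" where
  "bernc = bern + fps_const (1/2) * fps_X"

lemma bern_mult: "bern * (fps_exp 1 - 1) = fps_X"
proof -
  have n: "fps_nth (fps_exp 1 - 1 :: rat fps) 1 \<noteq> 0" "fps_nth (fps_exp 1 - 1 :: rat fps) 0 = 0"
    by simp_all
  then have "subdegree (fps_exp 1 - 1 :: rat fps) = 1" by (intro subdegreeI) auto
  moreover have "fps_exp 1 - 1 \<noteq> (0 :: rat fps)" using n by (metis fps_zero_nth)
  ultimately have "fps_exp 1 - 1 dvd (fps_X :: rat fps)" by (subst fps_dvd_iff) auto
  then show ?thesis by (simp add: bern_def)
qed

lemma bernoulli_num_bern: "bernoulli_num k = fact k * fps_nth bern k"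
  by (simp add: bernoulli_num_def bern_def)

lemma bern_nth: "fps_nth bern k = fps_nth bernc k - (if k = 1 then 1/2 else 0)"
  by (simp add: bernc_def)

lemma bern_0: "fps_nth bern 0 = 1"
proof -
  have "fps_nth (bern * (fps_exp 1 - 1)) 1 = 1" by (simp add: bern_mult)
  then show ?thesis by (simp add: fps_mult_nth)
qed

lemma bern_ode: "fps_X * fps_deriv bern = bern - bern * bern - fps_X * bern"
proof -
  let ?E = "fps_exp 1 :: rat fps"
  have ne: "?E - 1 \<noteq> 0"
    using bern_mult by auto
  have "fps_deriv (bern * (?E - 1)) = 1" by (simp add: bern_mult)
  then have d: "fps_deriv bern * (?E - 1) = 1 - bern * ?E"
    by (simp add: algebra_simps)
  have bE: "bern * ?E = fps_X + bern"
    using bern_mult by (simp add: algebra_simps)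
  have "(fps_X * fps_deriv bern) * (?E - 1) = (bern - bern * bern - fps_X * bern) * (?E - 1)"
  proof -
    have "(fps_X * fps_deriv bern) * (?E - 1) = fps_X * (1 - bern * ?E)"
      unfolding d[symmetric] by (simp add: mult_ac)
    also have "\<dots> = fps_X - fps_X * (fps_X + bern)"
      unfolding bE by (simp add: algebra_simps)
    also have "\<dots> = bern * (?E - 1) - bern * (bern * (?E - 1)) - fps_X * (bern * (?E - 1))"
      unfolding bern_mult by (simp add: algebra_simps)
    also have "\<dots> = (bern - bern * bern - fps_X * bern) * (?E - 1)"
      by (simp add: algebra_simps)
    finally show ?thesis .
  qed
  with ne show ?thesis by simp
qed

text \<open>Adding z/2 completes the square in the Riccati equation \<open>bern_ode\<close>: the
  mixed term disappears and the equation becomes invariant under z -> -z.\<close>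

lemma bernc_ode: "fps_X * fps_deriv bernc = bernc - bernc * bernc + fps_const (1/4) * (fps_X * fps_X)"
proof -
  let ?h = "fps_const (1/2) :: rat fps"
  have h: "?h * ?h = fps_const (1/4)" "2 * ?h = 1"
    by (simp_all add: numeral_fps_const)
  have "fps_X * fps_deriv bernc = fps_X * fps_deriv bern + ?h * fps_X"
    by (simp add: bernc_def algebra_simps)
  also have "\<dots> = bernc - bernc * bernc + (?h * ?h) * (fps_X * fps_X)"
    unfolding bern_ode by (simp add: bernc_def algebra_simps h(2))
  finally show ?thesis unfolding h .
qed

lemma bernc_rec:
  "of_nat n * fps_nth bernc n = fps_nth bernc n - (\<Sum>i=0..n. fps_nth bernc i * fps_nth bernc (n - i))
     + (if n = 2 then 1/4 else 0)"
proof -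
  have "fps_nth (fps_X * fps_deriv bernc) n = of_nat n * fps_nth bernc n"
    by (cases n) auto
  moreover have "fps_nth (fps_X * fps_X :: rat fps) n = (if n = 2 then 1 else 0)"
    by (simp only: fps_X_power_nth flip: power2_eq_square)
  moreover have "fps_nth (fps_X * fps_deriv bernc) n =
      fps_nth bernc n - fps_nth (bernc * bernc) n + 1/4 * fps_nth (fps_X * fps_X) n"
    unfolding bernc_ode by simp
  ultimately show ?thesis
    unfolding fps_mult_nth[of bernc bernc] by simp
qed

lemma bernc_0: "fps_nth bernc 0 = 1"
  by (simp add: bernc_def bern_0)

text \<open>Euler's convolution identity, read off from the Riccati equation; n > 2 avoids the
  inhomogeneous term 1/4 at n = 2. It accounts for the constant terms in
  \<open>Eis_heat\<close>.\<close>

lemma bernc_conv: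
  assumes "2 < n"
  shows "(\<Sum>i\<in>{0<..<n}. fps_nth bernc i * fps_nth bernc (n - i)) = - (of_nat n + 1) * fps_nth bernc n"
proof -
  have "{0..n} = insert 0 (insert n {0<..<n})" using assms by auto
  then have "(\<Sum>i=0..n. fps_nth bernc i * fps_nth bernc (n - i))
     = 2 * fps_nth bernc n + (\<Sum>i\<in>{0<..<n}. fps_nth bernc i * fps_nth bernc (n - i))"
    using assms by (simp add: bernc_0)
  with bernc_rec[of n] assms show ?thesis by (simp add: algebra_simps)
qed

text \<open>For odd n > 2 every product in \<open>bernc_conv\<close> has one factor of smaller odd
  index, so the left side vanishes while n + 1 does not.\<close>

lemma bernc_odd: "odd n \<Longrightarrow> fps_nth bernc n = 0"
proof (induction n rule: less_induct)
  case (less n)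
  show ?case
  proof (cases "n = 1")
    case True
    then show ?thesis using bernc_rec[of 1] by (simp add: bernc_0)
  next
    case False
    with less.prems have n: "2 < n" by (cases n) (auto elim!: oddE)
    have "fps_nth bernc i * fps_nth bernc (n - i) = 0" if "i \<in> {0<..<n}" for i
      using that less.IH[of i] less.IH[of "n - i"] less.prems by (cases "odd i") auto
    then have "(\<Sum>i\<in>{0<..<n}. fps_nth bernc i * fps_nth bernc (n - i)) = 0"
      by (intro sum.neutral) blast
    moreover have "of_nat n + 1 \<noteq> (0 :: rat)" by (metis of_nat_Suc of_nat_eq_0_iff nat.distinct(2) add.commute)
    ultimately show ?thesis using bernc_conv[OF n] by simp
  qed
qed

lemma bernc_values: "fps_nth bernc 2 = 1/12" "fps_nth bernc 4 = -1/720" "fps_nth bernc 6 = 1/30240"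
  "fps_nth bernc 8 = -1/1209600"
proof -
  have o: "fps_nth bernc 1 = 0" "fps_nth bernc 3 = 0" "fps_nth bernc 5 = 0" "fps_nth bernc 7 = 0"
    by (auto intro!: bernc_odd)
  have s: "{0::nat..2} = {0, 1, 2}" "{0<..<4::nat} = {1, 2, 3}" "{0<..<6::nat} = {1, 2, 3, 4, 5}"
    "{0<..<8::nat} = {1, 2, 3, 4, 5, 6, 7}" by auto
  show 2: "fps_nth bernc 2 = 1/12"
    using bernc_rec[of 2] unfolding s by (simp add: bernc_0 o o(1)[unfolded One_nat_def])
  show 4: "fps_nth bernc 4 = -1/720"
    using bernc_conv[of 4] unfolding s by (simp add: o o(1)[unfolded One_nat_def] 2)
  show 6: "fps_nth bernc 6 = 1/30240"
    using bernc_conv[of 6] unfolding s by (simp add: o o(1)[unfolded One_nat_def] 2 4)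
  show "fps_nth bernc 8 = -1/1209600"
    using bernc_conv[of 8] unfolding s by (simp add: o o(1)[unfolded One_nat_def] 2 4 6)
qed

lemma faulhaber:
  "(\<Sum>a<d. of_nat a ^ n) = (\<Sum>i\<le>n. fps_nth bern i * (fact n / fact (n + 1 - i)) * of_nat d ^ (n + 1 - i))"
proof -
  let ?E = "fps_exp 1 :: rat fps"
  have "1 - ?E ^ d = (1 - ?E) * (\<Sum>a<d. ?E ^ a)" by (rule one_diff_power_eq)
  then have "?E ^ d - 1 = (?E - 1) * (\<Sum>a<d. ?E ^ a)" by (simp add: algebra_simps)
  then have "bern * (?E ^ d - 1) = (bern * (?E - 1)) * (\<Sum>a<d. ?E ^ a)"
    by (simp only: mult.assoc)
  then have e: "bern * (?E ^ d - 1) = fps_X * (\<Sum>a<d. ?E ^ a)" by (simp add: bern_mult)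
  have "(\<Sum>a<d. of_nat a ^ n / fact n) = fps_nth (fps_X * (\<Sum>a<d. ?E ^ a)) (Suc n)"
    by (simp add: fps_sum_nth fps_exp_power_mult)
  also have "\<dots> = (\<Sum>i=0..Suc n. fps_nth bern i * fps_nth (?E ^ d - 1) (Suc n - i))"
    unfolding e[symmetric] fps_mult_nth ..
  also have "\<dots> = (\<Sum>i\<le>n. fps_nth bern i * fps_nth (?E ^ d - 1) (Suc n - i))"
    by (simp add: fps_exp_power_mult atLeast0AtMost)
  also have "\<dots> = (\<Sum>i\<le>n. fps_nth bern i * (of_nat d ^ (n + 1 - i) / fact (n + 1 - i)))"
    by (intro sum.cong) (auto simp: fps_exp_power_mult)
  finally have "(\<Sum>a<d. of_nat a ^ n / fact n) = (\<Sum>i\<le>n. fps_nth bern i * (of_nat d ^ (n + 1 - i) / fact (n + 1 - i)))" .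
  from arg_cong[OF this, of "\<lambda>x. fact n * x"] show ?thesis
    by (simp add: sum_distrib_left mult_ac)
qed

text \<open>Splitting off the exceptional coefficient -1/2 leaves those of \<open>bernc\<close>,
  which vanish at odd indices; apart from d^(2r) only odd powers of d occur, as in the divisor sums
  of Eisenstein series.\<close>

lemma faulhaber_even:
  assumes "0 < r"
  shows "(\<Sum>a\<in>{0<..<d}. of_nat a ^ (2 * r)) =
    (\<Sum>i\<le>2 * r. fps_nth bernc i * (fact (2 * r) / fact (2 * r + 1 - i)) * of_nat d ^ (2 * r + 1 - i))
    - 1/2 * of_nat d ^ (2 * r)"
proof -
  have "(\<Sum>a\<in>{0<..<d}. of_nat a ^ (2 * r)) = (\<Sum>a<d. of_nat a ^ (2 * r) :: rat)"
    using assms by (intro sum.mono_neutral_left) (auto simp: power_0_left)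
  also have "\<dots> = (\<Sum>i\<le>2 * r. fps_nth bernc i * (fact (2 * r) / fact (2 * r + 1 - i)) * of_nat d ^ (2 * r + 1 - i)
      - (if i = 1 then 1/2 * of_nat d ^ (2 * r) else 0))"
    unfolding faulhaber by (intro sum.cong) (auto simp: bern_nth left_diff_distrib diff_divide_distrib)
  also have "\<dots> = (\<Sum>i\<le>2 * r. fps_nth bernc i * (fact (2 * r) / fact (2 * r + 1 - i)) * of_nat d ^ (2 * r + 1 - i))
    - 1/2 * of_nat d ^ (2 * r)"
    using assms by (simp add: sum_subtractf)
  finally show ?thesis .
qed

section \<open>Eisenstein series\<close>

definition geis :: "nat \<Rightarrow> rat fps" where
  "geis k = (if even k then sigma_fps (k - 1) else 0)"

text \<open>The constant -B_k / (2k); writing it with \<open>bernc\<close> instead of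
  \<open>bern\<close> makes it vanish at k = 1 too, in accordance with
  \<open>Eis 1 = 0\<close>.\<close>

definition eis_const :: "nat \<Rightarrow> rat" where
  "eis_const k = - (fact (k - 1) * fps_nth bernc k / 2)"

lemma Eis_split: "0 < k \<Longrightarrow> Eis k = geis k + fps_const (eis_const k)"
proof -
  assume k: "0 < k"
  show ?thesis
  proof (cases "even k")
    case True
    with k have "k \<noteq> 1" by auto
    then have b: "bernoulli_num k = of_nat k * fact (k - 1) * fps_nth bernc k"
      using k by (simp add: bernoulli_num_bern bern_nth fact_reduce)
    show ?thesis
      using True k by (intro fps_ext) (simp add: Eis_def geis_def sigma_fps_def eis_const_def b)
  qed (simp add: Eis_def geis_def eis_const_def bernc_odd)
qed

lemma sigma_fps_sum: "0 < n \<Longrightarrow> fps_nth (sigma_fps r) n = (\<Sum>d | d dvd n. of_nat d ^ r)"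
  by (simp add: sigma_fps_def sigma_def)

text \<open>In (a - b)^(2r) - (a + b)^(2r) only products of two odd powers survive, and these sum to
  products of Eisenstein series. The diagonal a = b contributes the derivative through the factor
  n/d; the diagonal x = y contributes power sums, hence Bernoulli numbers.\<close>

lemma geis_convolution:
  assumes r: "0 < r"
  shows "(\<Sum>j\<le>2 * r. fps_const (of_nat (2 * r choose j)) * (geis (j + 1) * geis (2 * r + 1 - j))) =
    - fps_XD (geis (2 * r)) + fps_const (1/2) * geis (2 * r + 2)
    + (\<Sum>i\<le>2 * r. fps_const (fps_nth bernc i * (fact (2 * r) / fact (2 * r + 1 - i))) * geis (2 * r + 2 - i))"
  (is "?L = ?R")
proof (rule fps_ext)
  fix n
  show "fps_nth ?L n = fps_nth ?R n"
  proof (cases "n = 0")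
    case True
    have "fps_nth (geis k) 0 = 0" for k by (simp add: geis_def sigma_fps_def)
    with True show ?thesis by (simp add: fps_sum_nth fps_mult_nth)
  next
    case False
    then have n: "0 < n" by simp
    (* Chosen so that g a (b - a) - g a b telescopes to a difference of two powers. *)
    define g :: "nat \<Rightarrow> nat \<Rightarrow> rat" where
      "g = (\<lambda>a b. of_nat a ^ (2 * r) + of_nat b ^ (2 * r) + of_nat (a + b) ^ (2 * r))"
    define h :: "nat \<Rightarrow> nat \<Rightarrow> rat" where
      "h = (\<lambda>a b. 2 * ((of_nat a - of_nat b) ^ (2 * r) - of_nat (a + b) ^ (2 * r)))"
    have even: "(x - y) ^ (2 * r) = (y - x) ^ (2 * r)" for x y :: rat
      by (simp add: power_mult power2_commute)
    have main: "qsum n (\<lambda>_ _ _ _. True) h =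
      2 * (qsum n (\<lambda>a b x y. a = b) g - qsum n (\<lambda>a b x y. x = y) g) + qsum n (\<lambda>a b x y. a = b) h"
    proof (rule qsum_symmetric_shear)
      show "h a b = 2 * (g a (b - a) - g a b)" if "0 < a" "a < b" for a b
        using that even[of "of_nat a" "of_nat b"] by (simp add: h_def g_def of_nat_diff)
    qed (use even in \<open>simp_all add: g_def h_def add_ac\<close>)
    have h_sum: "h = (\<lambda>a b. \<Sum>j\<le>2 * r. 2 * of_nat (2 * r choose j) * ((-1) ^ j - 1) * (of_nat a ^ j * of_nat b ^ (2 * r - j)))"
    proof (intro ext)
      fix a b
      have "(of_nat a - of_nat b) ^ (2 * r) = (\<Sum>j\<le>2 * r. of_nat (2 * r choose j) * of_nat a ^ j * (- of_nat b) ^ (2 * r - j) :: rat)"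
        using binomial_ring[of "of_nat a :: rat" "- of_nat b" "2 * r"] by simp
      also have "\<dots> = (\<Sum>j\<le>2 * r. of_nat (2 * r choose j) * of_nat a ^ j * ((-1) ^ j * of_nat b ^ (2 * r - j)))"
      proof (intro sum.cong refl)
        fix j assume "j \<in> {..2 * r}"
        then have "(-1 :: rat) ^ (2 * r - j) = (-1) ^ j" by (cases "even j") auto
        then have "(- of_nat b :: rat) ^ (2 * r - j) = (-1) ^ j * of_nat b ^ (2 * r - j)"
          by (metis power_minus)
        then show "of_nat (2 * r choose j) * of_nat a ^ j * (- of_nat b :: rat) ^ (2 * r - j)
          = of_nat (2 * r choose j) * of_nat a ^ j * ((-1) ^ j * of_nat b ^ (2 * r - j))" by simp
      qed
      finally have m: "(of_nat a - of_nat b) ^ (2 * r) = (\<Sum>j\<le>2 * r. of_nat (2 * r choose j) * of_nat a ^ j * ((-1) ^ j * of_nat b ^ (2 * r - j)) :: rat)" .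
      have p: "of_nat (a + b) ^ (2 * r) = (\<Sum>j\<le>2 * r. of_nat (2 * r choose j) * of_nat a ^ j * of_nat b ^ (2 * r - j) :: rat)"
        unfolding of_nat_add by (rule binomial_ring)
      show "h a b = (\<Sum>j\<le>2 * r. 2 * of_nat (2 * r choose j) * ((-1) ^ j - 1) * (of_nat a ^ j * of_nat b ^ (2 * r - j)))"
        unfolding h_def m p sum_subtractf[symmetric] sum_distrib_left
        by (intro sum.cong) (auto simp: algebra_simps)
    qed
    have L: "qsum n (\<lambda>_ _ _ _. True) h = - 4 * fps_nth ?L n"
    proof -
      have "qsum n (\<lambda>_ _ _ _. True) h = (\<Sum>j\<le>2 * r. 2 * of_nat (2 * r choose j) * ((-1) ^ j - 1) * fps_nth (sigma_fps j * sigma_fps (2 * r - j)) n)"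
        unfolding h_sum qsum_sum qsum_mult qsum_convolution ..
      also have "\<dots> = (\<Sum>j\<le>2 * r. - 4 * (of_nat (2 * r choose j) * fps_nth (geis (j + 1) * geis (2 * r + 1 - j)) n))"
        by (intro sum.cong) (auto simp: geis_def Suc_diff_le)
      finally show ?thesis by (simp add: fps_sum_nth sum_distrib_left)
    qed
    let ?N = "of_nat n :: rat"
    let ?b = "\<lambda>i. fps_nth bernc i * (fact (2 * r) / fact (2 * r + 1 - i))"
    \<comment> \<open>For a = b = d the powers (2d)^(2r) cancel, leaving 2 g + h = 4 d^(2r).\<close>
    have da: "2 * qsum n (\<lambda>a b x y. a = b) g + qsum n (\<lambda>a b x y. a = b) h
      = (\<Sum>d | d dvd n. 4 * (?N / of_nat d - 1) * of_nat d ^ (2 * r))"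
      unfolding qsum_diag_a[OF n] sum_distrib_left sum.distrib[symmetric]
      using r by (intro sum.cong) (auto simp: g_def h_def power_0_left algebra_simps)
    have dx: "2 * qsum n (\<lambda>a b x y. x = y) g
      = (\<Sum>d | d dvd n. 4 * (\<Sum>i\<le>2 * r. ?b i * of_nat d ^ (2 * r + 1 - i)) - 4 * of_nat d ^ (2 * r) + 2 * of_nat d ^ (2 * r + 1))"
      unfolding qsum_diag_x[OF n] sum_distrib_left[of 2 _ "{d. d dvd n}"]
    proof (intro sum.cong refl)
      fix d assume "d \<in> {d. d dvd n}"
      then have d: "0 < d" using n by (auto intro!: Nat.gr0I)
      have refl: "(\<Sum>a\<in>{0<..<d}. of_nat (d - a) ^ (2 * r)) = (\<Sum>a\<in>{0<..<d}. of_nat a ^ (2 * r) :: rat)"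
        by (rule sum.reindex_bij_witness[of _ "\<lambda>a. d - a" "\<lambda>a. d - a"]) auto
      have "(\<Sum>a\<in>{0<..<d}. g a (d - a)) = (\<Sum>a\<in>{0<..<d}. of_nat a ^ (2 * r) + of_nat (d - a) ^ (2 * r) + of_nat d ^ (2 * r))"
        unfolding g_def by (intro sum.cong) auto
      also have "\<dots> = 2 * (\<Sum>a\<in>{0<..<d}. of_nat a ^ (2 * r)) + of_nat (d - 1) * of_nat d ^ (2 * r)"
        unfolding sum.distrib refl by simp
      also have "\<dots> = 2 * (\<Sum>i\<le>2 * r. ?b i * of_nat d ^ (2 * r + 1 - i)) - 2 * of_nat d ^ (2 * r) + of_nat d ^ (2 * r + 1)"
        unfolding faulhaber_even[OF r] using d by (simp add: of_nat_diff Suc_leI algebra_simps)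
      finally show "2 * (\<Sum>a\<in>{0<..<d}. g a (d - a)) =
        4 * (\<Sum>i\<le>2 * r. ?b i * of_nat d ^ (2 * r + 1 - i)) - 4 * of_nat d ^ (2 * r) + 2 * of_nat d ^ (2 * r + 1)"
        by (simp add: algebra_simps)
    qed
    have "qsum n (\<lambda>_ _ _ _. True) h = (\<Sum>d | d dvd n. 4 * (?N * of_nat d ^ (2 * r - 1)) - 2 * of_nat d ^ (2 * r + 1)
       - 4 * (\<Sum>i\<le>2 * r. ?b i * of_nat d ^ (2 * r + 1 - i)))"
    proof -
      have "qsum n (\<lambda>_ _ _ _. True) h = (\<Sum>d | d dvd n. 4 * (?N / of_nat d - 1) * of_nat d ^ (2 * r))
        - (\<Sum>d | d dvd n. 4 * (\<Sum>i\<le>2 * r. ?b i * of_nat d ^ (2 * r + 1 - i)) - 4 * of_nat d ^ (2 * r) + 2 * of_nat d ^ (2 * r + 1))"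
        unfolding main da[symmetric] dx[symmetric] by (simp add: algebra_simps)
      also have "\<dots> = (\<Sum>d | d dvd n. 4 * (?N * of_nat d ^ (2 * r - 1)) - 2 * of_nat d ^ (2 * r + 1)
       - 4 * (\<Sum>i\<le>2 * r. ?b i * of_nat d ^ (2 * r + 1 - i)))"
        unfolding sum_subtractf[symmetric]
      proof (intro sum.cong refl)
        fix d assume "d \<in> {d. d dvd n}"
        then have d: "0 < d" using n by (auto intro!: Nat.gr0I)
        obtain s where s: "2 * r = Suc s" using r by (cases "2 * r") auto
        show "4 * (?N / of_nat d - 1) * of_nat d ^ (2 * r)
          - (4 * (\<Sum>i\<le>2 * r. ?b i * of_nat d ^ (2 * r + 1 - i)) - 4 * of_nat d ^ (2 * r) + 2 * of_nat d ^ (2 * r + 1))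
          = 4 * (?N * of_nat d ^ (2 * r - 1)) - 2 * of_nat d ^ (2 * r + 1) - 4 * (\<Sum>i\<le>2 * r. ?b i * of_nat d ^ (2 * r + 1 - i))"
          using d unfolding s by (simp add: algebra_simps)
      qed
      finally show ?thesis .
    qed
    also have "\<dots> = 4 * (?N * fps_nth (sigma_fps (2 * r - 1)) n) - 2 * fps_nth (sigma_fps (2 * r + 1)) n
       - 4 * (\<Sum>i\<le>2 * r. ?b i * fps_nth (sigma_fps (2 * r + 1 - i)) n)"
      unfolding sigma_fps_sum[OF n] sum_distrib_left sum_subtractf
      by (subst sum.swap[where A = "{d. d dvd n}"]) (rule refl)
    also have "(\<Sum>i\<le>2 * r. ?b i * fps_nth (sigma_fps (2 * r + 1 - i)) n) = (\<Sum>i\<le>2 * r. ?b i * fps_nth (geis (2 * r + 2 - i)) n)"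
      by (intro sum.cong) (auto simp: geis_def bernc_odd)
    finally have "- 4 * fps_nth ?L n = - 4 * fps_nth ?R n"
      unfolding L using r by (simp add: fps_sum_nth geis_def algebra_simps)
    then show ?thesis by simp
  qed
qed

lemma eis_const_convolution:
  assumes "0 < r"
  shows "(\<Sum>j\<le>2 * r. of_nat (2 * r choose j) * (eis_const (j + 1) * eis_const (2 * r + 1 - j)))
    = (1/2 + 1 / (2 * of_nat r + 1)) * eis_const (2 * r + 2)"
proof -
  have "(\<Sum>j\<le>2 * r. of_nat (2 * r choose j) * (eis_const (j + 1) * eis_const (2 * r + 1 - j)))
     = (\<Sum>j\<le>2 * r. fact (2 * r) / 4 * (fps_nth bernc (j + 1) * fps_nth bernc (2 * r + 1 - j)))"
    by (intro sum.cong) (auto simp: eis_const_def binomial_fact)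
  also have "\<dots> = (\<Sum>i\<in>{0<..<2 * r + 2}. fact (2 * r) / 4 * (fps_nth bernc i * fps_nth bernc (2 * r + 2 - i)))"
    by (rule sum.reindex_bij_witness[of _ "\<lambda>i. i - 1" Suc]) (auto simp: Suc_diff_le)
  also have "\<dots> = fact (2 * r) / 4 * (- (of_nat (2 * r + 2) + 1) * fps_nth bernc (2 * r + 2))"
    unfolding sum_distrib_left[symmetric] using assms by (subst bernc_conv) auto
  also have "\<dots> = (1/2 + 1 / (2 * of_nat r + 1)) * eis_const (2 * r + 2)"
  proof -
    have "2 * of_nat r + 1 \<noteq> (0 :: rat)"
      using of_nat_neq_0[of "2 * r"] by (simp add: add.commute)
    then show ?thesis by (simp add: eis_const_def field_simps)
  qed
  finally show ?thesis .
qed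

lemma fps_const_sum: "fps_const (sum f A :: rat) = (\<Sum>a\<in>A. fps_const (f a))"
  by (induction A rule: infinite_finite_induct) (auto simp flip: fps_const_add)

text \<open>Restoring the constant terms produces two equal cross sums, each -1/2 times the
  Bernoulli terms of \<open>geis_convolution\<close> with 1 \<le> i \<le> 2r. These cancel, and only
  i = 0 is left, giving the summand 1/(2r + 1).\<close>

lemma Eis_heat:
  assumes r: "0 < r"
  shows "(\<Sum>j\<le>2 * r. fps_const (of_nat (2 * r choose j)) * (Eis (j + 1) * Eis (2 * r + 1 - j))) =
    - fps_XD (Eis (2 * r)) + fps_const (1/2 + 1 / (2 * of_nat r + 1)) * Eis (2 * r + 2)"
proof -
  let ?c = "\<lambda>j. fps_const (of_nat (2 * r choose j)) :: rat fps"
  let ?k = "\<lambda>i. fps_const (eis_const i)"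
  let ?b = "\<lambda>i. fps_nth bernc i * (fact (2 * r) / fact (2 * r + 1 - i))"
  have e: "?c j * (Eis (j + 1) * Eis (2 * r + 1 - j)) =
     ?c j * (geis (j + 1) * geis (2 * r + 1 - j)) + ?c j * ?k (j + 1) * geis (2 * r + 1 - j)
     + ?c j * ?k (2 * r + 1 - j) * geis (j + 1) + fps_const (of_nat (2 * r choose j) * (eis_const (j + 1) * eis_const (2 * r + 1 - j)))"
    if "j \<le> 2 * r" for j
    using that by (simp add: Eis_split algebra_simps flip: fps_const_mult)
  have sw: "(\<Sum>j\<le>2 * r. ?c j * ?k (2 * r + 1 - j) * geis (j + 1)) = (\<Sum>j\<le>2 * r. ?c j * ?k (j + 1) * geis (2 * r + 1 - j))"
    by (rule sum.reindex_bij_witness[of _ "\<lambda>j. 2 * r - j" "\<lambda>j. 2 * r - j"])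
       (auto simp: Suc_diff_le binomial_symmetric[symmetric])
  have l: "(\<Sum>j\<le>2 * r. ?c j * ?k (j + 1) * geis (2 * r + 1 - j)) =
     - (fps_const (1/2) * (\<Sum>i\<in>{1..2 * r}. fps_const (?b i) * geis (2 * r + 2 - i)))"
  proof -
    have "(\<Sum>j\<le>2 * r. ?c j * ?k (j + 1) * geis (2 * r + 1 - j)) =
      (\<Sum>i\<in>{1..2 * r + 1}. - (fps_const (1/2) * (fps_const (?b i) * geis (2 * r + 2 - i))))"
    proof (rule sum.reindex_bij_witness[of _ "\<lambda>i. i - 1" Suc])
      fix j assume j: "j \<in> {..2 * r}"
      then have "of_nat (2 * r choose j) * eis_const (j + 1) = - (1/2 * ?b (Suc j))"
        by (simp add: eis_const_def binomial_fact mult_ac)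
      then have "?c j * ?k (j + 1) = - (fps_const (1/2) * fps_const (?b (Suc j)))"
        by (simp only: fps_const_mult fps_const_neg)
      moreover have "2 * r + 2 - Suc j = 2 * r + 1 - j" by simp
      ultimately show "- (fps_const (1/2) * (fps_const (?b (Suc j)) * geis (2 * r + 2 - Suc j)))
          = ?c j * ?k (j + 1) * geis (2 * r + 1 - j)"
        by (simp only: mult_minus_left mult.assoc)
    qed auto
    also have "{1..2 * r + 1} = insert (2 * r + 1) {1..2 * r}" by auto
    also have "(\<Sum>i\<in>insert (2 * r + 1) {1..2 * r}. - (fps_const (1/2) * (fps_const (?b i) * geis (2 * r + 2 - i))))
       = (\<Sum>i\<in>{1..2 * r}. - (fps_const (1/2) * (fps_const (?b i) * geis (2 * r + 2 - i))))"
      by (simp add: bernc_odd)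
    finally show ?thesis by (simp add: sum_negf sum_distrib_left)
  qed
  have b: "(\<Sum>i\<le>2 * r. fps_const (?b i) * geis (2 * r + 2 - i)) =
    fps_const (1 / (2 * of_nat r + 1)) * geis (2 * r + 2) + (\<Sum>i\<in>{1..2 * r}. fps_const (?b i) * geis (2 * r + 2 - i))"
  proof -
    have "{..2 * r} = insert 0 {1..2 * r}" by auto
    then show ?thesis by (simp add: bernc_0 add.commute[of 1])
  qed
  have half: "fps_const (1/2) * x + fps_const (1/2) * x = (x :: rat fps)" for x
    by (simp add: numeral_fps_const flip: mult_2 mult.assoc)
  have "(\<Sum>j\<le>2 * r. ?c j * (Eis (j + 1) * Eis (2 * r + 1 - j))) =
    (\<Sum>j\<le>2 * r. ?c j * (geis (j + 1) * geis (2 * r + 1 - j)))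
    + (\<Sum>j\<le>2 * r. ?c j * ?k (j + 1) * geis (2 * r + 1 - j)) + (\<Sum>j\<le>2 * r. ?c j * ?k (2 * r + 1 - j) * geis (j + 1))
    + fps_const (\<Sum>j\<le>2 * r. of_nat (2 * r choose j) * (eis_const (j + 1) * eis_const (2 * r + 1 - j)))"
    unfolding fps_const_sum sum.distrib[symmetric] using e by (intro sum.cong) auto
  also have "\<dots> = - fps_XD (geis (2 * r)) + fps_const (1/2) * geis (2 * r + 2) + fps_const (1 / (2 * of_nat r + 1)) * geis (2 * r + 2)
    + fps_const ((1/2 + 1 / (2 * of_nat r + 1)) * eis_const (2 * r + 2))"
    unfolding sw l geis_convolution[OF r] b eis_const_convolution[OF r]
    using half[of "\<Sum>i\<in>{1..2 * r}. fps_const (?b i) * geis (2 * r + 2 - i)"] by (simp add: algebra_simps)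
  also have "\<dots> = - fps_XD (Eis (2 * r)) + fps_const (1/2 + 1 / (2 * of_nat r + 1)) * Eis (2 * r + 2)"
  proof -
    have c: "fps_XD (fps_const c) = 0" for c :: rat by (simp add: fps_XD_def)
    have E: "Eis (2 * r) = geis (2 * r) + ?k (2 * r)" "Eis (2 * r + 2) = geis (2 * r + 2) + ?k (2 * r + 2)"
      using r by (simp_all add: Eis_split)
    show ?thesis
      unfolding E fps_XD_add c fps_const_mult[symmetric] fps_const_add[symmetric]
      by (simp only: ring_distribs add_ac add_0_left add_0_right)
  qed
  finally show ?thesis .
qed

section \<open>The identity in weight 8\<close>

lemma sum_quartic: "(\<Sum>a<d. of_nat a ^ 2 * (of_nat d - of_nat a) ^ 2) = (of_nat d ^ 5 - of_nat d) / (30 :: rat)"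
proof -
  have 2: "(\<Sum>a<d. of_nat a ^ 2) = (2 * of_nat d ^ 3 - 3 * of_nat d ^ 2 + of_nat d) / (6 :: rat)"
    by (induction d) (auto simp: field_simps power2_eq_square power3_eq_cube)
  have 3: "(\<Sum>a<d. of_nat a ^ 3) = (of_nat d ^ 4 - 2 * of_nat d ^ 3 + of_nat d ^ 2) / (4 :: rat)"
    by (induction d) (auto simp: field_simps power2_eq_square power3_eq_cube power4_eq_xxxx)
  have 4: "(\<Sum>a<d. of_nat a ^ 4) = (6 * of_nat d ^ 5 - 15 * of_nat d ^ 4 + 10 * of_nat d ^ 3 - of_nat d) / (30 :: rat)"
    by (induction d) (auto simp: field_simps eval_nat_numeral)
  have "(\<Sum>a<d. of_nat a ^ 2 * (of_nat d - of_nat a) ^ 2) =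
    of_nat d ^ 2 * (\<Sum>a<d. of_nat a ^ 2) - 2 * of_nat d * (\<Sum>a<d. of_nat a ^ 3) + (\<Sum>a<d. of_nat a ^ 4 :: rat)"
    unfolding sum_distrib_left sum_subtractf[symmetric] sum.distrib[symmetric]
    by (intro sum.cong) (auto simp: algebra_simps power2_eq_square power3_eq_cube power4_eq_xxxx)
  also have "\<dots> = (of_nat d ^ 5 - of_nat d) / 30"
    unfolding 2 3 4 by (simp add: field_simps eval_nat_numeral)
  finally show ?thesis .
qed

lemma sigma_3_convolution:
  "fps_const 120 * (sigma_fps 3 * sigma_fps 3) = sigma_fps 7 - sigma_fps 3"
proof (rule fps_ext)
  fix n
  show "fps_nth (fps_const 120 * (sigma_fps 3 * sigma_fps 3)) n = fps_nth (sigma_fps 7 - sigma_fps 3) n"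
  proof (cases "n = 0")
    case True
    then show ?thesis by (simp add: sigma_fps_def fps_mult_nth)
  next
    case False
    then have n: "0 < n" by simp
    \<comment> \<open>With this choice g a (b - a) - g a b = a^2 b^2 ((a + b)^2 - (b - a)^2) / 4 =
      a^3 b^3.\<close>
    define g :: "nat \<Rightarrow> nat \<Rightarrow> rat" where
      "g = (\<lambda>a b. - ((of_nat a * of_nat b * of_nat (a + b)) ^ 2 / 4))"
    define h :: "nat \<Rightarrow> nat \<Rightarrow> rat" where
      "h = (\<lambda>a b. 2 * (of_nat a ^ 3 * of_nat b ^ 3))"
    have main: "qsum n (\<lambda>_ _ _ _. True) h =
      2 * (qsum n (\<lambda>a b x y. a = b) g - qsum n (\<lambda>a b x y. x = y) g) + qsum n (\<lambda>a b x y. a = b) h"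
      by (rule qsum_symmetric_shear)
        (auto simp: g_def h_def of_nat_diff field_simps power2_eq_square power3_eq_cube)
    have L: "qsum n (\<lambda>_ _ _ _. True) h = 2 * fps_nth (sigma_fps 3 * sigma_fps 3) n"
      unfolding h_def qsum_mult qsum_convolution ..
    \<comment> \<open>At a = b = d both terms are multiples of d^6 and cancel, so no derivative
      enters.\<close>
    have da: "2 * qsum n (\<lambda>a b x y. a = b) g + qsum n (\<lambda>a b x y. a = b) h = 0"
      unfolding qsum_diag_a[OF n] sum_distrib_left sum.distrib[symmetric]
      by (intro sum.neutral) (auto simp: g_def h_def algebra_simps power2_eq_square power3_eq_cube)
    have dx: "qsum n (\<lambda>a b x y. x = y) g = (\<Sum>d | d dvd n. - (of_nat d ^ 7 - of_nat d ^ 3) / 120)"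
      unfolding qsum_diag_x[OF n]
    proof (intro sum.cong refl)
      fix d assume "d \<in> {d. d dvd n}"
      have "(\<Sum>a\<in>{0<..<d}. g a (d - a)) = (\<Sum>a\<in>{0<..<d}. - (of_nat d ^ 2 / 4 * (of_nat a ^ 2 * (of_nat d - of_nat a) ^ 2)))"
        by (intro sum.cong) (auto simp: g_def of_nat_diff power_mult_distrib)
      also have "\<dots> = (\<Sum>a<d. - (of_nat d ^ 2 / 4 * (of_nat a ^ 2 * (of_nat d - of_nat a) ^ 2)))"
        by (intro sum.mono_neutral_left) auto
      also have "\<dots> = - (of_nat d ^ 2 / 4 * ((of_nat d ^ 5 - of_nat d) / 30))"
        by (simp only: sum_negf sum_distrib_left[symmetric] sum_quartic)
      also have "\<dots> = - (of_nat d ^ 7 - of_nat d ^ 3) / 120"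
        by (simp add: field_simps eval_nat_numeral)
      finally show "(\<Sum>a\<in>{0<..<d}. g a (d - a)) = - (of_nat d ^ 7 - of_nat d ^ 3) / 120" .
    qed
    have "2 * fps_nth (sigma_fps 3 * sigma_fps 3) n = - 2 * qsum n (\<lambda>a b x y. x = y) g"
      using main da unfolding L by (simp add: algebra_simps)
    also have "\<dots> = 2 * (fps_nth (sigma_fps 7 - sigma_fps 3) n / 120)"
      unfolding dx by (simp add: sigma_fps_sum[OF n] sum_subtractf sum_divide_distrib[symmetric] sum_negf)
    finally show ?thesis by simp
  qed
qed

text \<open>The constants fit: 120 * 2 / 240 = 1 cancels \<open>- sigma_fps 3\<close>, and 120 /
  240^2 = 1/480.\<close>

lemma Eis_8: "Eis 8 = fps_const 120 * (Eis 4 * Eis 4)"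
proof -
  have c: "eis_const 4 = 1/240" "eis_const 8 = 1/480"
    by (simp_all add: eis_const_def bernc_values fact_numeral)
  have 4: "Eis 4 = sigma_fps 3 + fps_const (1/240)" and 8: "Eis 8 = sigma_fps 7 + fps_const (1/480)"
    using Eis_split[of 4] Eis_split[of 8] by (simp_all add: c geis_def)
  have "fps_const 120 * (Eis 4 * Eis 4) = fps_const 120 * (sigma_fps 3 * sigma_fps 3)
    + fps_const 120 * (fps_const (1/240) + fps_const (1/240)) * sigma_fps 3
    + fps_const 120 * (fps_const (1/240) * fps_const (1/240))"
    unfolding 4 by (simp only: algebra_simps)
  also have "\<dots> = Eis 8"
    unfolding sigma_3_convolution 8 fps_const_add fps_const_mult by simp
  finally show ?thesis by simp
qed

section \<open>Quasimodular forms\<close>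

lemma finite_quasi_index: "finite {(a, b, c). 2 * a + 4 * b + 6 * c = (k :: nat)}"
  by (rule finite_subset[of _ "{..k} \<times> {..k} \<times> {..k}"]) auto

lemma quasimodular_iff:
  "f \<in> quasimodular k \<longleftrightarrow> (\<exists>r. f = (\<Sum>(a, b, c) \<in> {(a, b, c). 2 * a + 4 * b + 6 * c = k}.
        fps_const (r a b c) * Eis 2 ^ a * Eis 4 ^ b * Eis 6 ^ c))"
  by (auto simp: quasimodular_def)

lemma quasimodular_0: "0 \<in> quasimodular k"
  unfolding quasimodular_iff by (rule exI[of _ "\<lambda>_ _ _. 0"]) simp

lemma quasimodular_add:
  assumes "f \<in> quasimodular k" "g \<in> quasimodular k"
  shows "f + g \<in> quasimodular k"
proof -
  obtain r s where "f = (\<Sum>(a, b, c) \<in> {(a, b, c). 2 * a + 4 * b + 6 * c = k}. fps_const (r a b c) * Eis 2 ^ a * Eis 4 ^ b * Eis 6 ^ c)"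
    "g = (\<Sum>(a, b, c) \<in> {(a, b, c). 2 * a + 4 * b + 6 * c = k}. fps_const (s a b c) * Eis 2 ^ a * Eis 4 ^ b * Eis 6 ^ c)"
    using assms unfolding quasimodular_iff by blast
  then show ?thesis unfolding quasimodular_iff
    by (intro exI[of _ "\<lambda>a b c. r a b c + s a b c"])
       (simp add: split_def algebra_simps sum.distrib flip: fps_const_add)
qed

lemma quasimodular_sum: "(\<And>x. x \<in> A \<Longrightarrow> F x \<in> quasimodular k) \<Longrightarrow> sum F A \<in> quasimodular k"
  by (induction A rule: infinite_finite_induct) (auto intro: quasimodular_0 quasimodular_add)

lemma quasimodular_monomial:
  "fps_const x * Eis 2 ^ a * Eis 4 ^ b * Eis 6 ^ c \<in> quasimodular (2 * a + 4 * b + 6 * c)"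
proof -
  let ?I = "{(a', b', c'). 2 * a' + 4 * b' + 6 * c' = 2 * a + 4 * b + 6 * c}"
  have "(\<Sum>(a', b', c')\<in>?I. fps_const (if (a', b', c') = (a, b, c) then x else 0) * Eis 2 ^ a' * Eis 4 ^ b' * Eis 6 ^ c')
     = (\<Sum>i\<in>?I. if i = (a, b, c) then fps_const x * Eis 2 ^ a * Eis 4 ^ b * Eis 6 ^ c else 0)"
  proof (intro sum.cong refl)
    fix i assume "i \<in> ?I"
    obtain a' b' c' where i: "i = (a', b', c')" by (cases i)
    show "(case i of (a', b', c') \<Rightarrow> fps_const (if (a', b', c') = (a, b, c) then x else 0) * Eis 2 ^ a' * Eis 4 ^ b' * Eis 6 ^ c')
       = (if i = (a, b, c) then fps_const x * Eis 2 ^ a * Eis 4 ^ b * Eis 6 ^ c else 0)"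
    proof (cases "i = (a, b, c)")
      case False
      then show ?thesis
        unfolding i by (simp only: prod.case if_False fps_const_0_eq_0 mult_zero_left)
    qed simp
  qed
  also have "\<dots> = fps_const x * Eis 2 ^ a * Eis 4 ^ b * Eis 6 ^ c"
    using finite_quasi_index by simp
  finally have e: "fps_const x * Eis 2 ^ a * Eis 4 ^ b * Eis 6 ^ c =
    (\<Sum>(a', b', c')\<in>?I. fps_const (if (a', b', c') = (a, b, c) then x else 0) * Eis 2 ^ a' * Eis 4 ^ b' * Eis 6 ^ c')" ..
  show ?thesis unfolding quasimodular_iff
    by (rule exI[of _ "\<lambda>a' b' c'. if (a', b', c') = (a, b, c) then x else 0"]) (rule e)
qed

lemma quasimodular_mult:
  assumes "f \<in> quasimodular k" "g \<in> quasimodular l"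
  shows "f * g \<in> quasimodular (k + l)"
proof -
  obtain r s where fg: "f = (\<Sum>(a, b, c) \<in> {(a, b, c). 2 * a + 4 * b + 6 * c = k}. fps_const (r a b c) * Eis 2 ^ a * Eis 4 ^ b * Eis 6 ^ c)"
    "g = (\<Sum>(a, b, c) \<in> {(a, b, c). 2 * a + 4 * b + 6 * c = l}. fps_const (s a b c) * Eis 2 ^ a * Eis 4 ^ b * Eis 6 ^ c)"
    using assms unfolding quasimodular_iff by blast
  show ?thesis unfolding fg sum_product
  proof (intro quasimodular_sum, clarify)
    fix a b c a' b' c' :: nat
    assume "k = 2 * a + 4 * b + 6 * c" "l = 2 * a' + 4 * b' + 6 * c'"
    have "fps_const (r a b c) * Eis 2 ^ a * Eis 4 ^ b * Eis 6 ^ c * (fps_const (s a' b' c') * Eis 2 ^ a' * Eis 4 ^ b' * Eis 6 ^ c')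
      = fps_const (r a b c * s a' b' c') * Eis 2 ^ (a + a') * Eis 4 ^ (b + b') * Eis 6 ^ (c + c')"
      by (simp add: power_add mult_ac flip: fps_const_mult)
    also have "\<dots> \<in> quasimodular (2 * (a + a') + 4 * (b + b') + 6 * (c + c'))"
      by (rule quasimodular_monomial)
    finally show "fps_const (r a b c) * Eis 2 ^ a * Eis 4 ^ b * Eis 6 ^ c * (fps_const (s a' b' c') * Eis 2 ^ a' * Eis 4 ^ b' * Eis 6 ^ c')
      \<in> quasimodular (2 * a + 4 * b + 6 * c + (2 * a' + 4 * b' + 6 * c'))" by (simp add: algebra_simps)
  qed
qed

lemma quasimodular_const: "fps_const x \<in> quasimodular 0"
  using quasimodular_monomial[of x 0 0 0] by simp

lemma quasimodular_scale: "f \<in> quasimodular k \<Longrightarrow> fps_const x * f \<in> quasimodular k"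
  using quasimodular_mult[OF quasimodular_const[of x], of f k] by simp

lemma quasimodular_uminus: "f \<in> quasimodular k \<Longrightarrow> - f \<in> quasimodular k"
  using quasimodular_scale[of f k "-1"] by (simp flip: fps_const_neg)

lemma quasimodular_diff: "f \<in> quasimodular k \<Longrightarrow> g \<in> quasimodular k \<Longrightarrow> f - g \<in> quasimodular k"
  using quasimodular_add[of f k "- g"] quasimodular_uminus[of g k] by simp

lemma quasimodular_Eis_246: "Eis 2 \<in> quasimodular 2" "Eis 4 \<in> quasimodular 4" "Eis 6 \<in> quasimodular 6"
  using quasimodular_monomial[of 1 1 0 0] quasimodular_monomial[of 1 0 1 0] quasimodular_monomial[of 1 0 0 1]
  by simp_all

lemma Eis_odd: "odd k \<Longrightarrow> Eis k = 0"
  by (simp add: Eis_def)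

lemma quasimodular_Eis_product:
  assumes "\<And>m. 2 \<le> m \<Longrightarrow> m < n \<Longrightarrow> Eis m \<in> quasimodular m" "i < n" "j < n" "i + j = n"
  shows "Eis i * Eis j \<in> quasimodular n"
proof (cases "i = 1 \<or> j = 1")
  case True
  then show ?thesis by (auto simp: Eis_odd quasimodular_0)
next
  case False
  with assms(2-4) have "2 \<le> i" "2 \<le> j" by linarith+
  then have "Eis i \<in> quasimodular i" "Eis j \<in> quasimodular j" using assms by simp_all
  then show ?thesis using quasimodular_mult[of "Eis i" i "Eis j" j] assms(4) by simp
qed

text \<open>In \<open>Eis_heat\<close> all terms but two are products of Eisenstein series of lower
  weight, and the coefficient \<open>x\<close> is positive. One direction yields the derivatives of
  G_2, G_4, G_6, the other the next Eisenstein series from a derivative.\<close>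

lemma quasimodular_heat:
  assumes r: "0 < r" and E: "\<And>m. 2 \<le> m \<Longrightarrow> m \<le> 2 * r \<Longrightarrow> Eis m \<in> quasimodular m"
  shows "fps_XD (Eis (2 * r)) \<in> quasimodular (2 * r + 2) \<longleftrightarrow> Eis (2 * r + 2) \<in> quasimodular (2 * r + 2)"
proof -
  define S where "S = (\<Sum>j\<le>2 * r. fps_const (of_nat (2 * r choose j)) * (Eis (j + 1) * Eis (2 * r + 1 - j)))"
  define x :: rat where "x = 1/2 + 1 / (2 * of_nat r + 1)"
  have "S \<in> quasimodular (2 * r + 2)"
    unfolding S_def
  proof (intro quasimodular_sum quasimodular_scale)
    fix j assume j: "j \<in> {..2 * r}"
    have odd: "Eis (2 * r + 1) = 0" "Eis 1 = 0" by (simp_all add: Eis_odd)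
    show "Eis (j + 1) * Eis (2 * r + 1 - j) \<in> quasimodular (2 * r + 2)"
    proof (cases "j = 0 \<or> j = 2 * r")
      case True
      then show ?thesis using odd by (auto simp: quasimodular_0)
    next
      case False
      with j show ?thesis
      proof (intro quasimodular_Eis_product)
        show "Eis m \<in> quasimodular m" if "2 \<le> m" "m < 2 * r + 2" for m
        proof (cases "m = 2 * r + 1")
          case True
          then show ?thesis using odd(1) by (simp add: quasimodular_0)
        qed (use that in \<open>auto intro!: E\<close>)
      qed auto
    qed
  qed
  note S = this
  have e: "S = - fps_XD (Eis (2 * r)) + fps_const x * Eis (2 * r + 2)"
    unfolding S_def x_def by (rule Eis_heat[OF r])
  have x: "x \<noteq> 0"
  proof -
    have "0 < x" unfolding x_def by (intro add_pos_pos) auto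
    then show ?thesis by simp
  qed
  have D: "fps_XD (Eis (2 * r)) = fps_const x * Eis (2 * r + 2) - S"
    unfolding e by simp
  have "fps_const (1 / x) * (fps_XD (Eis (2 * r)) + S) = fps_const (1 / x * x) * Eis (2 * r + 2)"
    unfolding e by (simp flip: mult.assoc)
  then have E2: "Eis (2 * r + 2) = fps_const (1 / x) * (fps_XD (Eis (2 * r)) + S)"
    using x by simp
  show ?thesis
  proof
    assume "fps_XD (Eis (2 * r)) \<in> quasimodular (2 * r + 2)"
    then show "Eis (2 * r + 2) \<in> quasimodular (2 * r + 2)"
      by (subst E2) (intro quasimodular_scale quasimodular_add S)
  next
    assume "Eis (2 * r + 2) \<in> quasimodular (2 * r + 2)"
    then show "fps_XD (Eis (2 * r)) \<in> quasimodular (2 * r + 2)"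
      unfolding D by (intro quasimodular_scale quasimodular_diff S)
  qed
qed

definition quasi_closed :: "nat \<Rightarrow> rat fps \<Rightarrow> bool" where
  "quasi_closed k f \<longleftrightarrow> f \<in> quasimodular k \<and> fps_XD f \<in> quasimodular (k + 2)"

lemma fps_XD_mult: "fps_XD (f * g :: rat fps) = fps_XD f * g + f * fps_XD g"
  by (simp add: fps_XD_def algebra_simps)

lemma quasi_closed_mult: "quasi_closed k f \<Longrightarrow> quasi_closed l g \<Longrightarrow> quasi_closed (k + l) (f * g)"
  unfolding quasi_closed_def fps_XD_mult
  using quasimodular_mult[of "fps_XD f" "k + 2" g l] quasimodular_mult[of f k "fps_XD g" "l + 2"]
  by (auto intro!: quasimodular_mult quasimodular_add simp: algebra_simps)

lemma quasi_closed_const: "quasi_closed 0 (fps_const x)"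
  by (simp add: quasi_closed_def quasimodular_const quasimodular_0 fps_XD_def)

lemma quasi_closed_power: "quasi_closed k f \<Longrightarrow> quasi_closed (k * n) (f ^ n)"
proof (induction n)
  case 0
  then show ?case using quasi_closed_const[of 1] by simp
next
  case (Suc n)
  then show ?case using quasi_closed_mult[of k f "k * n" "f ^ n"] by simp
qed

text \<open>Ramanujan's differential equations: r = 1, 2, 3 reduce the derivatives to G_4, G_6 and
  G_8, and G_8 is a multiple of G_4^2.\<close>

lemma quasi_closed_Eis_246: "quasi_closed 2 (Eis 2)" "quasi_closed 4 (Eis 4)" "quasi_closed 6 (Eis 6)"
proof -
  have odd: "Eis m \<in> quasimodular m" if "odd m" for m using that by (simp add: Eis_odd quasimodular_0)
  have E: "Eis m \<in> quasimodular m" if "2 \<le> m" "m \<le> 6" for m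
  proof -
    have "m = 2 \<or> m = 3 \<or> m = 4 \<or> m = 5 \<or> m = 6" using that by auto
    then show ?thesis using quasimodular_Eis_246 odd[of 3] odd[of 5] by auto
  qed
  have E8: "Eis 8 \<in> quasimodular 8"
    unfolding Eis_8 using quasimodular_mult[OF quasimodular_Eis_246(2) quasimodular_Eis_246(2)]
    by (intro quasimodular_scale) simp
  have h: "fps_XD (Eis (2 * r)) \<in> quasimodular (2 * r + 2)"
    if "0 < r" "2 * r \<le> 6" "Eis (2 * r + 2) \<in> quasimodular (2 * r + 2)" for r
    using quasimodular_heat[OF that(1)] E that(2,3) by auto
  have "fps_XD (Eis 2) \<in> quasimodular 4" "fps_XD (Eis 4) \<in> quasimodular 6" "fps_XD (Eis 6) \<in> quasimodular 8"
    using h[of 1] h[of 2] h[of 3] E8 quasimodular_Eis_246 by simp_all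
  then show "quasi_closed 2 (Eis 2)" "quasi_closed 4 (Eis 4)" "quasi_closed 6 (Eis 6)"
    by (simp_all add: quasi_closed_def quasimodular_Eis_246)
qed

lemma fps_XD_sum: "fps_XD (sum F A :: rat fps) = (\<Sum>x\<in>A. fps_XD (F x))"
  by (induction A rule: infinite_finite_induct) (auto simp: fps_XD_def algebra_simps)

lemma quasimodular_fps_XD:
  assumes "f \<in> quasimodular k"
  shows "fps_XD f \<in> quasimodular (k + 2)"
proof -
  obtain r where f: "f = (\<Sum>(a, b, c) \<in> {(a, b, c). 2 * a + 4 * b + 6 * c = k}. fps_const (r a b c) * Eis 2 ^ a * Eis 4 ^ b * Eis 6 ^ c)"
    using assms unfolding quasimodular_iff by blast
  show ?thesis unfolding f fps_XD_sum
  proof (intro quasimodular_sum, clarify)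
    fix a b c :: nat
    have "quasi_closed (0 + 2 * a + 4 * b + 6 * c) (fps_const (r a b c) * Eis 2 ^ a * Eis 4 ^ b * Eis 6 ^ c)"
      by (intro quasi_closed_mult quasi_closed_power quasi_closed_const quasi_closed_Eis_246)
    then show "fps_XD (fps_const (r a b c) * Eis 2 ^ a * Eis 4 ^ b * Eis 6 ^ c) \<in> quasimodular (2 * a + 4 * b + 6 * c + 2)"
      by (simp add: quasi_closed_def)
  qed
qed

text \<open>Once the ring is closed under q d/dq, the heat relation is read backwards: the
  derivative of G_(k-2) gives G_k.\<close>

lemma quasimodular_Eis: "2 \<le> k \<Longrightarrow> Eis k \<in> quasimodular k"
proof (induction k rule: less_induct)
  case (less k)
  show ?case
  proof (cases "odd k \<or> k = 2")
    case True
    then show ?thesis using quasimodular_Eis_246 by (auto simp: Eis_odd quasimodular_0)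
  next
    case False
    then obtain t where t: "k = 2 * t" by (auto elim: evenE)
    with False less.prems have "2 \<le> t" by auto
    with t have k: "k = 2 * (t - 1) + 2" "0 < t - 1" by simp_all
    define r where "r = t - 1"
    note k = k[folded r_def]
    have "Eis (2 * r) \<in> quasimodular (2 * r)" using less.IH[of "2 * r"] k by simp
    from quasimodular_fps_XD[OF this] show ?thesis
      using quasimodular_heat[OF k(2)] less.IH k(1) by simp
  qed
qed

lemma quasimodular_Eis_deriv: "2 \<le> i \<Longrightarrow> Eis_deriv i j \<in> quasimodular (i + 2 * j)"
proof (induction j)
  case 0
  then show ?case by (simp add: Eis_deriv_def quasimodular_Eis)
next
  case (Suc j)
  then show ?case using quasimodular_fps_XD[of "Eis_deriv i j" "i + 2 * j"]
    by (simp add: Eis_deriv_def)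
qed

section \<open>Partitions as bead sets\<close>

text \<open>Represents the difference of two sums that may each diverge; only the symmetric
  difference of the sets contributes.\<close>

definition diffsum :: "(int \<Rightarrow> 'a::comm_ring_1) \<Rightarrow> int set \<Rightarrow> int set \<Rightarrow> 'a" where
  "diffsum \<phi> A B = (\<Sum>s\<in>A - B. \<phi> s) - (\<Sum>s\<in>B - A. \<phi> s)"

definition almost_eq :: "int set \<Rightarrow> int set \<Rightarrow> bool" where
  "almost_eq A B \<longleftrightarrow> finite (A - B) \<and> finite (B - A)"

definition maya :: "int set \<Rightarrow> bool" where
  "maya S \<longleftrightarrow> almost_eq S {..<0}"

text \<open>
  The sum of \<open>\<phi>\<close> over \<open>S\<close>, regularised by subtracting the divergent sum over the vacuum \<open>{..<0}\<close>.
\<close>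

definition pw :: "(int \<Rightarrow> 'a::comm_ring_1) \<Rightarrow> int set \<Rightarrow> 'a" where
  "pw \<phi> S = diffsum \<phi> S {..<0}"

lemma almost_eq_refl [simp]: "almost_eq A A"
  by (simp add: almost_eq_def)

lemma almost_eq_sym: "almost_eq A B \<Longrightarrow> almost_eq B A"
  by (simp add: almost_eq_def)

lemma almost_eq_trans:
  assumes "almost_eq A B" "almost_eq B C"
  shows "almost_eq A C"
proof -
  have "A - C \<subseteq> (A - B) \<union> (B - C)" "C - A \<subseteq> (C - B) \<union> (B - A)" by auto
  with assms show ?thesis unfolding almost_eq_def by (meson finite_Un finite_subset)
qed

lemma diffsum_eq:
  assumes "finite F" "A - B \<subseteq> F" "B - A \<subseteq> F"
  shows "diffsum \<phi> A B = (\<Sum>s\<in>F. \<phi> s * (of_bool (s \<in> A) - of_bool (s \<in> B)))"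
proof -
  have "(\<Sum>s\<in>F. \<phi> s * (of_bool (s \<in> A) - of_bool (s \<in> B))) =
     (\<Sum>s\<in>F. (if s \<in> A - B then \<phi> s else 0) - (if s \<in> B - A then \<phi> s else 0))"
    by (intro sum.cong) auto
  also have "\<dots> = (\<Sum>s\<in>F \<inter> (A - B). \<phi> s) - (\<Sum>s\<in>F \<inter> (B - A). \<phi> s)"
    unfolding sum_subtractf using assms(1) by (simp only: sum.inter_restrict)
  moreover have "F \<inter> (A - B) = A - B" "F \<inter> (B - A) = B - A" using assms by auto
  ultimately show ?thesis by (simp add: diffsum_def)
qed

lemma diffsum_trans:
  assumes "almost_eq A B" "almost_eq B C"
  shows "diffsum \<phi> A C = diffsum \<phi> A B + diffsum \<phi> B C"
proof -
  let ?F = "(A - B) \<union> (B - A) \<union> (B - C) \<union> (C - B)"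
  have F: "finite ?F" using assms by (auto simp: almost_eq_def)
  have "diffsum \<phi> A C = (\<Sum>s\<in>?F. \<phi> s * (of_bool (s \<in> A) - of_bool (s \<in> C)))"
    by (rule diffsum_eq[OF F]) auto
  moreover have "diffsum \<phi> A B = (\<Sum>s\<in>?F. \<phi> s * (of_bool (s \<in> A) - of_bool (s \<in> B)))"
    by (rule diffsum_eq[OF F]) auto
  moreover have "diffsum \<phi> B C = (\<Sum>s\<in>?F. \<phi> s * (of_bool (s \<in> B) - of_bool (s \<in> C)))"
    by (rule diffsum_eq[OF F]) auto
  ultimately show ?thesis
    by (simp add: sum.distrib[symmetric] algebra_simps)
qed

lemma diffsum_swap: "diffsum \<phi> B A = - diffsum \<phi> A B"
  by (simp add: diffsum_def)

lemma diffsum_image: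
  assumes "inj f"
  shows "diffsum \<phi> (f ` A) (f ` B) = diffsum (\<lambda>s. \<phi> (f s)) A B"
proof -
  have "f ` A - f ` B = f ` (A - B)" "f ` B - f ` A = f ` (B - A)"
    using image_set_diff[OF assms] by auto
  then show ?thesis
    using inj_on_subset[OF assms] by (simp add: diffsum_def sum.reindex)
qed

lemma almost_eq_image: "inj f \<Longrightarrow> almost_eq A B \<Longrightarrow> almost_eq (f ` A) (f ` B)"
  by (simp add: almost_eq_def image_set_diff[symmetric])

lemma diffsum_linear:
  "diffsum (\<lambda>s. \<phi> s + \<psi> s) A B = diffsum \<phi> A B + diffsum \<psi> A B"
  "diffsum (\<lambda>s. \<phi> s - \<psi> s) A B = diffsum \<phi> A B - diffsum \<psi> A B"
  "diffsum (\<lambda>s. c * \<phi> s) A B = c * diffsum \<phi> A B"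
  by (simp_all add: diffsum_def sum.distrib sum_subtractf sum_distrib_left algebra_simps)

lemma diffsum_sum: "diffsum (\<lambda>s. \<Sum>i\<in>I. \<phi> i s) A B = (\<Sum>i\<in>I. diffsum (\<phi> i) A B)"
  unfolding diffsum_def sum_subtractf by (simp add: sum.swap[of _ I])

lemma pw_insert:
  assumes "maya S" "s \<notin> S"
  shows "maya (insert s S)" "pw \<phi> (insert s S) = pw \<phi> S + \<phi> s"
proof -
  have d: "insert s S - S = {s}" "S - insert s S = {}" using assms(2) by auto
  have a: "almost_eq (insert s S) S" unfolding almost_eq_def d by simp
  show "maya (insert s S)" using almost_eq_trans[OF a] assms(1) by (simp add: maya_def)
  have "diffsum \<phi> (insert s S) S = \<phi> s" unfolding diffsum_def d by simp
  then show "pw \<phi> (insert s S) = pw \<phi> S + \<phi> s"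
    using diffsum_trans[OF a, of "{..<0}" \<phi>] assms(1) by (simp add: pw_def maya_def)
qed

lemma pw_remove:
  assumes "maya S" "s \<in> S"
  shows "maya (S - {s})" "pw \<phi> (S - {s}) = pw \<phi> S - \<phi> s"
proof -
  have d: "(S - {s}) - S = {}" "S - (S - {s}) = {s}" using assms(2) by auto
  have a: "almost_eq (S - {s}) S" unfolding almost_eq_def d by simp
  show "maya (S - {s})" using almost_eq_trans[OF a] assms(1) by (simp add: maya_def)
  have "diffsum \<phi> (S - {s}) S = - \<phi> s" unfolding diffsum_def d by simp
  then show "pw \<phi> (S - {s}) = pw \<phi> S - \<phi> s"
    using diffsum_trans[OF a, of "{..<0}" \<phi>] assms(1) by (simp add: pw_def maya_def)
qed

text \<open>
  Bead sets of charge \<open>c\<close> and energy \<open>E\<close>; those of charge \<open>0\<close> are the partitions of \<open>E\<close>.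
\<close>

definition mayas :: "int \<Rightarrow> int \<Rightarrow> int set set" where
  "mayas c E = {S. maya S \<and> pw (\<lambda>_. 1) S = c \<and> pw (\<lambda>s. s) S = E}"

section \<open>The bead set of a partition\<close>

definition part :: "nat list \<Rightarrow> nat \<Rightarrow> nat" where
  "part xs i = (if i < length xs then xs ! i else 0)"

definition bead :: "nat list \<Rightarrow> nat \<Rightarrow> int" where
  "bead xs i = int (part xs i) - int i - 1"

definition beads :: "nat list \<Rightarrow> int set" where
  "beads xs = range (bead xs)"

lemma part_antimono:
  assumes "sorted_wrt (\<ge>) xs" "i \<le> j"
  shows "part xs j \<le> part xs i"
  using assms sorted_wrt_nth_less[OF assms(1), of i j] by (cases "i = j") (auto simp: part_def)

lemma bead_strict:
  assumes "sorted_wrt (\<ge>) xs" "i < j"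
  shows "bead xs j < bead xs i"
  using part_antimono[OF assms(1), of i j] assms(2) by (simp add: bead_def)

lemma bead_inj: "sorted_wrt (\<ge>) xs \<Longrightarrow> inj (bead xs)"
  by (metis bead_strict injI less_irrefl nat_neq_iff)

lemma beads_decompose:
  "beads xs = bead xs ` {..<length xs} \<union> {..<- int (length xs)}"
proof -
  have "bead xs ` {length xs..} = {..<- int (length xs)}"
  proof
    show "{..<- int (length xs)} \<subseteq> bead xs ` {length xs..}"
    proof
      fix z assume "z \<in> {..<- int (length xs)}"
      then have "z = bead xs (nat (- z - 1))" "nat (- z - 1) \<in> {length xs..}"
        by (auto simp: bead_def part_def)
      then show "z \<in> bead xs ` {length xs..}" by (rule image_eqI)
    qed
  qed (auto simp: bead_def part_def)
  moreover have "UNIV = {..<length xs} \<union> {length xs..}" by auto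
  ultimately show ?thesis unfolding beads_def by (metis image_Un)
qed

lemma bead_ge: "i < length xs \<Longrightarrow> - int (length xs) \<le> bead xs i"
  by (simp add: bead_def)

lemma pw_beads:
  assumes "sorted_wrt (\<ge>) xs"
  shows "maya (beads xs)"
    and "pw \<phi> (beads xs) = (\<Sum>i<length xs. \<phi> (bead xs i) - \<phi> (- int i - 1))"
proof -
  let ?n = "length xs"
  let ?V = "{..<- int ?n}"
  have d1: "beads xs - ?V = bead xs ` {..<?n}" "?V - beads xs = {}"
    using bead_ge[of _ xs] unfolding beads_decompose by force+
  have d2: "?V - {..<0} = {}" "{..<0} - ?V = (\<lambda>i. - int i - 1) ` {..<?n}"
  proof -
    show "{..<0} - ?V = (\<lambda>i. - int i - 1) ` {..<?n}"
    proof
      show "{..<0} - ?V \<subseteq> (\<lambda>i. - int i - 1) ` {..<?n}"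
      proof
        fix z assume "z \<in> {..<0} - ?V"
        then have "z = - int (nat (- z - 1)) - 1" "nat (- z - 1) \<in> {..<?n}" by auto
        then show "z \<in> (\<lambda>i. - int i - 1) ` {..<?n}" by (rule image_eqI)
      qed
    qed auto
  qed auto
  have a: "almost_eq (beads xs) ?V" "almost_eq ?V {..<0}"
    unfolding almost_eq_def d1 d2 by simp_all
  show "maya (beads xs)" unfolding maya_def using a by (rule almost_eq_trans)
  have "diffsum \<phi> (beads xs) ?V = (\<Sum>i<?n. \<phi> (bead xs i))"
    unfolding diffsum_def d1 using inj_on_subset[OF bead_inj[OF assms]] by (simp add: sum.reindex)
  moreover have "diffsum \<phi> ?V {..<0} = - (\<Sum>i<?n. \<phi> (- int i - 1))"
    unfolding diffsum_def d2 by (subst sum.reindex) (auto simp: inj_on_def)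
  ultimately show "pw \<phi> (beads xs) = (\<Sum>i<?n. \<phi> (bead xs i) - \<phi> (- int i - 1))"
    unfolding pw_def diffsum_trans[OF a] by (simp add: sum_subtractf)
qed

lemma beads_mayas:
  assumes "sorted_wrt (\<ge>) xs"
  shows "beads xs \<in> mayas 0 (int (sum_list xs))"
proof -
  have "(\<Sum>i<length xs. bead xs i - (- int i - 1)) = int (\<Sum>i<length xs. xs ! i)"
    unfolding of_nat_sum by (intro sum.cong) (auto simp: bead_def part_def)
  then show ?thesis
    unfolding mayas_def by (simp add: pw_beads[OF assms] sum_list_sum_nth atLeast0LessThan)
qed

text \<open>When the first i values agree, \<open>h i\<close> must be some \<open>k j\<close> with j
  \<ge> i and is therefore at most \<open>k i\<close>; the reverse inequality holds by
  symmetry.\<close>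

lemma strict_decreasing_range_eq:
  fixes f g :: "nat \<Rightarrow> int"
  assumes f: "\<And>i j. i < j \<Longrightarrow> f j < f i" and g: "\<And>i j. i < j \<Longrightarrow> g j < g i"
    and r: "range f = range g"
  shows "f i = g i"
proof (induction i rule: less_induct)
  case (less i)
  have *: "h i \<le> k i" if h: "\<And>i j. i < j \<Longrightarrow> h j < h i" and k: "\<And>i j. i < j \<Longrightarrow> k j < k i"
    and r: "range h = range k" and IH: "\<And>j. j < i \<Longrightarrow> h j = k j" for h k :: "nat \<Rightarrow> int"
  proof -
    have "h i \<in> range k" using r by blast
    then obtain j where j: "h i = k j" by blast
    have "\<not> j < i"
    proof
      assume "j < i"
      then show False using IH[of j] h[of j i] j by simp
    qed
    then show ?thesis using j k[of i j] by (cases "i = j") auto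
  qed
  show ?case
    using *[of f g] *[of g f] f g r less by (metis order_antisym)
qed

lemma beads_inj:
  assumes "sorted_wrt (\<ge>) xs" "0 \<notin> set xs" "sorted_wrt (\<ge>) ys" "0 \<notin> set ys" "beads xs = beads ys"
  shows "xs = ys"
proof -
  have "bead xs i = bead ys i" for i
    using assms(5) bead_strict[OF assms(1)] bead_strict[OF assms(3)]
    unfolding beads_def by (intro strict_decreasing_range_eq) auto
  then have p: "part xs i = part ys i" for i by (simp add: bead_def)
  have nz: "part zs i \<noteq> 0 \<longleftrightarrow> i < length zs" if "0 \<notin> set zs" for zs i
  proof (cases "i < length zs")
    case True
    then have "zs ! i \<in> set zs" by (rule nth_mem)
    with that have "zs ! i \<noteq> 0" by metis
    with True show ?thesis by (simp add: part_def)
  qed (simp add: part_def)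
  have "i < length xs \<longleftrightarrow> i < length ys" for i
    using nz[OF assms(2), of i] nz[OF assms(4), of i] p[of i] by simp
  then have "length xs = length ys" by (meson linorder_neqE_nat less_irrefl)
  moreover have "xs ! i = ys ! i" if "i < length xs" for i
    using p[of i] that \<open>length xs = length ys\<close> by (simp add: part_def)
  ultimately show ?thesis by (intro nth_equalityI) auto
qed

lemma part_filter:
  assumes "sorted_wrt (\<ge>) ys"
  shows "part (filter (\<lambda>x. x \<noteq> 0) ys) i = part ys i"
  using assms
proof (induction ys arbitrary: i)
  case (Cons y ys)
  show ?case
  proof (cases "y = 0")
    case True
    with Cons.prems have z: "\<forall>x\<in>set (y # ys). x = 0" by auto
    then have "filter (\<lambda>x. x \<noteq> 0) (y # ys) = []" by (auto simp: filter_empty_conv)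
    moreover have "part (y # ys) i = 0" using z nth_mem[of i "y # ys"] by (auto simp: part_def)
    ultimately show ?thesis by (simp add: part_def)
  next
    case False
    have "part (y # zs) i = (case i of 0 \<Rightarrow> y | Suc j \<Rightarrow> part zs j)" for zs
      by (cases i) (auto simp: part_def)
    then show ?thesis using False Cons by (auto split: nat.splits)
  qed
qed simp

lemma maya_bound:
  assumes "maya S"
  obtains N :: nat where "{..<- int N} \<subseteq> S"
proof -
  have fin: "finite ({..<0} - S)" using assms by (simp add: maya_def almost_eq_def)
  \<comment> \<open>The sum of all \<open>- z\<close> over the finitely many gaps bounds each single
    one.\<close>
  define N where "N = nat (\<Sum>z\<in>{..<0} - S. - z)"
  have "z \<in> S" if "z < - int N" for z
  proof (rule ccontr)
    assume "z \<notin> S"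
    with that have z: "z \<in> {..<0} - S" by auto
    have "- z \<le> (\<Sum>z\<in>{..<0} - S. - z)"
      using fin z by (intro member_le_sum[of z _ "\<lambda>z. - z"]) auto
    moreover have "(\<Sum>z\<in>{..<0} - S. - z) \<le> int N" unfolding N_def by simp
    ultimately show False using that by linarith
  qed
  then show ?thesis using that[of N] by auto
qed

text \<open>Below -N every site is occupied, so charge 0 leaves exactly N further beads. Listed in
  decreasing order they give N parts, some possibly 0; these are filtered out at the end, which does
  not change the bead set.\<close>

lemma maya_surj:
  assumes S: "maya S" and c: "pw (\<lambda>_. 1) S = (0 :: int)"
  obtains xs where "sorted_wrt (\<ge>) xs" "0 \<notin> set xs" "beads xs = S"
proof -
  obtain N :: nat where N: "{..<- int N} \<subseteq> S" using maya_bound[OF S] .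
  let ?V = "{..<- int N}"
  let ?T = "S - ?V"
  have d: "?V - {..<0} = {}" "{..<0} - ?V = {- int N..<0}" by auto
  have a2: "almost_eq ?V {..<0}" unfolding almost_eq_def d by simp
  have a1: "almost_eq S ?V"
    using S almost_eq_trans almost_eq_sym[OF a2] by (auto simp: maya_def)
  then have fin: "finite ?T" by (simp add: almost_eq_def)
  have "int (card ?T) - int N = 0"
    using c N unfolding pw_def diffsum_trans[OF a1 a2] unfolding diffsum_def d
    by (simp add: Diff_eq_empty_iff[THEN iffD2])
  then have card: "card ?T = N" by simp
  define l where "l = rev (sorted_list_of_set ?T)"
  have l: "length l = N" "set l = ?T" "sorted_wrt (>) l"
    using fin card by (simp_all add: l_def sorted_wrt_rev)
  define ys where "ys = map (\<lambda>i. nat (l ! i + int i + 1)) [0..<N]"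
  \<comment> \<open>After \<open>l ! i\<close> the list has N - 1 - i further beads, all smaller and
    none below -N; this makes the parts nonnegative.\<close>
  have low: "- int N + int (N - 1 - i) \<le> l ! i" if "i < N" for i
    using that
  proof (induction "N - 1 - i" arbitrary: i)
    case 0
    then have "l ! i \<in> ?T" using l nth_mem by metis
    then show ?case using 0 by auto
  next
    case (Suc k)
    then have i: "Suc i < N" "k = N - 1 - Suc i" by auto
    have "l ! Suc i < l ! i"
      using sorted_wrt_nth_less[OF l(3), of i "Suc i"] i l(1) by simp
    with Suc.hyps(1)[OF i(2,1)] Suc.hyps(2) i show ?case by simp
  qed
  have ge: "0 \<le> l ! i + int i + 1" if "i < N" for i
    using low[OF that] that by (simp add: of_nat_diff)
  have sys: "sorted_wrt (\<ge>) ys"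
  proof (subst sorted_wrt_iff_nth_less, intro allI impI)
    fix i j assume ij: "i < j" "j < length ys"
    then have j: "j < N" by (simp add: ys_def)
    have step: "l ! Suc k < l ! k" if "Suc k < N" for k
      using sorted_wrt_nth_less[OF l(3), of k "Suc k"] that l(1) by simp
    have "l ! j + int j \<le> l ! i + int i"
      using ij(1) j
    proof (induction rule: strict_inc_induct)
      case (base i)
      then show ?case using step[of i] by simp
    next
      case (step i)
      then show ?case using \<open>\<And>k. Suc k < N \<Longrightarrow> l ! Suc k < l ! k\<close>[of i] by simp
    qed
    then show "ys ! j \<le> ys ! i" using ij j by (simp add: ys_def nat_mono)
  qed
  have bl: "bead ys i = l ! i" if "i < N" for i
    using that ge[OF that] by (simp add: bead_def part_def ys_def)
  have "beads ys = S"
  proof -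
    have "bead ys ` {..<N} = set l"
      using bl l(1) by (force simp: set_conv_nth)
    moreover have "length ys = N" by (simp add: ys_def)
    ultimately show ?thesis using N unfolding beads_decompose l(2) by auto
  qed
  moreover have "beads (filter (\<lambda>x. x \<noteq> 0) ys) = beads ys"
  proof -
    have "bead (filter (\<lambda>x. x \<noteq> 0) ys) = bead ys"
      using part_filter[OF sys] by (intro ext) (simp add: bead_def)
    then show ?thesis by (simp add: beads_def)
  qed
  moreover have "sorted_wrt (\<ge>) (filter (\<lambda>x. x \<noteq> 0) ys)" using sys by (rule sorted_wrt_filter)
  ultimately show ?thesis using that[of "filter (\<lambda>x. x \<noteq> 0) ys"] by auto
qed

lemma mayas_0_nonneg:
  assumes "S \<in> mayas 0 E"
  shows "0 \<le> E"
proof -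
  obtain xs where xs: "sorted_wrt (\<ge>) xs" "beads xs = S"
    using maya_surj[of S] assms unfolding mayas_def by blast
  then show ?thesis using beads_mayas[OF xs(1)] assms by (auto simp: mayas_def)
qed

lemma bij_beads: "bij_betw beads (partitions_of n) (mayas 0 (int n))"
proof (rule bij_betwI')
  fix xs ys assume "xs \<in> partitions_of n" "ys \<in> partitions_of n"
  then show "(beads xs = beads ys) = (xs = ys)"
    using beads_inj by (auto simp: partitions_of_def)
next
  fix xs assume "xs \<in> partitions_of n"
  then show "beads xs \<in> mayas 0 (int n)"
    using beads_mayas by (auto simp: partitions_of_def)
next
  fix S assume S: "S \<in> mayas 0 (int n)"
  then obtain xs where xs: "sorted_wrt (\<ge>) xs" "0 \<notin> set xs" "beads xs = S"
    using maya_surj[of S] unfolding mayas_def by blast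
  then have "sum_list xs = n"
    using beads_mayas[OF xs(1)] S by (auto simp: mayas_def)
  with xs show "\<exists>xs\<in>partitions_of n. S = beads xs" by (auto simp: partitions_of_def)
qed

lemma Qfun_beads:
  assumes "sorted_wrt (\<ge>) xs"
  shows "Qfun (Suc k) xs = pw (\<lambda>s. (of_int s + 1/2) ^ k) (beads xs) / fact k + beta (Suc k)"
proof -
  have "(\<Sum>i=1..length xs. (of_nat (xs ! (i - 1)) - of_nat i + 1/2) ^ k - (- of_nat i + 1/2) ^ k)
     = (\<Sum>i<length xs. (of_int (bead xs i) + 1/2) ^ k - (of_int (- int i - 1) + 1/2) ^ k :: rat)"
    by (rule sum.reindex_bij_witness[of _ Suc "\<lambda>i. i - 1"]) (auto simp: bead_def part_def algebra_simps)
  then show ?thesis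
    by (simp add: Qfun_def pw_beads(2)[OF assms])
qed

section \<open>Hooks\<close>

definition hooks :: "nat \<Rightarrow> int set \<Rightarrow> int set" where
  "hooks m S = {z. z \<notin> S \<and> z + int m \<in> S}"

definition addables :: "nat \<Rightarrow> int set \<Rightarrow> int set" where
  "addables m S = {z. z \<in> S \<and> z + int m \<notin> S}"

lemma almost_eq_shift:
  assumes "maya S"
  shows "almost_eq S ((\<lambda>s. s - int m) ` S)"
proof -
  let ?f = "\<lambda>s. s - int m"
  have a: "almost_eq (?f ` S) (?f ` {..<0})"
    using assms by (intro almost_eq_image) (auto simp: maya_def inj_def)
  have f: "?f ` {..<0} = {..<- int m}"
  proof
    show "{..<- int m} \<subseteq> ?f ` {..<0}"
    proof
      fix z assume "z \<in> {..<- int m}"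
      then have "z = ?f (z + int m)" "z + int m \<in> {..<0}" by auto
      then show "z \<in> ?f ` {..<0}" by (rule image_eqI)
    qed
  qed auto
  have d: "{..<- int m} - {..<0} = {}" "{..<0} - {..<- int m} = {- int m..<0}" by auto
  have "almost_eq {..<- int m} {..<0}" unfolding almost_eq_def d by simp
  with a assms show ?thesis
    unfolding f maya_def using almost_eq_trans almost_eq_sym by blast
qed

text \<open>Addable and removable hooks are the two halves of the symmetric difference between S and
  its translate by -m, so a signed sum over both is a \<open>diffsum\<close>.\<close>

lemma shift_diff:
  "S - (\<lambda>s. s - int m) ` S = addables m S" "(\<lambda>s. s - int m) ` S - S = hooks m S"
proof -
  have "z \<in> (\<lambda>s. s - int m) ` S \<longleftrightarrow> z + int m \<in> S" for z
    by (auto simp: image_iff) (metis add_diff_cancel_right')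
  then show "S - (\<lambda>s. s - int m) ` S = addables m S" "(\<lambda>s. s - int m) ` S - S = hooks m S"
    by (auto simp: addables_def hooks_def)
qed

lemma finite_hooks: "maya S \<Longrightarrow> finite (hooks m S)" "maya S \<Longrightarrow> finite (addables m S)"
  using almost_eq_shift[of S m] unfolding almost_eq_def shift_diff by auto

text \<open>S and its translate are compared through the vacuum and the translated vacuum; the last
  sum is the vacuum's own contribution.\<close>

lemma addables_minus_hooks:
  assumes "maya S"
  shows "(\<Sum>z\<in>addables m S. \<phi> z) - (\<Sum>z\<in>hooks m S. \<phi> z) =
    pw \<phi> S - pw (\<lambda>s. \<phi> (s - int m)) S + (\<Sum>s\<in>{- int m..<0}. \<phi> s)"
proof -
  let ?f = "\<lambda>s. s - int m"
  have inj: "inj ?f" by (simp add: inj_def)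
  have v: "maya {..<0}" by (simp add: maya_def)
  have f: "?f ` {..<0} = {..<- int m}"
  proof
    show "{..<- int m} \<subseteq> ?f ` {..<0}"
    proof
      fix z assume "z \<in> {..<- int m}"
      then have "z = ?f (z + int m)" "z + int m \<in> {..<0}" by auto
      then show "z \<in> ?f ` {..<0}" by (rule image_eqI)
    qed
  qed auto
  have d: "{..<- int m} - {..<0} = {}" "{..<0} - {..<- int m} = {- int m..<0}" by auto
  have "diffsum \<phi> S (?f ` S) = diffsum \<phi> S {..<0} + diffsum \<phi> {..<0} (?f ` S)"
    using assms almost_eq_trans[OF almost_eq_sym[OF assms[unfolded maya_def]] almost_eq_shift[OF assms]]
    by (intro diffsum_trans) (simp_all add: maya_def)
  also have "diffsum \<phi> {..<0} (?f ` S) = diffsum \<phi> {..<0} (?f ` {..<0}) + diffsum \<phi> (?f ` {..<0}) (?f ` S)"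
    using assms almost_eq_shift[OF v, of m] almost_eq_image[OF inj, of "{..<0}" S]
    by (intro diffsum_trans) (auto simp: maya_def intro: almost_eq_sym)
  also have "diffsum \<phi> (?f ` {..<0}) (?f ` S) = - pw (\<lambda>s. \<phi> (s - int m)) S"
    by (simp add: pw_def diffsum_image[OF inj] diffsum_swap[of _ "{..<0}"])
  also have "diffsum \<phi> {..<0} (?f ` {..<0}) = (\<Sum>s\<in>{- int m..<0}. \<phi> s)"
    unfolding f diffsum_def d by simp
  finally show ?thesis
    unfolding pw_def[of \<phi>] by (simp add: diffsum_def[of \<phi> S "?f ` S"] shift_diff)
qed

section \<open>Cells of the Young diagram as pairs of a bead and a hole\<close>

lemma finite_downset:
  assumes "finite A" "\<And>i j. i \<in> A \<Longrightarrow> j \<le> i \<Longrightarrow> j \<in> A"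
  shows "A = {..<card (A :: nat set)}"
proof -
  obtain n where n: "A = {..<n}"
  proof (cases "A = {}")
    case True
    then show ?thesis using that[of 0] by simp
  next
    case False
    have "A = {..Max A}"
      using assms(2)[OF Max_in[OF assms(1) False]] Max_ge[OF assms(1)] by auto
    then show ?thesis using that[of "Suc (Max A)"] by (simp add: lessThan_Suc_atMost)
  qed
  then show ?thesis by simp
qed

definition col :: "nat list \<Rightarrow> nat \<Rightarrow> nat" where
  "col xs j = card {i. j < part xs i}"

text \<open>
  The cell in row \<open>i\<close> and column \<open>j\<close> corresponds to the bead \<open>bead xs i\<close> above the empty site
  \<open>hole xs j\<close>; their distance is its hook length.
\<close>

definition hole :: "nat list \<Rightarrow> nat \<Rightarrow> int" where
  "hole xs j = int j - int (col xs j)"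

lemma less_part_iff:
  assumes "sorted_wrt (\<ge>) xs"
  shows "j < part xs i \<longleftrightarrow> i < col xs j"
proof -
  have "finite {i. j < part xs i}"
    by (rule finite_subset[of _ "{..<length xs}"]) (auto simp: part_def)
  then have "{i. j < part xs i} = {..<col xs j}"
    unfolding col_def using part_antimono[OF assms] le_trans less_le_trans
    by (intro finite_downset) (auto intro: less_le_trans)
  then show ?thesis by auto
qed

lemma young_part: "young xs = {(i, j). j < part xs i}"
  by (auto simp: young_def part_def split: if_splits)

lemma hook_length_bead_hole:
  assumes "sorted_wrt (\<ge>) xs" "(i, j) \<in> young xs"
  shows "int (hook_length xs (i, j)) = bead xs i - hole xs j"
proof -
  have ij: "j < part xs i" "i < col xs j"
    using assms(2) less_part_iff[OF assms(1), of j i] by (simp_all add: young_part)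
  have "{d \<in> young xs. fst d = i \<and> j \<le> snd d \<or> snd d = j \<and> i \<le> fst d}
     = Pair i ` {j..<part xs i} \<union> (\<lambda>i'. (i', j)) ` {i<..<col xs j}"
    using ij by (auto simp: young_part image_iff less_part_iff[OF assms(1), of j])
  moreover have "Pair i ` {j..<part xs i} \<inter> (\<lambda>i'. (i', j)) ` {i<..<col xs j} = {}" by auto
  ultimately have "hook_length xs (i, j) = (part xs i - j) + (col xs j - Suc i)"
    unfolding hook_length_def by (simp add: card_Un_disjoint card_image inj_on_def)
  then show ?thesis using ij by (simp add: bead_def hole_def of_nat_diff)
qed

lemma hole_strict:
  assumes "sorted_wrt (\<ge>) xs" "j < k"
  shows "hole xs j < hole xs k"
proof -
  have "\<not> col xs j < col xs k"
    using less_part_iff[OF assms(1), of j "col xs j"] less_part_iff[OF assms(1), of k "col xs j"] assms(2) by auto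
  then show ?thesis using assms(2) by (simp add: hole_def)
qed

lemma hole_less_bead_iff:
  assumes "sorted_wrt (\<ge>) xs"
  shows "hole xs j < bead xs i \<longleftrightarrow> (i, j) \<in> young xs" "hole xs j \<noteq> bead xs i"
proof -
  have "hole xs j < bead xs i \<and> j < part xs i \<or> bead xs i < hole xs j \<and> \<not> j < part xs i"
    using less_part_iff[OF assms, of j i] by (auto simp: bead_def hole_def)
  then show "hole xs j < bead xs i \<longleftrightarrow> (i, j) \<in> young xs" "hole xs j \<noteq> bead xs i"
    by (auto simp: young_part)
qed

lemma hole_surj:
  assumes "sorted_wrt (\<ge>) xs" "z \<notin> beads xs"
  obtains j where "z = hole xs j"
proof -
  let ?A = "{i. z < bead xs i}"
  have "finite ?A"
  proof (rule finite_subset)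
    show "?A \<subseteq> {..<length xs + nat (- z)}"
    proof
      fix i assume "i \<in> ?A"
      then show "i \<in> {..<length xs + nat (- z)}"
        by (cases "i < length xs") (auto simp: bead_def part_def)
    qed
  qed simp
  moreover have "j \<in> ?A" if "i \<in> ?A" "j \<le> i" for i j
    using that bead_strict[OF assms(1), of j i] by (cases "i = j") auto
  ultimately have "?A = {..<card ?A}" by (rule finite_downset)
  then obtain r where "?A = {..<r}" by blast
  then have r: "z < bead xs i \<longleftrightarrow> i < r" for i by auto
  have "bead xs r < z" using r[of r] assms(2) by (force simp: beads_def)
  then have pr: "int (part xs r) \<le> z + int r" by (simp add: bead_def)
  \<comment> \<open>\<open>r\<close> is the number of beads above \<open>z\<close>, hence has to be
    the column height; solving j - r = z gives j.\<close>
  define j where "j = nat (z + int r)"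
  have j: "int j = z + int r" using pr by (simp add: j_def)
  have "j < part xs i \<longleftrightarrow> i < r" for i
  proof (cases "i < r")
    case True
    then have "z < bead xs (r - 1)" using r[of "r - 1"] by simp
    then have "int j < int (part xs (r - 1))" using True unfolding bead_def j by (simp add: of_nat_diff)
    moreover have "part xs (r - 1) \<le> part xs i" using True by (intro part_antimono[OF assms(1)]) simp
    ultimately show ?thesis using True by simp
  next
    case False
    then have "part xs i \<le> part xs r" by (intro part_antimono[OF assms(1)]) simp
    then have "part xs i \<le> j" using pr j by linarith
    then show ?thesis using False by simp
  qed
  then have "{i. j < part xs i} = {..<r}" by auto
  then have "hole xs j = z" using j by (simp add: hole_def col_def)
  then show ?thesis using that by blast
qed

lemma sum_hook_length:
  assumes xs: "xs \<in> partitions_of n"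
  shows "(\<Sum>c\<in>young xs. g (hook_length xs c)) = (\<Sum>m=1..n. g m * of_nat (card (hooks m (beads xs))) :: rat)"
proof -
  have s: "sorted_wrt (\<ge>) xs" using xs by (simp add: partitions_of_def)
  have S: "beads xs \<in> mayas 0 (int n)" using bij_betwE[OF bij_beads] xs by blast
  have my: "maya (beads xs)" using S by (simp add: mayas_def)
  let ?P = "{(a, z). a \<in> beads xs \<and> z \<notin> beads xs \<and> z < a}"
  have "(\<Sum>c\<in>young xs. g (hook_length xs c)) =
     (\<Sum>c\<in>young xs. case (bead xs (fst c), hole xs (snd c)) of (a, z) \<Rightarrow> g (nat (a - z)))"
  proof (intro sum.cong refl)
    fix c assume c: "c \<in> young xs"
    then show "g (hook_length xs c) = (case (bead xs (fst c), hole xs (snd c)) of (a, z) \<Rightarrow> g (nat (a - z)))"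
      using hook_length_bead_hole[OF s, of "fst c" "snd c"] by (simp flip: of_nat_eq_iff) (metis nat_int)
  qed
  also have "\<dots> = (\<Sum>(a, z)\<in>?P. g (nat (a - z)))"
  proof (rule sum.reindex_bij_betw)
    show "bij_betw (\<lambda>c. (bead xs (fst c), hole xs (snd c))) (young xs) ?P"
    proof (rule bij_betwI')
      fix c d assume "c \<in> young xs" "d \<in> young xs"
      show "((bead xs (fst c), hole xs (snd c)) = (bead xs (fst d), hole xs (snd d))) = (c = d)"
        using bead_inj[OF s] hole_strict[OF s]
        by (auto simp: inj_def prod_eq_iff) (metis less_irrefl nat_neq_iff)
    next
      fix c assume c: "c \<in> young xs"
      then show "(bead xs (fst c), hole xs (snd c)) \<in> ?P"
        using hole_less_bead_iff[OF s] by (auto simp: beads_def)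
    next
      fix p assume "p \<in> ?P"
      then obtain a z where p: "p = (a, z)" "a \<in> beads xs" "z \<notin> beads xs" "z < a" by auto
      from p(2) obtain i where i: "a = bead xs i" by (auto simp: beads_def)
      obtain j where j: "z = hole xs j" using hole_surj[OF s p(3)] .
      have "(i, j) \<in> young xs" using hole_less_bead_iff(1)[OF s] p(4) i j by blast
      then show "\<exists>c\<in>young xs. p = (bead xs (fst c), hole xs (snd c))"
        using i j p(1) by force
    qed
  qed
  also have "\<dots> = (\<Sum>(m, z)\<in>(SIGMA m:{1..n}. hooks m (beads xs)). g m)"
  proof (rule sum.reindex_bij_witness[of _ "\<lambda>(m, z). (z + int m, z)" "\<lambda>(a, z). (nat (a - z), z)"])
    fix p assume "p \<in> ?P"
    then obtain a z where p: "p = (a, z)" "a \<in> beads xs" "z \<notin> beads xs" "z < a" by auto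
    \<comment> \<open>Moving the bead from a to z gives a bead set of charge 0 and energy n - (a -
      z), which cannot be negative.\<close>
    have "a - z \<le> int n"
    proof -
      let ?S = "insert z (beads xs - {a})"
      have r: "maya (beads xs - {a})" "z \<notin> beads xs - {a}" using pw_remove(1)[OF my p(2)] p(3) by auto
      have "?S \<in> mayas 0 (int n - (a - z))"
        using S pw_insert(1)[OF r] pw_insert(2)[OF r, of "\<lambda>s. s"] pw_insert(2)[OF r, of "\<lambda>s. 1 :: int"]
          pw_remove(2)[OF my p(2), of "\<lambda>s. s"] pw_remove(2)[OF my p(2), of "\<lambda>s. 1 :: int"]
        by (simp add: mayas_def)
      then show ?thesis using mayas_0_nonneg by force
    qed
    then show "(case p of (a, z) \<Rightarrow> (nat (a - z), z)) \<in> (SIGMA m:{1..n}. hooks m (beads xs))"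
      using p by (auto simp: hooks_def)
  qed (auto simp: hooks_def)
  also have "\<dots> = (\<Sum>m=1..n. \<Sum>z\<in>hooks m (beads xs). g m)"
    using finite_hooks(1)[OF my] by (subst sum.Sigma) auto
  finally show ?thesis by (simp add: mult_ac)
qed

lemma T_minus1_hooks:
  assumes "xs \<in> partitions_of n"
  shows "T_minus1 xs = (\<Sum>m=1..n. 1 / of_nat m ^ 2 * of_nat (card (hooks m (beads xs))))"
  unfolding T_minus1_def by (rule sum_hook_length[OF assms])

text \<open>The site z is carried along because the summand depends on it: a removable hook at z
  turns into an addable one at the same z.\<close>

lemma move_bead:
  "bij_betw (\<lambda>(S, z). (insert z (S - {z + int m}), z))
     (SIGMA S:mayas c E. hooks m S) (SIGMA S:mayas c (E - int m). addables m S)" if "0 < m"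
proof (rule bij_betw_byWitness[where f' = "\<lambda>(S, z). (insert (z + int m) (S - {z}), z)"])
  show "(\<lambda>(S, z). (insert z (S - {z + int m}), z)) ` (SIGMA S:mayas c E. hooks m S) \<subseteq> (SIGMA S:mayas c (E - int m). addables m S)"
  proof clarify
    fix S z assume S: "S \<in> mayas c E" and z: "z \<in> hooks m S"
    then have my: "maya S" and z': "z + int m \<in> S" "z \<notin> S" by (auto simp: mayas_def hooks_def)
    have r: "maya (S - {z + int m})" "z \<notin> S - {z + int m}" using pw_remove(1)[OF my z'(1)] z'(2) by auto
    show "insert z (S - {z + int m}) \<in> mayas c (E - int m) \<and> z \<in> addables m (insert z (S - {z + int m}))"
      using S that pw_insert(1)[OF r] pw_insert(2)[OF r, of "\<lambda>s. s"] pw_insert(2)[OF r, of "\<lambda>s. 1 :: int"]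
          pw_remove(2)[OF my z'(1), of "\<lambda>s. s"] pw_remove(2)[OF my z'(1), of "\<lambda>s. 1 :: int"]
      by (simp add: mayas_def addables_def)
  qed
  show "(\<lambda>(S, z). (insert (z + int m) (S - {z}), z)) ` (SIGMA S:mayas c (E - int m). addables m S) \<subseteq> (SIGMA S:mayas c E. hooks m S)"
  proof clarify
    fix S z assume S: "S \<in> mayas c (E - int m)" and z: "z \<in> addables m S"
    then have my: "maya S" and z': "z \<in> S" "z + int m \<notin> S" by (auto simp: mayas_def addables_def)
    have r: "maya (S - {z})" "z + int m \<notin> S - {z}" using pw_remove(1)[OF my z'(1)] z'(2) by auto
    show "insert (z + int m) (S - {z}) \<in> mayas c E \<and> z \<in> hooks m (insert (z + int m) (S - {z}))"
      using S that pw_insert(1)[OF r] pw_insert(2)[OF r, of "\<lambda>s. s"] pw_insert(2)[OF r, of "\<lambda>s. 1 :: int"]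
          pw_remove(2)[OF my z'(1), of "\<lambda>s. s"] pw_remove(2)[OF my z'(1), of "\<lambda>s. 1 :: int"]
      by (simp add: mayas_def hooks_def)
  qed
qed (use that in \<open>auto simp: hooks_def addables_def\<close>)

lemma pw_move:
  assumes "maya S" "z \<in> hooks m S"
  shows "pw \<phi> S = pw \<phi> (insert z (S - {z + int m})) + \<phi> (z + int m) - \<phi> z"
proof -
  have z: "z + int m \<in> S" "z \<notin> S" using assms(2) by (auto simp: hooks_def)
  have r: "maya (S - {z + int m})" "z \<notin> S - {z + int m}" using pw_remove(1)[OF assms(1) z(1)] z(2) by auto
  show ?thesis
    using pw_insert(2)[OF r, of \<phi>] pw_remove(2)[OF assms(1) z(1), of \<phi>] by simp
qed

section \<open>Moving a bead along a hook\<close>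

abbreviation bpos :: "int \<Rightarrow> rat" where
  "bpos s \<equiv> of_int s + 1/2"

text \<open>
  \<open>qcoord S n\<close> is \<open>Q\<^bsub>n+1\<^esub>\<close>, in accordance with the indexing of the variables.
\<close>

definition qcoord :: "int set \<Rightarrow> nat \<Rightarrow> rat" where
  "qcoord S n = pw (\<lambda>s. bpos s ^ n) S / fact n + beta (Suc n)"

definition qval :: "int set \<Rightarrow> nat \<Rightarrow> rat" where
  "qval S k = (case k of 0 \<Rightarrow> 1 | Suc n \<Rightarrow> qcoord S n)"

definition ev_maya :: "shsym \<Rightarrow> int set \<Rightarrow> rat" where
  "ev_maya f S = hev (\<lambda>c. c) (qcoord S) f"

lemma Q_0: "Q 0 = 1"
  by (simp add: Q_def)

lemma ev_maya_add: "ev_maya (f + g) S = ev_maya f S + ev_maya g S"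
  and ev_maya_mult: "ev_maya (f * g) S = ev_maya f S * ev_maya g S"
  and ev_maya_cst: "ev_maya (cst c) S = c"
  and ev_maya_0: "ev_maya 0 S = 0"
  and ev_maya_1: "ev_maya 1 S = 1"
  by (simp_all add: ev_maya_def hev_add hev_mult hev_cst hev_one rat_hom_id)

lemma ev_maya_Q: "ev_maya (Q k) S = qval S k"
proof (cases k)
  case 0
  then show ?thesis by (simp add: Q_0 ev_maya_1 qval_def)
next
  case (Suc n)
  then show ?thesis by (simp add: ev_maya_def hev_Q_Suc rat_hom_id qval_def)
qed

lemma sheval_beads:
  assumes "sorted_wrt (\<ge>) xs"
  shows "sheval f xs = ev_maya f (beads xs)" "Qfun k xs = qval (beads xs) k"
proof -
  have e: "(\<lambda>n. Qfun (n + 1) xs) = qcoord (beads xs)"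
    using Qfun_beads[OF assms] by (intro ext) (simp add: qcoord_def)
  then show "sheval f xs = ev_maya f (beads xs)"
    by (simp add: sheval_hev ev_maya_def)
  show "Qfun k xs = qval (beads xs) k"
    using fun_cong[OF e, of "k - 1"] by (cases k) (simp_all add: qval_def Qfun_def)
qed

lemma beta_0: "beta 0 = 1"
proof -
  have "fps_nth (Abs_fps beta * (fps_const (1/2) * (fps_exp (1/2) - fps_exp (- 1/2)))) 1 = 1/2"
    unfolding fps_beta by simp
  then show ?thesis by (simp add: fps_mult_nth)
qed

lemma beta_times: "Abs_fps beta * (fps_exp (1/2) - fps_exp (- 1/2)) = fps_X"
proof -
  let ?D = "fps_exp (1/2) - fps_exp (- 1/2) :: rat fps"
  have "fps_const 2 * (Abs_fps beta * (fps_const (1/2) * ?D)) = fps_const 2 * (fps_const (1/2) * fps_X)"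
    unfolding fps_beta ..
  then have "(fps_const 2 * fps_const (1/2)) * (Abs_fps beta * ?D) = (fps_const 2 * fps_const (1/2)) * fps_X"
    by (simp only: mult_ac)
  then show ?thesis by simp
qed

text \<open>The analogue of \<open>faulhaber\<close> at half-integers: multiplication by exp(z/2) -
  exp(-z/2) makes the sum of exponentials telescope.\<close>

lemma beta_sum:
  "(\<Sum>a<m. (of_nat a + 1/2) ^ n) = (\<Sum>k\<le>n. beta k * (fact n / fact (n + 1 - k)) * of_nat m ^ (n + 1 - k))"
proof -
  let ?B = "Abs_fps beta" and ?D = "fps_exp (1/2) - fps_exp (- 1/2) :: rat fps"
  note D = beta_times
  have "?D * (\<Sum>a<m. fps_exp (of_nat a + 1/2)) = fps_exp (of_nat m) - 1"
  proof (induction m)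
    case (Suc m)
    have "?D * fps_exp (of_nat m + 1/2) = fps_exp (of_nat (Suc m)) - fps_exp (of_nat m)"
      by (simp add: left_diff_distrib fps_exp_add_mult[symmetric] algebra_simps)
    with Suc show ?case by (simp add: distrib_left)
  qed simp
  then have e: "fps_X * (\<Sum>a<m. fps_exp (of_nat a + 1/2)) = ?B * (fps_exp (of_nat m) - 1)"
    unfolding D[symmetric] by (simp only: mult.assoc)
  have "(\<Sum>a<m. (of_nat a + 1/2) ^ n / fact n) = fps_nth (fps_X * (\<Sum>a<m. fps_exp (of_nat a + 1/2))) (Suc n)"
    by (simp add: fps_sum_nth)
  also have "\<dots> = (\<Sum>i=0..Suc n. beta i * fps_nth (fps_exp (of_nat m) - 1) (Suc n - i))"
    unfolding e fps_mult_nth by simp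
  also have "\<dots> = (\<Sum>i\<le>n. beta i * fps_nth (fps_exp (of_nat m) - 1) (Suc n - i))"
    by (simp add: atLeast0AtMost)
  also have "\<dots> = (\<Sum>i\<le>n. beta i * (of_nat m ^ (n + 1 - i) / fact (n + 1 - i)))"
    by (intro sum.cong) auto
  finally have "(\<Sum>a<m. (of_nat a + 1/2) ^ n / fact n) = (\<Sum>i\<le>n. beta i * (of_nat m ^ (n + 1 - i) / fact (n + 1 - i)))" .
  from arg_cong[OF this, of "\<lambda>x. fact n * x"] show ?thesis
    by (simp add: sum_distrib_left mult_ac)
qed

text \<open>The constants beta_k in Q_k pay off here: the vacuum sum expands with exactly the
  coefficients that complete the regularised bead sums to Q_k. The term k = 0 comes from the vacuum
  alone, as Q_0 = beta_0 = 1.\<close>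

lemma addables_minus_hooks_power:
  assumes S: "maya S"
  shows "(\<Sum>z\<in>addables m S. (bpos z + of_nat m) ^ n) - (\<Sum>z\<in>hooks m S. (bpos z + of_nat m) ^ n) =
    (\<Sum>k\<le>n. qval S k * (fact n / fact (n + 1 - k)) * of_nat m ^ (n + 1 - k))"
proof -
  let ?M = "of_nat m :: rat"
  have "pw (\<lambda>s. (bpos s + ?M) ^ n) S - pw (\<lambda>s. (bpos (s - int m) + ?M) ^ n) S
      = pw (\<lambda>s. \<Sum>j<n. of_nat (n choose j) * ?M ^ (n - j) * bpos s ^ j) S"
  proof -
    have "(x + ?M) ^ n - x ^ n = (\<Sum>j<n. of_nat (n choose j) * ?M ^ (n - j) * x ^ j)" for x
    proof -
      have "{..n} = insert n {..<n}" by auto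
      then show ?thesis unfolding binomial_ring by (simp add: mult_ac)
    qed
    note this[of "bpos _"]
    then show ?thesis unfolding pw_def diffsum_linear(2)[symmetric] by simp
  qed
  also have "\<dots> = (\<Sum>j<n. of_nat (n choose j) * ?M ^ (n - j) * pw (\<lambda>s. bpos s ^ j) S)"
    unfolding pw_def diffsum_sum diffsum_linear(3) ..
  also have "\<dots> = (\<Sum>k\<in>{1..n}. (qval S k - beta k) * (fact n / fact (n + 1 - k)) * ?M ^ (n + 1 - k))"
    by (rule sum.reindex_bij_witness[of _ "\<lambda>k. k - 1" Suc])
       (auto simp: qval_def qcoord_def binomial_fact)
  also have "\<dots> = (\<Sum>k\<le>n. (qval S k - beta k) * (fact n / fact (n + 1 - k)) * ?M ^ (n + 1 - k))"
    by (intro sum.mono_neutral_left) (auto simp: qval_def beta_0 not_le)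
  finally have 1: "pw (\<lambda>s. (bpos s + ?M) ^ n) S - pw (\<lambda>s. (bpos (s - int m) + ?M) ^ n) S
      = (\<Sum>k\<le>n. (qval S k - beta k) * (fact n / fact (n + 1 - k)) * ?M ^ (n + 1 - k))" .
  have 2: "(\<Sum>s\<in>{- int m..<0}. (bpos s + ?M) ^ n) = (\<Sum>a<m. (of_nat a + 1/2) ^ n)"
    by (rule sum.reindex_bij_witness[of _ "\<lambda>a. int a - int m" "\<lambda>s. nat (s + int m)"])
       (auto simp: algebra_simps)
  show ?thesis
    unfolding addables_minus_hooks[OF S, where \<phi> = "\<lambda>z. (bpos z + of_nat m) ^ n"] 1 2 beta_sum
    by (simp only: sum.distrib[symmetric] left_diff_distrib diff_add_cancel)
qed

text \<open>Since n! / (n + 1 - k)! = k! binom(n + 1, k) / (n + 1), the coefficients of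
  \<open>addables_minus_hooks_power\<close> are those of an integral over [v, v + 1]; this is how
  the integral in the definition of rho arises.\<close>

lemma addables_minus_hooks_poly:
  assumes S: "maya S" and m: "0 < m" and K: "Polynomial.degree P \<le> K"
  shows "(\<Sum>z\<in>addables m S. poly P (bpos z / of_nat m + 1)) - (\<Sum>z\<in>hooks m S. poly P (bpos z / of_nat m + 1)) =
    (\<Sum>k\<le>K. qval S k * (fact k * coeff (unit_integral P) k) * (of_nat m / of_nat m ^ k))"
proof -
  let ?M = "of_nat m :: rat" and ?d = "Polynomial.degree P"
  have M: "?M \<noteq> 0" using m by simp
  have p: "poly P (bpos z / ?M + 1) = (\<Sum>n\<le>?d. coeff P n / ?M ^ n * (bpos z + ?M) ^ n)" for z
  proof -
    have "bpos z / ?M + 1 = (bpos z + ?M) / ?M" using M by (simp add: add_divide_distrib)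
    then show ?thesis unfolding poly_altdef by (simp only: power_divide) simp
  qed
  have "(\<Sum>z\<in>addables m S. poly P (bpos z / ?M + 1)) - (\<Sum>z\<in>hooks m S. poly P (bpos z / ?M + 1))
     = (\<Sum>n\<le>?d. coeff P n / ?M ^ n * ((\<Sum>z\<in>addables m S. (bpos z + ?M) ^ n) - (\<Sum>z\<in>hooks m S. (bpos z + ?M) ^ n)))"
    unfolding p right_diff_distrib sum_subtractf sum_distrib_left
    by (subst sum.swap, subst (2) sum.swap) (rule refl)
  also have "\<dots> = (\<Sum>n\<le>?d. \<Sum>k\<le>n. coeff P n / ?M ^ n * (qval S k * (fact n / fact (n + 1 - k)) * ?M ^ (n + 1 - k)))"
    unfolding addables_minus_hooks_power[OF S] sum_distrib_left ..
  also have "\<dots> = (\<Sum>n\<le>?d. \<Sum>k\<le>K. qval S k * (fact k * (coeff P n * (if k \<le> n then of_nat (Suc n choose k) / of_nat (Suc n) else 0))) * (?M / ?M ^ k))"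
  proof (rule sum.cong[OF refl])
    fix n assume n: "n \<in> {..?d}"
    have "(\<Sum>k\<le>n. coeff P n / ?M ^ n * (qval S k * (fact n / fact (n + 1 - k)) * ?M ^ (n + 1 - k)))
       = (\<Sum>k\<le>n. qval S k * (fact k * (coeff P n * (if k \<le> n then of_nat (Suc n choose k) / of_nat (Suc n) else 0))) * (?M / ?M ^ k))"
    proof (intro sum.cong refl)
      fix k assume k: "k \<in> {..n}"
      have "?M ^ (n + 1 - k) * ?M ^ k = ?M * ?M ^ n"
        using k by (simp flip: power_add)
      then have 1: "?M ^ (n + 1 - k) / ?M ^ n = ?M / ?M ^ k"
        using M by (simp add: field_simps)
      have 2: "fact k * (of_nat (Suc n choose k) / of_nat (Suc n)) = (fact n / fact (n + 1 - k) :: rat)"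
      proof -
        have "of_nat (Suc n choose k) = (of_nat (Suc n) * fact n / (fact k * fact (n + 1 - k)) :: rat)"
          using k binomial_fact[of k "Suc n"] unfolding fact_Suc[of n] by simp
        then show ?thesis by (simp del: of_nat_Suc binomial_Suc_Suc)
      qed
      have "coeff P n / ?M ^ n * (qval S k * (fact n / fact (n + 1 - k)) * ?M ^ (n + 1 - k))
         = qval S k * (coeff P n * (fact n / fact (n + 1 - k))) * (?M ^ (n + 1 - k) / ?M ^ n)" by (simp add: mult_ac)
      also have "\<dots> = qval S k * (coeff P n * (fact k * (of_nat (Suc n choose k) / of_nat (Suc n)))) * (?M / ?M ^ k)"
        unfolding 1 2 ..
      finally show "coeff P n / ?M ^ n * (qval S k * (fact n / fact (n + 1 - k)) * ?M ^ (n + 1 - k))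
        = qval S k * (fact k * (coeff P n * (if k \<le> n then of_nat (Suc n choose k) / of_nat (Suc n) else 0))) * (?M / ?M ^ k)"
        using k by (simp only: atMost_iff if_True mult_ac)
    qed
    also have "\<dots> = (\<Sum>k\<le>K. qval S k * (fact k * (coeff P n * (if k \<le> n then of_nat (Suc n choose k) / of_nat (Suc n) else 0))) * (?M / ?M ^ k))"
      using n K by (intro sum.mono_neutral_left) auto
    finally show "(\<Sum>k\<le>n. coeff P n / ?M ^ n * (qval S k * (fact n / fact (n + 1 - k)) * ?M ^ (n + 1 - k)))
      = (\<Sum>k\<le>K. qval S k * (fact k * (coeff P n * (if k \<le> n then of_nat (Suc n choose k) / of_nat (Suc n) else 0))) * (?M / ?M ^ k))" .
  qed
  also have "\<dots> = (\<Sum>k\<le>K. qval S k * (fact k * coeff (unit_integral P) k) * (?M / ?M ^ k))"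
    unfolding coeff_unit_integral sum_distrib_left sum_distrib_right by (rule sum.swap)
  finally show ?thesis .
qed

text \<open>
  The value of \<open>f\<close> after \<open>p\<^sub>l\<close> has been raised by \<open>r\<close> times the amount which one bead moved from \<open>z + m\<close> to
  \<open>z\<close> takes away from it. The \<open>r\<close>-fold shift makes iteration of the move possible.
\<close>

definition shifted_ev :: "shsym \<Rightarrow> nat \<Rightarrow> nat \<Rightarrow> int \<Rightarrow> int set \<Rightarrow> rat" where
  "shifted_ev f m r z S =
     hev (\<lambda>c. c) (\<lambda>l. qcoord S l + of_nat r * ((bpos z + of_nat m) ^ l - bpos z ^ l) / fact l) f"

lemma shifted_ev_0: "shifted_ev f m 0 z S = ev_maya f S"
  by (simp add: shifted_ev_def ev_maya_def)

lemma shifted_ev_move: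
  assumes "maya S" "z \<in> hooks m S"
  shows "shifted_ev f m r z S = shifted_ev f m (Suc r) z (insert z (S - {z + int m}))"
proof -
  have "qcoord S l = qcoord (insert z (S - {z + int m})) l + ((bpos z + of_nat m) ^ l - bpos z ^ l) / fact l" for l
    unfolding qcoord_def pw_move[OF assms, of "\<lambda>s. bpos s ^ l"]
    by (simp add: add_divide_distrib diff_divide_distrib add_ac)
  note e = this
  have "(\<lambda>l. qcoord S l + of_nat r * ((bpos z + of_nat m) ^ l - bpos z ^ l) / fact l) =
    (\<lambda>l. qcoord (insert z (S - {z + int m})) l + of_nat (Suc r) * ((bpos z + of_nat m) ^ l - bpos z ^ l) / fact l)"
    by (intro ext, unfold e of_nat_Suc distrib_right add_divide_distrib) simp
  then show ?thesis by (simp only: shifted_ev_def)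
qed

lemma mon_weight_degree: "mon_weight m = (\<Sum>l\<in>Poly_Mapping.keys m. l * Poly_Mapping.lookup m l) + mon_degree m"
  by (simp add: mon_weight_def mon_degree_def sum.distrib)

text \<open>In the variable t = b/m + 1 the shift of p_l is r m^l (t^l - (t - 1)^l). Collecting
  factors gives r to the degree and m to the sum of all l, that is, weight minus degree.\<close>

lemma shifted_ev_taylor:
  assumes f: "\<forall>a\<in>Poly_Mapping.keys f. mon_weight a \<le> w" and m: "0 < m"
  shows "shifted_ev f m r z S = (\<Sum>a | mon_weight a \<le> w.
    of_nat r ^ mon_degree a * of_nat m ^ (mon_weight a - mon_degree a) * ev_maya (mon_diff a f) S
      * poly (mpoly a) (bpos z / of_nat m + 1))"
proof -
  let ?M = "of_nat m :: rat"
  have M: "?M \<noteq> 0" using m by simp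
  have c: "(bpos z + ?M) ^ l - bpos z ^ l = ?M ^ l * poly (cpoly l) (bpos z / ?M + 1)" for l
  proof -
    have "?M * (bpos z / ?M + 1) = bpos z + ?M" "?M * (bpos z / ?M + 1 - 1) = bpos z"
      using M by (simp_all only: distrib_left right_diff_distrib) simp_all
    then show ?thesis
      unfolding poly_cpoly right_diff_distrib[of "?M ^ l"] power_mult_distrib[symmetric] by simp
  qed
  have p: "(\<Prod>l\<in>Poly_Mapping.keys a. (of_nat r * ((bpos z + ?M) ^ l - bpos z ^ l)) ^ Poly_Mapping.lookup a l / fact (Poly_Mapping.lookup a l))
     = of_nat r ^ mon_degree a * ?M ^ (mon_weight a - mon_degree a) * poly (mpoly a) (bpos z / ?M + 1)" for a
  proof -
    have "mon_weight a - mon_degree a = (\<Sum>l\<in>Poly_Mapping.keys a. l * Poly_Mapping.lookup a l)"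
      by (simp add: mon_weight_degree)
    then have "?M ^ (mon_weight a - mon_degree a) = (\<Prod>l\<in>Poly_Mapping.keys a. (?M ^ l) ^ Poly_Mapping.lookup a l)"
      by (simp add: power_sum power_mult)
    moreover have "(of_nat r :: rat) ^ mon_degree a = (\<Prod>l\<in>Poly_Mapping.keys a. of_nat r ^ Poly_Mapping.lookup a l)"
      by (simp add: mon_degree_def power_sum)
    ultimately show ?thesis
      unfolding c poly_mpoly ifact_def
      by (simp add: power_mult_distrib prod.distrib prod_dividef mult_ac)
  qed
  show ?thesis
    unfolding shifted_ev_def
    using taylor[OF f, of "qcoord S" "\<lambda>l. of_nat r * ((bpos z + ?M) ^ l - bpos z ^ l)"]
    by (simp add: p ev_maya_def[symmetric] mult_ac)
qed

lemma finite_mayas: "finite (mayas 0 E)"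
proof (cases "0 \<le> E")
  case True
  then have "bij_betw beads (partitions_of (nat E)) (mayas 0 E)" using bij_beads[of "nat E"] by simp
  then show ?thesis using finite_partitions_of bij_betw_finite by blast
next
  case False
  then have "mayas 0 E = {}" using mayas_0_nonneg by blast
  then show ?thesis by simp
qed

definition drift :: "shsym \<Rightarrow> nat \<Rightarrow> nat \<Rightarrow> int set \<Rightarrow> rat" where
  "drift f m r S = (\<Sum>z\<in>addables m S. shifted_ev f m r z S) - (\<Sum>z\<in>hooks m S. shifted_ev f m r z S)"

lemma drift_formula:
  assumes f: "\<forall>a\<in>Poly_Mapping.keys f. mon_weight a \<le> w" and m: "0 < m" and S: "maya S"
  shows "drift f m r S = (\<Sum>(a, k)\<in>{a. mon_weight a \<le> w} \<times> {..w}.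
    of_nat r ^ mon_degree a * (of_nat m ^ (mon_weight a - mon_degree a) * (of_nat m / of_nat m ^ k))
      * rho_series k a * ev_maya (Q k * mon_diff a f) S)"
proof -
  let ?M = "of_nat m :: rat"
  let ?c = "\<lambda>a. of_nat r ^ mon_degree a * ?M ^ (mon_weight a - mon_degree a) * ev_maya (mon_diff a f) S"
  let ?p = "\<lambda>a z. poly (mpoly a) (bpos z / ?M + 1)"
  have "drift f m r S = (\<Sum>a | mon_weight a \<le> w. ?c a * ((\<Sum>z\<in>addables m S. ?p a z) - (\<Sum>z\<in>hooks m S. ?p a z)))"
    unfolding drift_def shifted_ev_taylor[OF f m] right_diff_distrib sum_subtractf sum_distrib_left
    by (subst sum.swap, subst (2) sum.swap) (rule refl)
  also have "\<dots> = (\<Sum>a | mon_weight a \<le> w. ?c a * (\<Sum>k\<le>w. qval S k * rho_series k a * (?M / ?M ^ k)))"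
  proof (intro sum.cong refl)
    fix a assume a: "a \<in> {a. mon_weight a \<le> w}"
    have "Polynomial.degree (mpoly a) \<le> w"
    proof (cases "0 \<in> Poly_Mapping.keys a")
      case True
      then show ?thesis using mpoly_eq_0 by simp
    next
      case False
      then show ?thesis using degree_mpoly[OF False] a by simp
    qed
    from addables_minus_hooks_poly[OF S m this]
    show "?c a * ((\<Sum>z\<in>addables m S. ?p a z) - (\<Sum>z\<in>hooks m S. ?p a z))
      = ?c a * (\<Sum>k\<le>w. qval S k * rho_series k a * (?M / ?M ^ k))"
      by (simp add: rho_series_mpoly)
  qed
  finally show ?thesis
    unfolding sum_distrib_left sum.cartesian_product
    by (simp add: ev_maya_mult ev_maya_Q split_def mult_ac)
qed

definition hook_sum :: "shsym \<Rightarrow> nat \<Rightarrow> nat \<Rightarrow> int \<Rightarrow> rat" where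
  "hook_sum f m r E = (\<Sum>S\<in>mayas 0 E. \<Sum>z\<in>hooks m S. shifted_ev f m r z S)"

text \<open>Trading the addable hooks obtained by the move for removable ones costs the drift, which
  \<open>drift_formula\<close> makes explicit; the remaining hook sum has the original shape at
  lower energy.\<close>

lemma hook_sum_step:
  assumes m: "0 < m"
  shows "hook_sum f m r E = hook_sum f m (Suc r) (E - int m) + (\<Sum>S\<in>mayas 0 (E - int m). drift f m (Suc r) S)"
proof -
  have "hook_sum f m r E = (\<Sum>(S, z)\<in>(SIGMA S:mayas 0 E. hooks m S). shifted_ev f m r z S)"
    unfolding hook_sum_def using finite_mayas finite_hooks
    by (subst sum.Sigma) (auto simp: mayas_def)
  also have "\<dots> = (\<Sum>(S, z)\<in>(SIGMA S:mayas 0 E. hooks m S).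
      case (insert z (S - {z + int m}), z) of (S', z') \<Rightarrow> shifted_ev f m (Suc r) z' S')"
    by (intro sum.cong refl) (auto simp: mayas_def shifted_ev_move simp del: hooks_def)
  also have "\<dots> = (\<Sum>(S, z)\<in>(SIGMA S:mayas 0 (E - int m). addables m S). shifted_ev f m (Suc r) z S)"
    using sum.reindex_bij_betw[OF move_bead[OF m], of "\<lambda>(S, z). shifted_ev f m (Suc r) z S" 0 E]
    by (simp add: split_def)
  also have "\<dots> = (\<Sum>S\<in>mayas 0 (E - int m). \<Sum>z\<in>addables m S. shifted_ev f m (Suc r) z S)"
    using finite_mayas finite_hooks by (subst sum.Sigma) (auto simp: mayas_def)
  finally show ?thesis
    unfolding hook_sum_def drift_def sum_subtractf by simp
qed

lemma hook_sum_iterate: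
  assumes "0 < m"
  shows "hook_sum f m r E = hook_sum f m (r + K) (E - int (K * m))
    + (\<Sum>t=1..K. \<Sum>S\<in>mayas 0 (E - int (t * m)). drift f m (r + t) S)"
proof (induction K)
  case (Suc K)
  have "hook_sum f m (r + K) (E - int (K * m)) = hook_sum f m (r + Suc K) (E - int (Suc K * m))
    + (\<Sum>S\<in>mayas 0 (E - int (Suc K * m)). drift f m (r + Suc K) S)"
  proof -
    have "E - int (K * m) - int m = E - int (Suc K * m)" by simp
    from hook_sum_step[OF assms, of f "r + K" "E - int (K * m)", unfolded this] show ?thesis by simp
  qed
  with Suc show ?case by (simp add: distrib_right)
qed simp

lemma hook_sum_formula:
  assumes m: "0 < m"
  shows "(\<Sum>S\<in>mayas 0 (int n). of_nat (card (hooks m S)) * ev_maya f S) =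
    (\<Sum>t | 0 < t \<and> t * m \<le> n. \<Sum>S\<in>mayas 0 (int (n - t * m)). drift f m t S)"
proof -
  have neg: "mayas 0 E = {}" if "E < 0" for E using mayas_0_nonneg that by force
  have "(\<Sum>S\<in>mayas 0 (int n). of_nat (card (hooks m S)) * ev_maya f S) = hook_sum f m 0 (int n)"
    by (simp add: hook_sum_def shifted_ev_0)
  \<comment> \<open>After n + 1 moves of length m \<ge> 1 the energy is negative and the hook sum is
    empty.\<close>
  also have "\<dots> = (\<Sum>t=1..Suc n. \<Sum>S\<in>mayas 0 (int n - int (t * m)). drift f m t S)"
  proof -
    have "Suc n * 1 \<le> Suc n * m" using m by (intro mult_le_mono2) simp
    then have "n < Suc n * m" by (rule less_le_trans[rotated]) simp
    then have "int n < int (Suc n * m)" by (simp only: of_nat_less_iff)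
    then have "hook_sum f m (0 + Suc n) (int n - int (Suc n * m)) = 0"
      unfolding hook_sum_def by (subst neg) auto
    then show ?thesis using hook_sum_iterate[OF m, of f 0 "int n" "Suc n"] by simp
  qed
  also have "\<dots> = (\<Sum>t | 0 < t \<and> t * m \<le> n. \<Sum>S\<in>mayas 0 (int (n - t * m)). drift f m t S)"
  proof (rule sum.mono_neutral_cong_right)
    show "{t. 0 < t \<and> t * m \<le> n} \<subseteq> {1..Suc n}"
    proof
      fix t assume t: "t \<in> {t. 0 < t \<and> t * m \<le> n}"
      have "t \<le> t * m" using m by simp
      moreover have "t * m \<le> n" using t by simp
      ultimately have "t \<le> n" by (rule le_trans)
      with t show "t \<in> {1..Suc n}" by simp
    qed
    show "\<forall>t\<in>{1..Suc n} - {t. 0 < t \<and> t * m \<le> n}. (\<Sum>S\<in>mayas 0 (int n - int (t * m)). drift f m t S) = 0"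
    proof
      fix t assume "t \<in> {1..Suc n} - {t. 0 < t \<and> t * m \<le> n}"
      then have "n < t * m" by auto
      then have "int n < int (t * m)" by (simp only: of_nat_less_iff)
      then have "int n - int (t * m) < 0" by linarith
      from neg[OF this] show "(\<Sum>S\<in>mayas 0 (int n - int (t * m)). drift f m t S) = 0" by simp
    qed
  qed (auto simp: of_nat_diff)
  finally show ?thesis .
qed

section \<open>Generating functions over partitions\<close>

definition part_gf :: "(nat list \<Rightarrow> rat) \<Rightarrow> rat fps" where
  "part_gf F = Abs_fps (\<lambda>n. \<Sum>xs\<in>partitions_of n. F xs)"

text \<open>The j-fold q d/dq of the series whose coefficients sum m^(i-1) over the divisors m. The
  quotient \<open>of_nat m ^ i / of_nat m\<close> keeps the exponent -1 for i = 0, where i - 1 would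
  be truncated.\<close>

definition divisor_fps :: "nat \<Rightarrow> nat \<Rightarrow> rat fps" where
  "divisor_fps i j = Abs_fps (\<lambda>N. of_nat N ^ j * (\<Sum>(m, t)\<in>pairs N. of_nat m ^ i / of_nat m))"

lemma part_gf_mayas: "fps_nth (part_gf (\<lambda>xs. G (beads xs))) n = (\<Sum>S\<in>mayas 0 (int n). G S)"
  unfolding part_gf_def using sum.reindex_bij_betw[OF bij_beads, of G n] by simp

lemma part_gf_cong:
  "(\<And>xs. sorted_wrt (\<ge>) xs \<Longrightarrow> F xs = G xs) \<Longrightarrow> part_gf F = part_gf G"
  unfolding part_gf_def by (intro arg_cong[of _ _ Abs_fps] ext sum.cong) (auto simp: partitions_of_def)

abbreviation sh_gf :: "shsym \<Rightarrow> rat fps" where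
  "sh_gf f \<equiv> part_gf (sheval f)"

lemma sh_gf_maya: "fps_nth (sh_gf f) n = (\<Sum>S\<in>mayas 0 (int n). ev_maya f S)"
proof -
  have "sh_gf f = part_gf (\<lambda>xs. ev_maya f (beads xs))"
    by (rule part_gf_cong) (simp add: sheval_beads)
  then show ?thesis by (simp add: part_gf_mayas)
qed

lemma part_gf_T_minus1:
  assumes f: "\<forall>a\<in>Poly_Mapping.keys f. mon_weight a \<le> w"
  shows "part_gf (\<lambda>xs. T_minus1 xs * sheval f xs) =
    (\<Sum>(a, k)\<in>{a. mon_weight a \<le> w} \<times> {..w}. fps_const (rho_series k a) *
      (divisor_fps (mon_weight a - 2 * mon_degree a - k) (mon_degree a) * sh_gf (Q k * mon_diff a f)))"
  (is "_ = (\<Sum>(a, k)\<in>?I. fps_const (rho_series k a) * (?D a k * _))")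
proof (rule fps_ext)
  fix n :: nat
  define e :: "monom \<times> nat \<Rightarrow> nat \<Rightarrow> nat \<Rightarrow> rat" where
    "e = (\<lambda>(a, k) m t. of_nat t ^ mon_degree a * (of_nat m ^ (mon_weight a - mon_degree a) * (of_nat m / of_nat m ^ k))
      * rho_series k a / of_nat m ^ 2)"
  define Z where "Z = (\<lambda>(a, k). fps_nth (sh_gf (Q k * mon_diff a f)))"
  have D: "rho_series k a * fps_nth (?D a k) i = (\<Sum>(m, t)\<in>pairs i. e (a, k) m t)" for a k i
  proof (cases "rho_series k a = 0")
    case False
    define j where "j = mon_degree a"
    define l where "l = mon_weight a - 2 * j - k"
    \<comment> \<open>Nothing is truncated, so the exponent of m in \<open>e\<close> is (l + j + k)
      + 1 - k - 2 = l + j - 1, and t^j m^j is the j-th power of the index.\<close>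
    have w: "mon_weight a = l + 2 * j + k" using rho_series_weight[OF False] by (simp add: j_def l_def)
    have "rho_series k a * fps_nth (?D a k) i = (\<Sum>(m, t)\<in>pairs i. rho_series k a * (of_nat i ^ j * (of_nat m ^ l / of_nat m)))"
      by (simp only: divisor_fps_def fps_nth_Abs_fps sum_distrib_left split_def flip: j_def l_def)
    also have "\<dots> = (\<Sum>(m, t)\<in>pairs i. e (a, k) m t)"
    proof (rule sum.cong[OF refl], clarify)
      fix m t assume "(m, t) \<in> pairs i"
      then have m: "0 < m" and i: "i = m * t" by (auto simp: pairs_def)
      have "mon_weight a - j = l + j + k" using w by simp
      then show "rho_series k a * (of_nat i ^ j * (of_nat m ^ l / of_nat m)) = e (a, k) m t"
        using m by (simp add: e_def i power_add power_mult_distrib power2_eq_square flip: j_def)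
    qed
    finally show ?thesis .
  qed (simp add: e_def split_def)
  have drift: "(\<Sum>S\<in>mayas 0 (int i). drift f m t S) / of_nat m ^ 2 = (\<Sum>p\<in>?I. e p m t * Z p i)"
    if m: "0 < m" for m t i
  proof -
    have "(\<Sum>S\<in>mayas 0 (int i). drift f m t S) / of_nat m ^ 2
       = (\<Sum>S\<in>mayas 0 (int i). \<Sum>p\<in>?I. e p m t * ev_maya (Q (snd p) * mon_diff (fst p) f) S)"
      unfolding sum_divide_distrib
      by (intro sum.cong refl, subst drift_formula[OF f m])
        (auto simp: mayas_def sum_divide_distrib e_def split_def)
    also have "\<dots> = (\<Sum>p\<in>?I. e p m t * Z p i)"
      by (subst sum.swap) (simp add: Z_def split_def sh_gf_maya sum_distrib_left)
    finally show ?thesis .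
  qed
  have "fps_nth (part_gf (\<lambda>xs. T_minus1 xs * sheval f xs)) n
     = (\<Sum>xs\<in>partitions_of n. \<Sum>m=1..n. 1 / of_nat m ^ 2 * (of_nat (card (hooks m (beads xs))) * ev_maya f (beads xs)))"
    unfolding part_gf_def fps_nth_Abs_fps
    by (intro sum.cong) (auto simp: partitions_of_def T_minus1_hooks sheval_beads sum_distrib_right mult.assoc)
  also have "\<dots> = (\<Sum>S\<in>mayas 0 (int n). \<Sum>m=1..n. 1 / of_nat m ^ 2 * (of_nat (card (hooks m S)) * ev_maya f S))"
    by (rule sum.reindex_bij_betw[OF bij_beads])
  also have "\<dots> = (\<Sum>m=1..n. (\<Sum>S\<in>mayas 0 (int n). of_nat (card (hooks m S)) * ev_maya f S) / of_nat m ^ 2)"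
    by (subst sum.swap) (simp add: sum_divide_distrib)
  also have "\<dots> = (\<Sum>m=1..n. \<Sum>t | 0 < t \<and> t * m \<le> n. \<Sum>p\<in>?I. e p m t * Z p (n - t * m))"
  proof (rule sum.cong[OF refl])
    fix m assume "m \<in> {1..n}"
    then have m: "0 < m" by simp
    show "(\<Sum>S\<in>mayas 0 (int n). of_nat (card (hooks m S)) * ev_maya f S) / of_nat m ^ 2
      = (\<Sum>t | 0 < t \<and> t * m \<le> n. \<Sum>p\<in>?I. e p m t * Z p (n - t * m))"
      unfolding hook_sum_formula[OF m] drift[OF m, symmetric] by (rule sum_divide_distrib)
  qed
  also have "\<dots> = (\<Sum>i=0..n. \<Sum>(m, t)\<in>pairs i. \<Sum>p\<in>?I. e p m t * Z p (n - i))"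
    unfolding sum_pairs_le by (intro sum.cong refl) (auto simp: pairs_def mult.commute)
  also have "\<dots> = (\<Sum>i=0..n. \<Sum>p\<in>?I. \<Sum>(m, t)\<in>pairs i. e p m t * Z p (n - i))"
    unfolding split_def by (intro sum.cong[OF refl] sum.swap)
  also have "\<dots> = (\<Sum>p\<in>?I. \<Sum>i=0..n. \<Sum>(m, t)\<in>pairs i. e p m t * Z p (n - i))"
    by (rule sum.swap)
  also have "\<dots> = fps_nth (\<Sum>(a, k)\<in>?I. fps_const (rho_series k a) * (?D a k * sh_gf (Q k * mon_diff a f))) n"
    unfolding fps_sum_nth
  proof (rule sum.cong[OF refl], clarify)
    fix a k
    have "(\<Sum>i=0..n. \<Sum>(m, t)\<in>pairs i. e (a, k) m t * Z (a, k) (n - i))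
       = (\<Sum>i=0..n. rho_series k a * fps_nth (?D a k) i * Z (a, k) (n - i))"
      unfolding D sum_distrib_right by (simp only: split_def)
    then show "(\<Sum>i=0..n. \<Sum>(m, t)\<in>pairs i. e (a, k) m t * Z (a, k) (n - i))
       = fps_nth (fps_const (rho_series k a) * (?D a k * sh_gf (Q k * mon_diff a f))) n"
      unfolding fps_mult_left_const_nth
      by (simp only: fps_mult_nth Z_def prod.case sum_distrib_left mult.assoc)
  qed
  finally show "fps_nth (part_gf (\<lambda>xs. T_minus1 xs * sheval f xs)) n =
    fps_nth (\<Sum>(a, k)\<in>?I. fps_const (rho_series k a) * (?D a k * sh_gf (Q k * mon_diff a f))) n" .
qed

section \<open>The formula for the modified \<open>q\<close>-bracket\<close>

definition weight_le :: "nat \<Rightarrow> shsym \<Rightarrow> bool" where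
  "weight_le w f \<longleftrightarrow> (\<forall>a\<in>Poly_Mapping.keys f. mon_weight a \<le> w)"

lemma mon_diff_eq_0':
  assumes "weight_le w f" "w < mon_weight m"
  shows "mon_diff m f = 0"
  using assms by (intro mon_diff_eq_0[of f "int w"]) (auto simp: weight_le_def)

lemma rho_part_eq_0:
  assumes "weight_le w f" "w < i + 2 * j + k"
  shows "rho_part i j k f = 0"
  unfolding rho_part_def using mon_diff_eq_0'[OF assms(1)] assms(2) by (intro sum.neutral) auto

lemma rho_expand:
  assumes "weight_le w f"
  shows "rho i j f = (\<Sum>k\<le>w. Q k * rho_part i j k f)"
proof -
  have "{k. Q k * rho_part i j k f \<noteq> 0} \<subseteq> {..w}"
    using rho_part_eq_0[OF assms, of i j] by (force simp: not_le)
  then show ?thesis unfolding rho_def by (intro Sum_any.expand_superset) auto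
qed

lemma rho_eq_0: "weight_le w f \<Longrightarrow> w < i + 2 * j \<Longrightarrow> rho i j f = 0"
  using rho_part_eq_0[of w f i j] by (simp add: rho_expand)

lemma rho_odd:
  assumes "odd i"
  shows "rho i j f = 0"
proof -
  have "rho_part i j k f = 0" for k
    unfolding rho_part_def
  proof (intro sum.neutral ballI)
    fix m assume m: "m \<in> {m. mon_degree m = j \<and> mon_weight m = i + 2 * j + k}"
    have "rho_series k m = 0"
      using rho_series_parity[of k m] m assms by auto
    then show "cst (rho_series k m) * mon_diff m f = 0" by (simp add: cst_def)
  qed
  then show ?thesis by (simp add: rho_def)
qed

lemma rho_degree_0: "0 < i \<Longrightarrow> rho i 0 f = 0"
proof -
  assume i: "0 < i"
  have "rho_part i 0 k f = 0" for k
    unfolding rho_part_def using i by (intro sum.neutral) (auto simp: mon_degree_eq_0_iff)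
  then show ?thesis by (simp add: rho_def)
qed

lemma exists_weight_le: "\<exists>w. weight_le w f"
proof
  show "weight_le (\<Sum>a\<in>Poly_Mapping.keys f. mon_weight a) f"
    unfolding weight_le_def by (auto intro!: member_le_sum)
qed

lemma rho_0_0: "rho 0 0 f = f"
proof -
  obtain w where w: "weight_le w f" using exists_weight_le by blast
  have "rho_part 0 0 k f = (if k = 0 then f else 0)" for k
  proof -
    have "{m. mon_degree m = 0 \<and> mon_weight m = 0 + 2 * 0 + k} = (if k = 0 then {0} else {})"
      by (auto simp: mon_degree_eq_0_iff)
    then show ?thesis
      unfolding rho_part_def by (simp add: rho_series_0 cst_1 mon_diff_def)
  qed
  then have "rho 0 0 f = (\<Sum>k\<le>w. if k = 0 then f else 0)"
    unfolding rho_expand[OF w] by (intro sum.cong) (auto simp: Q_0)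
  then show ?thesis by simp
qed

lemma mon_degree_1:
  assumes "mon_degree m = 1"
  obtains n where "m = Poly_Mapping.single n 1"
proof -
  have "m \<noteq> 0" using assms by auto
  then obtain n where n: "n \<in> Poly_Mapping.keys m"
    by (metis all_not_in_conv keys_eq_empty)
  have "mon_degree (m - Poly_Mapping.single n 1) = 0"
    using mon_degree_add[of "Poly_Mapping.single n 1" "m - Poly_Mapping.single n 1"] assms
    unfolding monom_decompose[OF n] by simp
  then have "m - Poly_Mapping.single n 1 = 0" by (simp only: mon_degree_eq_0_iff)
  then show ?thesis using monom_decompose[OF n] that[of n] by simp
qed

lemma mon_diff_var: "mon_diff (Poly_Mapping.single n 1) f = dp n f"
  by (simp add: mon_diff_def)

lemma cst_mult: "cst a * cst b = cst (a * b)"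
  by (simp add: cst_def mult_single)

lemma rho_0_1: "rho 0 1 f = del2 f"
proof -
  obtain w where w: "weight_le w f" using exists_weight_le by blast
  have "rho_part 0 1 k f = pd (Suc k) f" for k
  proof -
    have "{m. mon_degree m = 1 \<and> mon_weight m = 0 + 2 * 1 + k} = {Poly_Mapping.single (Suc k) 1}"
    proof
      show "{m. mon_degree m = 1 \<and> mon_weight m = 0 + 2 * 1 + k} \<subseteq> {Poly_Mapping.single (Suc k) 1}"
      proof
        fix m assume m: "m \<in> {m. mon_degree m = 1 \<and> mon_weight m = 0 + 2 * 1 + k}"
        then obtain n where n: "m = Poly_Mapping.single n 1" using mon_degree_1 by blast
        with m have "n = Suc k" by simp
        with n show "m \<in> {Poly_Mapping.single (Suc k) 1}" by simp
      qed
    qed simp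
    then have "rho_part 0 1 k f = cst (rho_series k (Poly_Mapping.single (Suc k) 1)) * mon_diff (Poly_Mapping.single (Suc k) 1) f"
      unfolding rho_part_def by simp
    also have "\<dots> = (cst (fact (Suc k)) * cst (1 / fact (Suc k))) * pd (Suc k) f"
      unfolding rho_series_single mon_diff_var dp_def by (simp only: mult.assoc)
    also have "\<dots> = pd (Suc k) f" by (simp add: cst_mult cst_1 del: fact_Suc)
    finally show ?thesis .
  qed
  then have "rho 0 1 f = (\<Sum>k\<le>w. Q k * pd (Suc k) f)"
    unfolding rho_expand[OF w] by simp
  also have "\<dots> = (\<Sum>n\<in>{..Suc w} - {0}. Q (n - 1) * pd n f)"
    by (rule sum.reindex_bij_witness[of _ "\<lambda>n. n - 1" Suc]) auto
  also have "\<dots> = del2 f"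
  proof (rule del2_superset[symmetric])
    show "(\<Union>m\<in>Poly_Mapping.keys f. Poly_Mapping.keys m) \<subseteq> {..Suc w}"
    proof
      fix n assume "n \<in> (\<Union>m\<in>Poly_Mapping.keys f. Poly_Mapping.keys m)"
      then obtain m where m: "m \<in> Poly_Mapping.keys f" "Poly_Mapping.lookup m n \<noteq> 0" by (auto simp: in_keys_iff)
      have "(n + 1) * 1 \<le> (n + 1) * Poly_Mapping.lookup m n" using m(2) by (intro mult_le_mono2) simp
      also have "\<dots> \<le> w" using lookup_le_mon_weight[of n m] w m(1) by (force simp: weight_le_def)
      finally show "n \<in> {..Suc w}" by simp
    qed
  qed simp
  finally show ?thesis .
qed

lemma sh_gf_add: "sh_gf (f + g) = sh_gf f + sh_gf g"
  by (rule fps_ext) (simp add: part_gf_def sheval_add sum.distrib)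

lemma sh_gf_0: "sh_gf 0 = 0"
  by (rule fps_ext) (simp add: part_gf_def sheval_zero)

lemma sh_gf_sum: "sh_gf (sum F A) = (\<Sum>a\<in>A. sh_gf (F a))"
  by (induction A rule: infinite_finite_induct) (auto simp: sh_gf_0 sh_gf_add)

lemma sh_gf_cst: "sh_gf (cst c * f) = fps_const c * sh_gf f"
  by (rule fps_ext) (simp add: part_gf_def sheval_mult sheval_cst sum_distrib_left)

text \<open>A pair (a, k) with nonzero coefficient determines its i and j. Sums over fixed finite
  boxes with an \<open>if\<close> reduce the regrouping to exchanges of sums.\<close>

lemma part_gf_rho:
  assumes w: "weight_le w f"
  shows "part_gf (\<lambda>xs. T_minus1 xs * sheval f xs) = (\<Sum>i\<le>w. \<Sum>j\<le>w. divisor_fps i j * sh_gf (rho i j f))"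
proof -
  let ?M = "{a. mon_weight a \<le> w}"
  let ?c = "\<lambda>a i j k. mon_degree a = j \<and> mon_weight a = i + 2 * j + k"
  let ?X = "\<lambda>a k i j. fps_const (rho_series k a) * (divisor_fps i j * sh_gf (Q k * mon_diff a f))"
  have 1: "divisor_fps i j * sh_gf (rho i j f) = (\<Sum>k\<le>w. \<Sum>a\<in>?M. if ?c a i j k then ?X a k i j else 0)" for i j
  proof -
    have "sh_gf (Q k * rho_part i j k f) = (\<Sum>a\<in>?M. if ?c a i j k then fps_const (rho_series k a) * sh_gf (Q k * mon_diff a f) else 0)" for k
    proof -
      have fin: "finite {a. ?c a i j k}"
        by (rule finite_subset[OF _ finite_mon_weight_le[of "i + 2 * j + k"]]) auto
      have "sh_gf (Q k * rho_part i j k f) = (\<Sum>a | ?c a i j k. sh_gf (cst (rho_series k a) * (Q k * mon_diff a f)))"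
        unfolding rho_part_def sum_distrib_left sh_gf_sum by (simp only: mult_ac)
      also have "\<dots> = (\<Sum>a | ?c a i j k. fps_const (rho_series k a) * sh_gf (Q k * mon_diff a f))"
        unfolding sh_gf_cst ..
      also have "\<dots> = (\<Sum>a\<in>?M \<inter> {a. ?c a i j k}. fps_const (rho_series k a) * sh_gf (Q k * mon_diff a f))"
      proof (rule sum.mono_neutral_right[OF fin])
        show "\<forall>a\<in>{a. ?c a i j k} - ?M \<inter> {a. ?c a i j k}. fps_const (rho_series k a) * sh_gf (Q k * mon_diff a f) = 0"
        proof
          fix a assume "a \<in> {a. ?c a i j k} - ?M \<inter> {a. ?c a i j k}"
          then have "w < mon_weight a" by auto
          from mon_diff_eq_0'[OF w this] show "fps_const (rho_series k a) * sh_gf (Q k * mon_diff a f) = 0"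
            by (simp add: sh_gf_0)
        qed
      qed auto
      also have "\<dots> = (\<Sum>a\<in>?M. if ?c a i j k then fps_const (rho_series k a) * sh_gf (Q k * mon_diff a f) else 0)"
        by (simp add: sum.inter_restrict[OF finite_mon_weight_le])
      finally show ?thesis .
    qed
    note key = this
    show ?thesis
      unfolding rho_expand[OF w] sh_gf_sum key sum_distrib_left
      by (intro sum.cong refl) (simp add: mult.left_commute)
  qed
  have 2: "(\<Sum>i\<le>w. \<Sum>j\<le>w. if ?c a i j k then ?X a k i j else 0)
     = ?X a k (mon_weight a - 2 * mon_degree a - k) (mon_degree a)" if a: "a \<in> ?M" for a k
  proof (cases "rho_series k a = 0")
    case False
    then have le: "k + 2 * mon_degree a \<le> mon_weight a" by (rule rho_series_weight)
    define i0 where "i0 = mon_weight a - 2 * mon_degree a - k"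
    have i0: "i0 \<le> w" "mon_degree a \<le> w" using a le by (auto simp: i0_def)
    have "(\<Sum>i\<le>w. \<Sum>j\<le>w. if ?c a i j k then ?X a k i j else 0)
       = (\<Sum>i\<le>w. if i = i0 then \<Sum>j\<le>w. if j = mon_degree a then ?X a k i0 (mon_degree a) else 0 else 0)"
    proof (rule sum.cong[OF refl])
      fix i
      have wt: "mon_weight a = i0 + 2 * mon_degree a + k" using le by (simp add: i0_def)
      show "(\<Sum>j\<le>w. if ?c a i j k then ?X a k i j else 0)
        = (if i = i0 then \<Sum>j\<le>w. if j = mon_degree a then ?X a k i0 (mon_degree a) else 0 else 0)"
      proof (cases "i = i0")
        case True
        have "(\<Sum>j\<le>w. if ?c a i0 j k then ?X a k i0 j else 0) = (\<Sum>j\<le>w. if j = mon_degree a then ?X a k i0 (mon_degree a) else 0)"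
          unfolding wt by (intro sum.cong refl) auto
        then show ?thesis unfolding True by (simp only: if_True refl)
      next
        case False
        then show ?thesis unfolding wt by (auto intro!: sum.neutral)
      qed
    qed
    also have "\<dots> = ?X a k i0 (mon_degree a)" using i0 by simp
    finally show ?thesis unfolding i0_def .
  next
    case True
    then have "(if ?c a i j k then ?X a k i j else 0) = 0" for i j by simp
    with True show ?thesis by (simp only: sum.neutral_const fps_const_0_eq_0 mult_zero_left)
  qed
  have "(\<Sum>i\<le>w. \<Sum>j\<le>w. divisor_fps i j * sh_gf (rho i j f))
     = (\<Sum>i\<le>w. \<Sum>j\<le>w. \<Sum>k\<le>w. \<Sum>a\<in>?M. if ?c a i j k then ?X a k i j else 0)"
    unfolding 1 ..
  also have "\<dots> = (\<Sum>i\<le>w. \<Sum>k\<le>w. \<Sum>j\<le>w. \<Sum>a\<in>?M. if ?c a i j k then ?X a k i j else 0)"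
    by (intro sum.cong[OF refl] sum.swap)
  also have "\<dots> = (\<Sum>i\<le>w. \<Sum>k\<le>w. \<Sum>a\<in>?M. \<Sum>j\<le>w. if ?c a i j k then ?X a k i j else 0)"
    by (intro sum.cong[OF refl] sum.swap)
  also have "\<dots> = (\<Sum>k\<le>w. \<Sum>i\<le>w. \<Sum>a\<in>?M. \<Sum>j\<le>w. if ?c a i j k then ?X a k i j else 0)"
    by (rule sum.swap)
  also have "\<dots> = (\<Sum>k\<le>w. \<Sum>a\<in>?M. \<Sum>i\<le>w. \<Sum>j\<le>w. if ?c a i j k then ?X a k i j else 0)"
    by (intro sum.cong[OF refl] sum.swap)
  also have "\<dots> = (\<Sum>k\<le>w. \<Sum>a\<in>?M. ?X a k (mon_weight a - 2 * mon_degree a - k) (mon_degree a))"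
    by (intro sum.cong[OF refl] 2)
  also have "\<dots> = (\<Sum>a\<in>?M. \<Sum>k\<le>w. ?X a k (mon_weight a - 2 * mon_degree a - k) (mon_degree a))"
    by (rule sum.swap)
  also have "\<dots> = part_gf (\<lambda>xs. T_minus1 xs * sheval f xs)"
    using part_gf_T_minus1[of f w] w unfolding weight_le_def by (simp add: sum.cartesian_product)
  finally show ?thesis ..
qed

section \<open>Normalised brackets and Eisenstein series\<close>

lemma qbracket_part_gf: "qbracket F = part_gf F * inverse (part_gf (\<lambda>_. 1))"
proof -
  have "partitions_of 0 = {[]}"
  proof
    show "partitions_of 0 \<subseteq> {[]}"
    proof
      fix xs assume xs: "xs \<in> partitions_of 0"
      show "xs \<in> {[]}" using xs by (cases xs) (auto simp: partitions_of_def)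
    qed
  qed (simp add: partitions_of_def)
  then have "fps_nth (part_gf (\<lambda>_. 1)) 0 \<noteq> 0" by (simp add: part_gf_def)
  then show ?thesis unfolding qbracket_def part_gf_def by (rule fps_divide_unit)
qed

abbreviation bracket :: "shsym \<Rightarrow> rat fps" where
  "bracket f \<equiv> qbracket (sheval f)"

lemma bracket_0: "bracket 0 = 0"
  by (simp add: qbracket_part_gf sh_gf_0)

lemma bracket_add: "bracket (f + g) = bracket f + bracket g"
  by (simp add: qbracket_part_gf sh_gf_add distrib_right)

lemma bracket_cst: "bracket (cst c * f) = fps_const c * bracket f"
  by (simp add: qbracket_part_gf sh_gf_cst mult.assoc)

lemma bracket_1: "bracket 1 = 1"
proof -
  have "sheval 1 = (\<lambda>_. 1)" by (intro ext sheval_one)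
  moreover have "fps_nth (part_gf (\<lambda>_. 1)) 0 \<noteq> 0"
  proof
    assume z: "fps_nth (part_gf (\<lambda>_. 1)) 0 = 0"
    have "[] \<in> partitions_of 0" by (simp add: partitions_of_def)
    then have "partitions_of 0 \<noteq> {}" by blast
    with z show False by (simp add: part_gf_def card_eq_0_iff finite_partitions_of)
  qed
  ultimately show ?thesis by (simp add: qbracket_part_gf inverse_mult_eq_1')
qed

lemma bracket_T_minus1:
  assumes "weight_le w f"
  shows "qbracket (\<lambda>xs. T_minus1 xs * sheval f xs) = (\<Sum>i\<le>w. \<Sum>j\<le>w. divisor_fps i j * bracket (rho i j f))"
  unfolding qbracket_part_gf part_gf_rho[OF assms] sum_distrib_right by (simp only: mult.assoc)

lemma bracket_T_minus1_1: "qbracket T_minus1 = divisor_fps 0 0"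
proof -
  have "weight_le 0 1" by (simp add: weight_le_def)
  from bracket_T_minus1[OF this] show ?thesis by (simp add: sheval_one rho_0_0 bracket_1)
qed

lemma Eis_deriv_nth: "fps_nth (Eis_deriv i j) n = of_nat n ^ j * fps_nth (Eis i) n"
  unfolding Eis_deriv_def by (induction j) (simp_all add: mult_ac)

lemma Eis_nth_sigma:
  assumes "even i" "0 < n"
  shows "fps_nth (Eis i) n = (\<Sum>(m, t)\<in>pairs n. of_nat m ^ (i - 1))"
  using assms sigma_fps_nth[of "i - 1" n] by (simp add: Eis_def sigma_fps_def)

text \<open>For j > 0 the derivative kills the constant term of \<open>Eis i\<close>; the case j = 0
  is settled by \<open>rho_degree_0\<close>.\<close>

lemma divisor_fps_even:
  assumes "even i" "2 \<le> i" "0 < j"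
  shows "divisor_fps i j = Eis_deriv i j"
proof (rule fps_ext)
  fix n
  show "fps_nth (divisor_fps i j) n = fps_nth (Eis_deriv i j) n"
  proof (cases "n = 0")
    case True
    then show ?thesis using assms by (simp add: divisor_fps_def Eis_deriv_nth)
  next
    case False
    obtain r where r: "i = Suc r" using assms(2) by (cases i) auto
    have "(\<Sum>(m, t)\<in>pairs n. of_nat m ^ i / of_nat m) = (\<Sum>(m, t)\<in>pairs n. of_nat m ^ (i - 1) :: rat)"
      by (intro sum.cong) (auto simp: pairs_def r)
    then show ?thesis
      using False assms by (simp add: divisor_fps_def Eis_deriv_nth Eis_nth_sigma)
  qed
qed

text \<open>(m t)^(j+1) / m = (m t)^j t, and exchanging m and t turns the sum of t into sigma_1. The
  summand 1/24 offsets the constant term of G_2, which survives only for j = 0.\<close>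

lemma divisor_fps_0:
  "divisor_fps 0 (Suc j) = Eis_deriv 2 j + fps_const (if j = 0 then 1/24 else 0)"
proof (rule fps_ext)
  fix n
  show "fps_nth (divisor_fps 0 (Suc j)) n = fps_nth (Eis_deriv 2 j + fps_const (if j = 0 then 1/24 else 0)) n"
  proof (cases "n = 0")
    case True
    have "fps_nth (Eis 2) 0 = - 1/24"
      using Eis_split[of 2] by (simp add: geis_def sigma_fps_def eis_const_def bernc_values)
    then show ?thesis using True by (simp add: divisor_fps_def Eis_deriv_nth)
  next
    case False
    have "of_nat n * (\<Sum>(m, t)\<in>pairs n. of_nat m ^ 0 / of_nat m) = (\<Sum>(m, t)\<in>pairs n. of_nat t :: rat)"
      unfolding sum_distrib_left by (intro sum.cong) (auto simp: pairs_def)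
    also have "\<dots> = (\<Sum>(m, t)\<in>pairs n. of_nat m :: rat)"
      using sum_pairs[of n "of_nat :: nat \<Rightarrow> rat"] sum_pairs'[of n "of_nat :: nat \<Rightarrow> rat"] False by simp
    also have "\<dots> = fps_nth (Eis 2) n"
      using False Eis_nth_sigma[of 2 n] by simp
    finally have "of_nat n ^ j * (of_nat n * (\<Sum>(m, t)\<in>pairs n. of_nat m ^ 0 / of_nat m)) = of_nat n ^ j * fps_nth (Eis 2) n"
      by simp
    then show ?thesis
      using False by (simp add: divisor_fps_def Eis_deriv_nth mult_ac)
  qed
qed

lemma bracket_star_expand:
  assumes w: "weight_le w f"
  shows "qbracket_star f = (\<Sum>i\<in>{2..w + 2}. \<Sum>j\<le>w. Eis_deriv i j * bracket (rho_star i j f))"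
proof -
  let ?B = "\<lambda>i j. bracket (rho i j f)"
  have big: "?B i j = 0" if "w < i + 2 * j" for i j
    using rho_eq_0[OF w that] by (simp add: bracket_0)
  have row0: "(\<Sum>j\<le>w. divisor_fps 0 j * ?B 0 j)
     = divisor_fps 0 0 * bracket f + (\<Sum>j\<le>w. Eis_deriv 2 j * ?B 0 (j + 1)) + fps_const (1/24) * bracket (del2 f)"
  proof -
    have "(\<Sum>j\<le>w. divisor_fps 0 j * ?B 0 j) = (\<Sum>j\<le>Suc w. divisor_fps 0 j * ?B 0 j)"
      using big[of 0 "Suc w"] by simp
    also have "\<dots> = divisor_fps 0 0 * ?B 0 0 + (\<Sum>j\<le>w. divisor_fps 0 (Suc j) * ?B 0 (Suc j))"
      by (rule sum.atMost_Suc_shift)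
    also have "(\<Sum>j\<le>w. divisor_fps 0 (Suc j) * ?B 0 (Suc j)) =
      (\<Sum>j\<le>w. Eis_deriv 2 j * ?B 0 (Suc j)) + (\<Sum>j\<le>w. if j = 0 then fps_const (1/24) * ?B 0 1 else 0)"
      unfolding divisor_fps_0 sum.distrib[symmetric] by (intro sum.cong) (auto simp: distrib_right)
    finally show ?thesis by (simp add: rho_0_0 rho_0_1[unfolded One_nat_def] add.assoc)
  qed
  have row: "(\<Sum>j\<le>w. divisor_fps i j * ?B i j) = (\<Sum>j\<le>w. Eis_deriv i j * ?B i j)" if "2 \<le> i" for i
  proof (rule sum.cong[OF refl])
    fix j
    show "divisor_fps i j * ?B i j = Eis_deriv i j * ?B i j"
      using that rho_odd[of i j f] rho_degree_0[of i f] divisor_fps_even[of i j]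
      by (cases "odd i"; cases "j = 0") (auto simp: bracket_0)
  qed
  \<comment> \<open>The range is extended to w + 2 so that i = 2, the row receiving
    \<open>rho 0 (j + 1)\<close>, is present for every w.\<close>
  have "qbracket (\<lambda>xs. T_minus1 xs * sheval f xs) = (\<Sum>i\<in>{..w + 2}. \<Sum>j\<le>w. divisor_fps i j * ?B i j)"
    unfolding bracket_T_minus1[OF w] by (intro sum.mono_neutral_left) (auto simp: big)
  also have "{..w + 2} = insert 0 (insert 1 {2..w + 2})" by auto
  also have "(\<Sum>i\<in>insert 0 (insert 1 {2..w + 2}). \<Sum>j\<le>w. divisor_fps i j * ?B i j)
     = (\<Sum>j\<le>w. divisor_fps 0 j * ?B 0 j) + (\<Sum>i\<in>{2..w + 2}. \<Sum>j\<le>w. divisor_fps i j * ?B i j)"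
    by (simp add: rho_odd bracket_0)
  also have "(\<Sum>i\<in>{2..w + 2}. \<Sum>j\<le>w. divisor_fps i j * ?B i j) = (\<Sum>i\<in>{2..w + 2}. \<Sum>j\<le>w. Eis_deriv i j * ?B i j)"
    by (intro sum.cong[OF refl] row) simp
  finally have main: "qbracket (\<lambda>xs. T_minus1 xs * sheval f xs) - qbracket T_minus1 * bracket f - fps_const (1/24) * bracket (del2 f)
     = (\<Sum>i\<in>{2..w + 2}. \<Sum>j\<le>w. Eis_deriv i j * ?B i j) + (\<Sum>j\<le>w. Eis_deriv 2 j * ?B 0 (j + 1))"
    unfolding row0 bracket_T_minus1_1 by simp
  have "(\<Sum>i\<in>{2..w + 2}. \<Sum>j\<le>w. Eis_deriv i j * bracket (rho_star i j f))
     = (\<Sum>i\<in>{2..w + 2}. (\<Sum>j\<le>w. Eis_deriv i j * ?B i j) + (if i = 2 then \<Sum>j\<le>w. Eis_deriv 2 j * ?B 0 (j + 1) else 0))"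
    unfolding rho_star_def by (intro sum.cong[OF refl]) (auto simp: bracket_add bracket_0 distrib_left sum.distrib)
  also have "\<dots> = (\<Sum>i\<in>{2..w + 2}. \<Sum>j\<le>w. Eis_deriv i j * ?B i j) + (\<Sum>j\<le>w. Eis_deriv 2 j * ?B 0 (j + 1))"
    by (simp add: sum.distrib)
  finally show ?thesis unfolding qbracket_star_def main ..
qed

lemma rho_star_support:
  assumes w: "weight_le w f"
  shows "{(i, j). 2 \<le> i \<and> rho_star i j f \<noteq> 0} \<subseteq> {2..w + 2} \<times> {..w}"
proof clarify
  fix i j assume i: "2 \<le> i" and nz: "rho_star i j f \<noteq> 0"
  have "i + 2 * j \<le> w \<or> i = 2 \<and> 2 * (j + 1) \<le> w"
  proof (rule ccontr)
    assume n: "\<not> (i + 2 * j \<le> w \<or> i = 2 \<and> 2 * (j + 1) \<le> w)"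
    then have "rho i j f = 0" by (intro rho_eq_0[OF w]) simp
    moreover have "rho 0 (j + 1) f = 0" if "i = 2" using n that by (intro rho_eq_0[OF w]) simp
    ultimately show False using nz by (simp add: rho_star_def split: if_splits)
  qed
  with i show "i \<in> {2..w + 2} \<and> j \<in> {..w}" by auto
qed

lemma bracket_star_formula:
  assumes w: "weight_le w f"
  shows "qbracket_star f = (\<Sum>(i, j) | 2 \<le> i \<and> rho_star i j f \<noteq> 0. Eis_deriv i j * bracket (rho_star i j f))"
proof -
  have "qbracket_star f = (\<Sum>(i, j)\<in>{2..w + 2} \<times> {..w}. Eis_deriv i j * bracket (rho_star i j f))"
    unfolding bracket_star_expand[OF w] by (simp add: sum.cartesian_product)
  also have "\<dots> = (\<Sum>(i, j) | 2 \<le> i \<and> rho_star i j f \<noteq> 0. Eis_deriv i j * bracket (rho_star i j f))"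
    using rho_star_support[OF w] by (intro sum.mono_neutral_right) (auto simp: bracket_0)
  finally show ?thesis .
qed

section \<open>The shift of all \<open>Q\<^sub>k\<close>\<close>

definition no_Q1 :: "shsym \<Rightarrow> bool" where
  "no_Q1 f \<longleftrightarrow> (\<forall>m\<in>Poly_Mapping.keys f. Poly_Mapping.lookup m 0 = 0)"

definition pure :: "nat \<Rightarrow> shsym \<Rightarrow> bool" where
  "pure w f \<longleftrightarrow> no_Q1 f \<and> homogeneous w f"

lemma homogeneous_add: "homogeneous w f \<Longrightarrow> homogeneous w g \<Longrightarrow> homogeneous w (f + g)"
  using keys_add[of f g] by (auto simp: homogeneous_def)

lemma homogeneous_0 [simp]: "homogeneous w 0"
  by (simp add: homogeneous_def)

lemma homogeneous_mult: "homogeneous w f \<Longrightarrow> homogeneous v g \<Longrightarrow> homogeneous (w + v) (f * g)"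
  using keys_mult[of f g] by (fastforce simp: homogeneous_def mon_weight_add)

lemma homogeneous_sum: "(\<And>x. x \<in> A \<Longrightarrow> homogeneous w (F x)) \<Longrightarrow> homogeneous w (sum F A)"
  by (induction A rule: infinite_finite_induct) (auto intro: homogeneous_add)

lemma homogeneous_cst: "homogeneous 0 (cst c)"
  by (auto simp: homogeneous_def cst_def)

lemma homogeneous_Q: "homogeneous k (Q k)"
  by (cases k) (auto simp: homogeneous_def Q_def)

lemma no_Q1_add: "no_Q1 f \<Longrightarrow> no_Q1 g \<Longrightarrow> no_Q1 (f + g)"
  using keys_add[of f g] by (auto simp: no_Q1_def)

lemma no_Q1_mult: "no_Q1 f \<Longrightarrow> no_Q1 g \<Longrightarrow> no_Q1 (f * g)"
  using keys_mult[of f g] by (fastforce simp: no_Q1_def lookup_add)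

lemma no_Q1_cst: "no_Q1 (cst c)"
  by (auto simp: no_Q1_def cst_def)

lemma no_Q1_Q: "k \<noteq> 1 \<Longrightarrow> no_Q1 (Q k)"
  by (cases k) (auto simp: no_Q1_def Q_def lookup_single when_def)

lemma pure_add: "pure w f \<Longrightarrow> pure w g \<Longrightarrow> pure w (f + g)"
  by (simp add: pure_def homogeneous_add no_Q1_add)

lemma pure_0 [simp]: "pure w 0"
  by (simp add: pure_def no_Q1_def)

lemma pure_mult: "pure w f \<Longrightarrow> pure v g \<Longrightarrow> pure (w + v) (f * g)"
  by (simp add: pure_def homogeneous_mult no_Q1_mult)

lemma pure_sum: "(\<And>x. x \<in> A \<Longrightarrow> pure w (F x)) \<Longrightarrow> pure w (sum F A)"
  by (induction A rule: infinite_finite_induct) (auto intro: pure_add)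

lemma pure_cst: "pure 0 (cst c)"
  by (simp add: pure_def homogeneous_cst no_Q1_cst)

lemma pure_Q: "k \<noteq> 1 \<Longrightarrow> pure k (Q k)"
  by (simp add: pure_def homogeneous_Q no_Q1_Q)

text \<open>
  \<open>Q\<^sub>1\<close> vanishes on all partitions, so it may be replaced by \<open>0\<close>. With this convention \<open>shift_poly\<close> is the
  ring homomorphism \<open>exp (Y \<partial>)\<close>, where \<open>\<partial>\<close> sends \<open>Q\<^sub>k\<close> to \<open>Q\<^bsub>k-1\<^esub>\<close>, and \<open>shift_coeff d\<close> is \<open>\<partial>\<^sup>d / d!\<close> with \<open>Q\<^sub>1\<close>
  set to \<open>0\<close> at the end only: \<open>\<partial>\<^sup>2 Q\<^sub>2 = 1\<close> although \<open>delta (delta (Q 2)) = 0\<close>.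
\<close>

definition Qred :: "nat \<Rightarrow> shsym" where
  "Qred k = (if k = 1 then 0 else Q k)"

lemma pure_Qred: "pure k (Qred k)"
  by (simp add: Qred_def pure_Q)

definition shift_var :: "nat \<Rightarrow> shsym poly" where
  "shift_var n = (\<Sum>j\<le>n + 1. Polynomial.monom (cst (1 / fact j) * Qred (n + 1 - j)) j)"

definition shift_poly :: "shsym \<Rightarrow> shsym poly" where
  "shift_poly f = hev (\<lambda>c. [:cst c:]) shift_var f"

lemma rat_hom_cst_poly: "rat_hom (\<lambda>c. [:cst c:])"
  by (simp add: rat_hom_def cst_def single_add mult_single one_pCons mult.commute)

lemma coeff_shift_var:
  "coeff (shift_var n) d = (if d \<le> n + 1 then cst (1 / fact d) * Qred (n + 1 - d) else 0)"
proof -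
  have "coeff (shift_var n) d = (\<Sum>j\<le>n + 1. if j = d then cst (1 / fact d) * Qred (n + 1 - d) else 0)"
    unfolding shift_var_def coeff_sum coeff_monom by (intro sum.cong) auto
  then show ?thesis by (simp only: sum.delta finite_atMost atMost_iff)
qed

text \<open>Homogeneity of total weight w when the indeterminate Y has weight 1; with this grading
  exp(Y \<partial>) preserves the weight.\<close>

definition pure_poly :: "nat \<Rightarrow> shsym poly \<Rightarrow> bool" where
  "pure_poly w P \<longleftrightarrow> (\<forall>d. if d \<le> w then pure (w - d) (coeff P d) else coeff P d = 0)"

lemma pure_poly_coeff: "pure_poly w P \<Longrightarrow> d \<le> w \<Longrightarrow> pure (w - d) (coeff P d)"
  "pure_poly w P \<Longrightarrow> w < d \<Longrightarrow> coeff P d = 0"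
  unfolding pure_poly_def by (metis, metis not_le)

lemma pure_poly_mult:
  assumes P: "pure_poly w P" and R: "pure_poly v R"
  shows "pure_poly (w + v) (P * R)"
  unfolding pure_poly_def
proof (intro allI)
  fix d
  have z: "coeff P i * coeff R (d - i) = 0" if "\<not> (i \<le> w \<and> d - i \<le> v)" for i
    using that pure_poly_coeff(2)[OF P, of i] pure_poly_coeff(2)[OF R, of "d - i"] by (auto simp: not_le)
  show "if d \<le> w + v then pure (w + v - d) (coeff (P * R) d) else coeff (P * R) d = 0"
  proof (cases "d \<le> w + v")
    case True
    have "pure (w + v - d) (coeff P i * coeff R (d - i))" if i: "i \<in> {..d}" for i
    proof (cases "i \<le> w \<and> d - i \<le> v")
      case True
      then have "w - i + (v - (d - i)) = w + v - d" using i by auto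
      with pure_mult[OF pure_poly_coeff(1)[OF P, of i] pure_poly_coeff(1)[OF R, of "d - i"]] True
      show ?thesis by metis
    next
      case False
      show ?thesis unfolding z[OF False] by simp
    qed
    then show ?thesis using True unfolding coeff_mult by (auto intro!: pure_sum)
  next
    case False
    then have "coeff (P * R) d = 0"
      unfolding coeff_mult by (intro sum.neutral ballI z) auto
    then show ?thesis using False by simp
  qed
qed

lemma pure_poly_add: "pure_poly w P \<Longrightarrow> pure_poly w R \<Longrightarrow> pure_poly w (P + R)"
  by (auto simp: pure_poly_def pure_add split: if_splits)

lemma pure_poly_0: "pure_poly w 0"
  by (simp add: pure_poly_def)

lemma pure_poly_sum: "(\<And>x. x \<in> A \<Longrightarrow> pure_poly w (F x)) \<Longrightarrow> pure_poly w (sum F A)"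
  by (induction A rule: infinite_finite_induct) (auto intro: pure_poly_add pure_poly_0)

lemma pure_poly_cst: "pure_poly 0 [:cst c:]"
  by (auto simp: pure_poly_def pure_cst coeff_pCons split: nat.splits)

lemma pure_poly_power: "pure_poly w P \<Longrightarrow> pure_poly (w * n) (P ^ n)"
proof (induction n)
  case 0
  then show ?case using pure_poly_cst[of 1] by (simp add: cst_1 one_pCons)
next
  case (Suc n)
  then show ?case using pure_poly_mult[of w P "w * n" "P ^ n"] by simp
qed

lemma pure_poly_prod:
  "(\<And>x. x \<in> A \<Longrightarrow> pure_poly (w x) (F x)) \<Longrightarrow> pure_poly (sum w A) (prod F A)"
proof (induction A rule: infinite_finite_induct)
  case (insert x A)
  then show ?case using pure_poly_mult[of "w x" "F x" "sum w A" "prod F A"] by simp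
qed (use pure_poly_cst[of 1] in \<open>simp_all add: cst_1 one_pCons\<close>)

lemma pure_poly_shift_var: "pure_poly (n + 1) (shift_var n)"
  unfolding pure_poly_def coeff_shift_var
proof (intro allI)
  fix d
  show "if d \<le> n + 1 then pure (n + 1 - d) (if d \<le> n + 1 then cst (1 / fact d) * Qred (n + 1 - d) else 0)
    else (if d \<le> n + 1 then cst (1 / fact d) * Qred (n + 1 - d) else 0) = 0"
    using pure_mult[OF pure_cst[of "1 / fact d"] pure_Qred[of "n + 1 - d"]] by simp
qed

lemma pure_poly_shift:
  assumes "homogeneous w f"
  shows "pure_poly w (shift_poly f)"
  unfolding shift_poly_def hev_def
proof (rule pure_poly_sum)
  fix m assume m: "m \<in> Poly_Mapping.keys f"
  have "pure_poly (\<Sum>n\<in>Poly_Mapping.keys m. (n + 1) * Poly_Mapping.lookup m n) (mon_val shift_var m)"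
    unfolding mon_val_def by (intro pure_poly_prod pure_poly_power pure_poly_shift_var)
  from pure_poly_mult[OF pure_poly_cst this]
  show "pure_poly w ([:cst (Poly_Mapping.lookup f m):] * mon_val shift_var m)"
    using assms m by (simp add: homogeneous_def mon_weight_def)
qed

definition shift_coeff :: "nat \<Rightarrow> shsym \<Rightarrow> shsym" where
  "shift_coeff d f = coeff (shift_poly f) d"

lemma shift_poly_mult: "shift_poly (f * g) = shift_poly f * shift_poly g"
  and shift_poly_add: "shift_poly (f + g) = shift_poly f + shift_poly g"
  by (simp_all add: shift_poly_def hev_mult hev_add rat_hom_cst_poly)

lemma shift_poly_Q: "shift_poly (Q (Suc n)) = shift_var n"
  by (simp add: shift_poly_def hev_Q_Suc rat_hom_cst_poly)

lemma mon_val_Q: "mon_val (\<lambda>n. Q (Suc n)) m = Poly_Mapping.single m 1"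
proof -
  have p: "Q (Suc n) ^ k = Poly_Mapping.single (Poly_Mapping.single n k) 1" for n k
  proof (induction k)
    case (Suc k)
    have "Q (Suc n) ^ Suc k = Poly_Mapping.single (Poly_Mapping.single n 1) 1 * Poly_Mapping.single (Poly_Mapping.single n k) 1"
      using Suc by (simp add: Q_def)
    then show ?case by (simp add: mult_single single_add[symmetric])
  qed simp
  have "(\<Prod>n\<in>A. Poly_Mapping.single (h n) (1 :: rat)) = Poly_Mapping.single (\<Sum>n\<in>A. h n) 1"
    for h :: "nat \<Rightarrow> monom" and A
    by (induction A rule: infinite_finite_induct) (auto simp: mult_single)
  then show ?thesis
    unfolding mon_val_def p using poly_mapping_sum_singles[of m] by simp
qed

lemma hom_hev:
  assumes "\<And>a b. h (a + b) = h a + h b" "h 0 = 0" "\<And>a b. h (a * b) = h a * h b" "h 1 = 1"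
  shows "h (hev \<kappa> x f) = hev (\<lambda>c. h (\<kappa> c)) (\<lambda>n. h (x n)) f"
proof -
  have s: "h (sum F A) = (\<Sum>a\<in>A. h (F a))" for F and A :: "monom set"
    by (induction A rule: infinite_finite_induct) (auto simp: assms)
  have p: "h (prod F A) = (\<Prod>a\<in>A. h (F a))" for F and A :: "nat set"
    by (induction A rule: infinite_finite_induct) (auto simp: assms)
  have e: "h (a ^ k) = h a ^ k" for a k
    by (induction k) (auto simp: assms)
  show ?thesis by (simp add: hev_def mon_val_def s p e assms)
qed

lemma shift_coeff_0:
  assumes "no_Q1 f"
  shows "shift_coeff 0 f = f"
proof -
  have "poly (shift_poly f) 0 = hev (\<lambda>c. poly [:cst c:] 0) (\<lambda>n. poly (shift_var n) 0) f"
    unfolding shift_poly_def by (rule hom_hev) simp_all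
  also have "\<dots> = hev cst (\<lambda>n. Qred (Suc n)) f"
    by (simp add: poly_0_coeff_0 coeff_shift_var cst_1)
  also have "\<dots> = (\<Sum>m\<in>Poly_Mapping.keys f. cst (Poly_Mapping.lookup f m) * mon_val (\<lambda>n. Q (Suc n)) m)"
    unfolding hev_def
  proof (intro sum.cong refl arg_cong2[of _ _ _ _ "(*)"])
    fix m assume "m \<in> Poly_Mapping.keys f"
    then have "Poly_Mapping.lookup m 0 = 0" using assms by (simp add: no_Q1_def)
    then show "mon_val (\<lambda>n. Qred (Suc n)) m = mon_val (\<lambda>n. Q (Suc n)) m"
      unfolding mon_val_def by (intro prod.cong) (auto simp: Qred_def in_keys_iff)
  qed
  also have "\<dots> = f"
    using poly_mapping_sum_singles[of f] by (simp add: mon_val_Q cst_def mult_single)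
  finally show ?thesis by (simp add: shift_coeff_def poly_0_coeff_0)
qed

abbreviation delta :: "shsym \<Rightarrow> shsym" where
  "delta \<equiv> shift_coeff 1"

text \<open>The coefficient of degree 0 replaces Q_1 by 0, so the Leibniz rule holds in this form
  for factors free of Q_1.\<close>

lemma delta_mult:
  assumes "no_Q1 f" "no_Q1 g"
  shows "delta (f * g) = f * delta g + delta f * g"
proof -
  have "{..1::nat} = {0, 1}" by auto
  then have "delta (f * g) = shift_coeff 0 f * delta g + delta f * shift_coeff 0 g"
    unfolding shift_coeff_def shift_poly_mult coeff_mult by simp
  then show ?thesis using assms by (simp add: shift_coeff_0)
qed

lemma shift_coeff_Q: "shift_coeff d (Q (Suc n)) = (if d \<le> n + 1 then cst (1 / fact d) * Qred (n + 1 - d) else 0)"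
  unfolding shift_coeff_def shift_poly_Q coeff_shift_var ..

lemma delta_Q: "3 \<le> a \<Longrightarrow> delta (Q a) = Q (a - 1)"
proof -
  assume a: "3 \<le> a"
  then obtain n where n: "a = Suc n" "2 \<le> n" by (cases a) auto
  then show ?thesis using shift_coeff_Q[of 1 n] by (simp add: Qred_def cst_1)
qed

lemma shift_coeff_sum: "shift_coeff d (sum F A) = (\<Sum>a\<in>A. shift_coeff d (F a))"
proof -
  have "shift_poly 0 = 0" by (simp add: shift_poly_def)
  then show ?thesis
    by (induction A rule: infinite_finite_induct) (auto simp: shift_coeff_def shift_poly_add)
qed

lemma pure_shift_coeff:
  assumes "homogeneous w f"
  shows "d \<le> w \<Longrightarrow> pure (w - d) (shift_coeff d f)" "w < d \<Longrightarrow> shift_coeff d f = 0"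
  using pure_poly_coeff[OF pure_poly_shift[OF assms]] by (simp_all add: shift_coeff_def)

text \<open>
  The preimage is the telescoping sum \<open>\<Sum>\<^sub>k (-1)\<^sup>k Q\<^bsub>a+k+1\<^esub> \<partial>\<^sup>k g\<close>.
\<close>

lemma delta_primitive:
  assumes g: "pure v g" and a: "2 \<le> a"
  obtains F where "pure (a + v + 1) F" "delta F = Q a * g"
proof -
  have it: "pure (v - k) ((delta ^^ k) g)" if "k \<le> v" for k
    using that
  proof (induction k)
    case (Suc k)
    then show ?case using pure_shift_coeff(1)[of "v - k" "(delta ^^ k) g" 1] by (simp add: pure_def)
  qed (use g in simp)
  have it0: "(delta ^^ Suc v) g = 0"
    using pure_shift_coeff(2)[of 0 "(delta ^^ v) g" 1] it[of v] by (simp add: pure_def)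
  define t where "t = (\<lambda>k. Q (a + k + 1) * (delta ^^ k) g)"
  define u where "u = (\<lambda>k. Q (a + k) * (delta ^^ k) g)"
  define F where "F = (\<Sum>k\<le>v. cst ((-1) ^ k) * t k)"
  have pt: "pure (a + v + 1) (t k)" if "k \<le> v" for k
  proof -
    have "pure (a + k + 1 + (v - k)) (t k)"
      unfolding t_def using a by (intro pure_mult pure_Q it that) simp
    moreover have "a + k + 1 + (v - k) = a + v + 1" using that by simp
    ultimately show ?thesis by simp
  qed
  have "pure (a + v + 1) F"
    unfolding F_def
  proof (intro pure_sum)
    fix k assume "k \<in> {..v}"
    then show "pure (a + v + 1) (cst ((-1) ^ k) * t k)"
      using pure_mult[OF pure_cst pt, of k "(-1) ^ k"] by simp
  qed
  moreover have "delta F = Q a * g"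
  proof -
    have "delta (cst ((-1) ^ k) * t k) = cst ((-1) ^ k) * (u k + u (Suc k))" if k: "k \<le> v" for k
    proof -
      have n: "no_Q1 ((delta ^^ k) g)" using it[OF k] by (simp add: pure_def)
      have "delta (cst c) = 0" for c
        unfolding shift_coeff_def shift_poly_def by (simp add: hev_cst rat_hom_cst_poly)
      then have "delta (cst ((-1) ^ k) * t k) = cst ((-1) ^ k) * delta (t k)"
        using delta_mult[of "cst ((-1) ^ k)" "t k"] pt[OF k] by (simp add: no_Q1_cst pure_def)
      also have "delta (t k) = u k + u (Suc k)"
      proof -
        have "delta (Q (a + k + 1)) = Q (a + k)" using a by (subst delta_Q) simp_all
        moreover have "no_Q1 (Q (a + k + 1))" using a by (intro no_Q1_Q) simp
        ultimately show ?thesis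
          unfolding t_def u_def using n by (subst delta_mult) (simp_all add: add.commute)
      qed
      finally show ?thesis .
    qed
    then have "delta F = (\<Sum>k\<le>v. cst ((-1) ^ k) * (u k + u (Suc k)))"
      unfolding F_def shift_coeff_sum by simp
    also have "\<dots> = u 0 + cst ((-1) ^ v) * u (Suc v)"
    proof (induction v)
      case (Suc v)
      have "cst ((-1) ^ Suc v) = - cst ((-1) ^ v)" by (simp add: cst_def single_uminus)
      with Suc show ?case by (simp add: algebra_simps)
    qed (simp add: cst_1)
    also have "u (Suc v) = 0" using it0 by (simp add: u_def)
    finally show ?thesis by (simp add: u_def)
  qed
  ultimately show ?thesis by (rule that)
qed

section \<open>Weights of the operators \<open>rho\<close> and \<open>rho_star\<close>\<close>

lemma mon_diff_homogeneous:
  assumes f: "homogeneous w f" and m: "mon_weight m \<le> w"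
  shows "homogeneous (w - mon_weight m) (mon_diff m f)"
proof -
  have "homogeneous (w - mon_weight m) (mon_diff m (Poly_Mapping.single a c))" if a: "mon_weight a = w" for a c
  proof (cases "\<forall>l. Poly_Mapping.lookup m l \<le> Poly_Mapping.lookup a l")
    case True
    then have "a = m + (a - m)"
      by (intro poly_mapping_eqI) (simp add: lookup_add lookup_minus)
    then have "mon_weight (a - m) = w - mon_weight m"
      using mon_weight_add[of m "a - m"] a by simp
    then show ?thesis unfolding mon_diff_single homogeneous_def by (auto split: if_splits)
  next
    case False
    then obtain l where l: "Poly_Mapping.lookup a l < Poly_Mapping.lookup m l" by (auto simp: not_le)
    then have "l \<in> Poly_Mapping.keys m" by (auto simp: in_keys_iff)
    then have "(\<Prod>l\<in>Poly_Mapping.keys m. fact (Poly_Mapping.lookup m l)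
          * of_nat (Poly_Mapping.lookup a l choose Poly_Mapping.lookup m l) / fact l ^ Poly_Mapping.lookup m l) = (0 :: rat)"
      using l by (intro prod_zero) (auto simp: binomial_eq_0)
    then show ?thesis unfolding mon_diff_single by (simp only: mult_zero_right single_zero homogeneous_0)
  qed
  note key = this
  have "homogeneous (w - mon_weight m) (\<Sum>a\<in>Poly_Mapping.keys f. mon_diff m (Poly_Mapping.single a (Poly_Mapping.lookup f a)))"
  proof (intro homogeneous_sum key)
    fix a assume "a \<in> Poly_Mapping.keys f"
    then show "mon_weight a = w" using f by (simp add: homogeneous_def)
  qed
  then show ?thesis
    unfolding mon_diff_sum[symmetric] poly_mapping_sum_singles[symmetric] .
qed

lemma homogeneous_weight_le: "homogeneous w f \<Longrightarrow> weight_le w f"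
  by (simp add: homogeneous_def weight_le_def)

lemma rho_homogeneous:
  assumes f: "homogeneous w f" and le: "i + 2 * j \<le> w"
  shows "homogeneous (w - (i + 2 * j)) (rho i j f)"
proof -
  have w: "weight_le w f" using f by (rule homogeneous_weight_le)
  show ?thesis
    unfolding rho_expand[OF w]
  proof (rule homogeneous_sum)
    fix k
    show "homogeneous (w - (i + 2 * j)) (Q k * rho_part i j k f)"
    proof (cases "i + 2 * j + k \<le> w")
      case True
      have "homogeneous (w - (i + 2 * j + k)) (rho_part i j k f)"
        unfolding rho_part_def
      proof (rule homogeneous_sum)
        fix m assume m: "m \<in> {m. mon_degree m = j \<and> mon_weight m = i + 2 * j + k}"
        then have "homogeneous (w - (i + 2 * j + k)) (mon_diff m f)"
          using mon_diff_homogeneous[OF f, of m] True by simp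
        then show "homogeneous (w - (i + 2 * j + k)) (cst (rho_series k m) * mon_diff m f)"
          using homogeneous_mult[OF homogeneous_cst] by force
      qed
      from homogeneous_mult[OF homogeneous_Q this, of k]
      show ?thesis using True by (simp add: add.commute)
    next
      case False
      then show ?thesis using rho_part_eq_0[OF w] by (simp add: not_le)
    qed
  qed
qed

lemma rho_star_homogeneous:
  assumes f: "homogeneous w f" and i: "2 \<le> i"
  shows "if i + 2 * j \<le> w then homogeneous (w - (i + 2 * j)) (rho_star i j f) else rho_star i j f = 0"
proof -
  have w: "weight_le w f" using f by (rule homogeneous_weight_le)
  show ?thesis
    using rho_homogeneous[OF f, of i j] rho_homogeneous[OF f, of 0 "j + 1"]
      rho_eq_0[OF w, of i j] rho_eq_0[OF w, of 0 "j + 1"]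
    by (auto simp: rho_star_def not_le intro: homogeneous_add)
qed

section \<open>Charge shifts and theta series\<close>

text \<open>The energy of the vacuum \<open>{..<c}\<close> of charge c, see
  \<open>pw_id_lessThan\<close>.\<close>

definition tri :: "int \<Rightarrow> int" where
  "tri c = c * (c - 1) div 2"

lemma two_tri: "2 * tri c = c * (c - 1)"
  unfolding tri_def by (rule dvd_mult_div_cancel) simp

lemma tri_nonneg: "0 \<le> tri c"
proof -
  have "0 \<le> c * (c - 1)" by (cases "c \<le> 0") (auto simp: mult_nonpos_nonpos)
  then show ?thesis by (simp add: tri_def)
qed

lemma abs_le_tri: "\<bar>c\<bar> \<le> tri c + 1"
proof -
  have "0 \<le> (c - 1) * (c - 2)" "0 \<le> c * (c + 1)"
    by (cases "c \<le> 1"; auto simp: mult_nonpos_nonpos)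
      (cases "c \<le> -1"; cases "c = 0"; auto simp: mult_nonpos_nonpos)
  then show ?thesis using two_tri[of c] by (simp add: algebra_simps abs_le_iff)
qed

lemma finite_tri: "finite {c. tri c \<le> N}"
proof (rule finite_subset)
  show "{c. tri c \<le> N} \<subseteq> {- (N + 1)..N + 1}"
  proof
    fix c assume "c \<in> {c. tri c \<le> N}"
    then show "c \<in> {- (N + 1)..N + 1}" using abs_le_tri[of c] by (simp add: abs_le_iff)
  qed
qed simp

lemma maya_lessThan: "maya {..<c}"
proof -
  have "{..<c} - {..<0} = {0..<c}" "{..<0} - {..<c} = {c..<0}" by auto
  then show ?thesis by (simp add: maya_def almost_eq_def)
qed

lemma pw_lessThan_Suc: "pw \<phi> {..<c + 1} = pw \<phi> {..<c} + \<phi> c"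
proof -
  have "{..<c + 1} = insert c {..<c}" by auto
  then show ?thesis using pw_insert(2)[OF maya_lessThan, of c c \<phi>] by simp
qed

lemma pw_lessThan_0: "pw \<phi> {..<0} = 0"
  by (simp add: pw_def diffsum_def)

text \<open>The biconditional step serves both directions from 0, so one case covers all
  integers.\<close>

lemma int_step_induct:
  fixes c :: int
  assumes "P 0" "\<And>c. P c \<longleftrightarrow> P (c + 1)"
  shows "P c"
proof (induction c rule: int_induct[of _ 0])
  case (step2 i)
  then show ?case using assms(2)[of "i - 1"] by simp
qed (use assms in auto)

lemma pw_one_lessThan: "pw (\<lambda>_. 1 :: int) {..<c} = c"
  by (induction c rule: int_step_induct) (simp_all add: pw_lessThan_0 pw_lessThan_Suc)

lemma pw_id_lessThan: "pw (\<lambda>s. s :: int) {..<c} = tri c"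
proof -
  have "2 * pw (\<lambda>s. s :: int) {..<c} = c * (c - 1)"
    by (induction c rule: int_step_induct)
      (auto simp: pw_lessThan_0 pw_lessThan_Suc algebra_simps)
  then show ?thesis using two_tri[of c] by simp
qed

abbreviation shift_set :: "int \<Rightarrow> int set \<Rightarrow> int set" where
  "shift_set c S \<equiv> (\<lambda>s. s + c) ` S"

lemma shift_set_lessThan: "shift_set c {..<0} = {..<c}"
proof
  show "{..<c} \<subseteq> shift_set c {..<0}"
  proof
    fix z assume "z \<in> {..<c}"
    then have "z = (z - c) + c" "z - c \<in> {..<0}" by auto
    then show "z \<in> shift_set c {..<0}" by (rule image_eqI)
  qed
qed auto

lemma pw_shift_set:
  assumes "maya S"
  shows "maya (shift_set c S)" "pw \<phi> (shift_set c S) = pw (\<lambda>s. \<phi> (s + c)) S + pw \<phi> {..<c}"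
proof -
  have inj: "inj (\<lambda>s. s + c)" by (simp add: inj_def)
  have a: "almost_eq (shift_set c S) {..<c}"
    using almost_eq_image[OF inj, of S "{..<0}"] assms by (simp add: maya_def shift_set_lessThan)
  have b: "almost_eq {..<c} {..<0}" using maya_lessThan by (simp add: maya_def)
  show "maya (shift_set c S)" using almost_eq_trans[OF a b] by (simp add: maya_def)
  have "diffsum \<phi> (shift_set c S) (shift_set c {..<0}) = pw (\<lambda>s. \<phi> (s + c)) S"
    unfolding diffsum_image[OF inj] pw_def ..
  then show "pw \<phi> (shift_set c S) = pw (\<lambda>s. \<phi> (s + c)) S + pw \<phi> {..<c}"
    unfolding pw_def[of \<phi>] diffsum_trans[OF a b] by (simp add: shift_set_lessThan)
qed

lemma pw_add: "pw (\<lambda>s. \<phi> s + \<psi> s) S = pw \<phi> S + pw \<psi> S"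
  and pw_cmult: "pw (\<lambda>s. c * \<phi> s) S = c * pw \<phi> S"
  by (simp_all add: pw_def diffsum_linear)

lemma of_int_pw: "of_int (pw \<phi> S) = pw (\<lambda>s. of_int (\<phi> s)) S"
  by (simp add: pw_def diffsum_def)

lemma shift_mayas:
  "S \<in> mayas 0 E \<longleftrightarrow> shift_set c S \<in> mayas c (E + tri c)"
proof -
  \<comment> \<open>Proved for every initial charge, so that translating by -c yields the
    converse.\<close>
  have f: "shift_set c S \<in> mayas (a + c) (E + a * c + tri c)" if S: "S \<in> mayas a E" for S c a E
  proof -
    have m: "maya S" using S by (simp add: mayas_def)
    have "pw (\<lambda>s. s + c) S = E + a * c"
      using S pw_add[where \<phi> = "\<lambda>s. s" and \<psi> = "\<lambda>s. c" and S = S] pw_cmult[where c = c and \<phi> = "\<lambda>_. 1" and S = S] by (simp add: mayas_def)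
    then show ?thesis
      using S pw_shift_set(1)[OF m, where c = c]
      by (simp add: mayas_def pw_shift_set(2)[OF m] pw_one_lessThan pw_id_lessThan)
  qed
  show ?thesis
  proof
    assume "S \<in> mayas 0 E"
    from f[OF this, of c] show "shift_set c S \<in> mayas c (E + tri c)" by simp
  next
    assume "shift_set c S \<in> mayas c (E + tri c)"
    from f[OF this, of "- c"] have "shift_set (- c) (shift_set c S) \<in> mayas 0 (E + tri c - c * c + tri (- c))" by simp
    moreover have "E + tri c - c * c + tri (- c) = E"
      using two_tri[of c] two_tri[of "- c"] by (simp add: algebra_simps)
    ultimately show "S \<in> mayas 0 E" by (simp add: image_image add_diff_eq)
  qed
qed

definition all_mayas :: "int \<Rightarrow> int set set" where
  "all_mayas E = {S. maya S \<and> pw (\<lambda>s. s) S = E}"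

text \<open>Bead sets of energy E sorted by charge: recentring one of charge c leaves a partition of
  E - \<open>tri c\<close>.\<close>

lemma bij_shift_set:
  "bij_betw (\<lambda>(c, S). shift_set c S) (SIGMA c:{c. tri c \<le> E}. mayas 0 (E - tri c)) (all_mayas E)"
  (is "bij_betw ?f ?A _")
proof -
  define g :: "int set \<Rightarrow> int \<times> int set" where "g T = (pw (\<lambda>_. 1) T, shift_set (- pw (\<lambda>_. 1) T) T)" for T
  have unshift: "shift_set c (shift_set (- c) T) = T" for c T by (simp add: image_image)
  show ?thesis
  proof (rule bij_betw_byWitness[where f' = g])
    show "\<forall>p\<in>?A. g (?f p) = p"
    proof clarify
      fix c S assume "S \<in> mayas 0 (E - tri c)"
      then have "pw (\<lambda>_. 1) (shift_set c S) = c"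
        using shift_mayas[of S "E - tri c" c] by (simp add: mayas_def)
      then show "g (shift_set c S) = (c, S)"
        by (simp add: g_def image_image)
    qed
    show "\<forall>T\<in>all_mayas E. ?f (g T) = T"
      by (simp only: g_def prod.case unshift) simp
    show "?f ` ?A \<subseteq> all_mayas E"
    proof clarify
      fix c S assume "S \<in> mayas 0 (E - tri c)"
      then show "shift_set c S \<in> all_mayas E"
        using shift_mayas[of S "E - tri c" c] by (simp add: mayas_def all_mayas_def)
    qed
    show "g ` all_mayas E \<subseteq> ?A"
    proof
      fix p assume "p \<in> g ` all_mayas E"
      then obtain T where T: "T \<in> all_mayas E" and p: "p = g T" by blast
      define c where "c = pw (\<lambda>_. 1 :: int) T"
      have "T \<in> mayas c (E - tri c + tri c)" using T by (simp add: all_mayas_def mayas_def c_def)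
      then have S: "shift_set (- c) T \<in> mayas 0 (E - tri c)"
        using shift_mayas[of "shift_set (- c) T" "E - tri c" c] unfolding unshift by simp
      then have "tri c \<le> E" using mayas_0_nonneg by force
      with S show "p \<in> ?A" by (simp add: p g_def c_def)
    qed
  qed
qed

definition int_sign :: "int \<Rightarrow> rat" where
  "int_sign c = (if even c then 1 else -1)"

text \<open>
  Flipping the occupation of site \<open>0\<close> preserves the energy and changes the charge by one, hence flips the sign.
\<close>

lemma toggle_sum:
  fixes G :: "int set \<Rightarrow> rat"
  assumes G: "\<And>T. maya T \<Longrightarrow> 0 \<notin> T \<Longrightarrow> G (insert 0 T) = G T"
  shows "(\<Sum>T\<in>all_mayas E. int_sign (pw (\<lambda>_. 1) T) * G T) = 0"
proof -
  define tog :: "int set \<Rightarrow> int set" where "tog T = (if 0 \<in> T then T - {0} else insert 0 T)" for T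
  have tt: "tog (tog T) = T" for T by (auto simp: tog_def)
  have m: "tog T \<in> all_mayas E \<and> int_sign (pw (\<lambda>_. 1) (tog T)) * G (tog T) = - (int_sign (pw (\<lambda>_. 1) T) * G T)"
    if T: "T \<in> all_mayas E" for T
  proof (cases "0 \<in> T")
    case True
    have my: "maya T" using T by (simp add: all_mayas_def)
    note r = pw_remove[OF my True]
    have "G (insert 0 (T - {0})) = G (T - {0})" using r(1) by (intro G) auto
    then have "G (T - {0}) = G T" using True by (simp add: insert_absorb)
    then show ?thesis
      using True T r(1) r(2)[of "\<lambda>s. s"] r(2)[of "\<lambda>_. 1 :: int"] by (simp add: tog_def all_mayas_def int_sign_def)
  next
    case False
    have my: "maya T" using T by (simp add: all_mayas_def)
    note r = pw_insert[OF my False]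
    show ?thesis
      using False T r(1) r(2)[of "\<lambda>s. s"] r(2)[of "\<lambda>_. 1 :: int"] G[OF my False] by (simp add: tog_def all_mayas_def int_sign_def)
  qed
  have "(\<Sum>T\<in>all_mayas E. int_sign (pw (\<lambda>_. 1) T) * G T) = (\<Sum>T\<in>all_mayas E. - (int_sign (pw (\<lambda>_. 1) T) * G T))"
    by (rule sum.reindex_bij_witness[of _ tog tog]) (use m tt in auto)
  then show ?thesis by (simp add: sum_negf)
qed

text \<open>Passing from half-integer to integer positions replaces the vacuum constants beta_k by
  Bernoulli coefficients. A new bead at c adds z exp(c z) to both sides, and for c = 0 the claim is
  exp(-z/2) (z/2) / sinh(z/2) = z / (exp z - 1).\<close>

lemma vacuum_series:
  "fps_exp (of_int c - 1/2) * Abs_fps beta = bern + fps_X * Abs_fps (\<lambda>n. pw (\<lambda>s. of_int s ^ n) {..<c} / fact n)"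
proof -
  let ?B = "Abs_fps beta" and ?D = "fps_exp (1/2) - fps_exp (- 1/2) :: rat fps"
  let ?V = "\<lambda>c. Abs_fps (\<lambda>n. pw (\<lambda>s. of_int s ^ n) {..<c} / fact n) :: rat fps"
  note D = beta_times
  show ?thesis
  proof (induction c rule: int_step_induct)
    case 1
    have "?D \<noteq> 0" using D by auto
    have "fps_exp (- 1/2) * ?B * ?D = bern * ?D"
    proof -
      have "fps_exp 1 - 1 = fps_exp (1/2) * ?D"
        by (simp add: right_diff_distrib fps_exp_add_mult[symmetric])
      then have "bern * ?D * fps_exp (1/2) = fps_X"
        using bern_mult by (simp add: mult_ac)
      then have "bern * ?D * (fps_exp (1/2) * fps_exp (- 1/2)) = fps_X * fps_exp (- 1/2)"
        by (simp only: mult.assoc[symmetric])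
      then have "bern * ?D = fps_X * fps_exp (- 1/2)"
        by (simp add: fps_exp_add_mult[symmetric])
      moreover have "fps_exp (- 1/2) * ?B * ?D = fps_X * fps_exp (- 1/2)"
        unfolding mult.assoc D by (rule mult.commute)
      ultimately show ?thesis by (simp only:)
    qed
    then have "fps_exp (- 1/2) * ?B = bern" using \<open>?D \<noteq> 0\<close> by simp
    moreover have "?V 0 = 0" by (rule fps_ext) (simp add: pw_lessThan_0)
    ultimately show ?case by simp
  next
    case (2 c)
    have V: "?V (c + 1) = ?V c + fps_exp (of_int c)"
      by (rule fps_ext) (simp add: pw_lessThan_Suc add_divide_distrib)
    have "fps_exp (of_int (c + 1) - 1/2) * ?B - fps_exp (of_int c - 1/2) * ?B = fps_exp (of_int c) * (?B * ?D)"
    proof -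
      have e: "fps_exp (of_int (c + 1) - 1/2) = fps_exp (of_int c) * (fps_exp (1/2) :: rat fps)"
        "fps_exp (of_int c - 1/2) = fps_exp (of_int c) * (fps_exp (- 1/2) :: rat fps)"
        by (simp_all add: fps_exp_add_mult[symmetric])
      show ?thesis unfolding e by (simp add: algebra_simps)
    qed
    then have s: "fps_exp (of_int (c + 1) - 1/2) * ?B = fps_exp (of_int c - 1/2) * ?B + fps_X * fps_exp (of_int c)"
      unfolding D by (simp add: algebra_simps)
    show ?case unfolding s V distrib_left by (simp add: add.assoc[symmetric])
  qed
qed

text \<open>The choice y = c - 1/2 in exp(y \<partial>) turns the positions s + 1/2 into the
  integers s + c. A bead at site 0 then contributes 0^n, which is invisible for n > 0; this is why
  flipping that site leaves the shifted Q_k with k \<ge> 2 unchanged.\<close>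

lemma shifted_qval:
  assumes S: "maya S"
  shows "(\<Sum>j\<le>Suc n. (of_int c - 1/2) ^ j / fact j * qval S (Suc n - j))
    = pw (\<lambda>s. of_int s ^ n) (shift_set c S) / fact n + fps_nth bern (Suc n)"
proof -
  let ?y = "of_int c - 1/2 :: rat"
  have "(\<Sum>j\<le>Suc n. ?y ^ j / fact j * beta (Suc n - j)) = fps_nth (fps_exp ?y * Abs_fps beta) (Suc n)"
    by (simp add: fps_mult_nth atLeast0AtMost)
  also have "\<dots> = fps_nth bern (Suc n) + pw (\<lambda>s. of_int s ^ n) {..<c} / fact n"
    unfolding vacuum_series by simp
  finally have b: "(\<Sum>j\<le>Suc n. ?y ^ j / fact j * beta (Suc n - j)) = fps_nth bern (Suc n) + pw (\<lambda>s. of_int s ^ n) {..<c} / fact n" .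
  have x: "of_int (s + c) ^ n = (\<Sum>j\<le>n. of_nat (n choose j) * ?y ^ j * bpos s ^ (n - j))" for s
  proof -
    have "of_int (s + c) = ?y + bpos s" by simp
    then show ?thesis by (simp only: binomial_ring)
  qed
  have "pw (\<lambda>s. of_int (s + c) ^ n) S / fact n = (\<Sum>j\<le>n. ?y ^ j / fact j * (pw (\<lambda>s. bpos s ^ (n - j)) S / fact (n - j)))"
    unfolding x pw_def diffsum_sum diffsum_linear(3) sum_divide_distrib
    by (intro sum.cong) (auto simp: binomial_fact)
  also have "\<dots> = (\<Sum>j\<le>n. ?y ^ j / fact j * (qval S (Suc n - j) - beta (Suc n - j)))"
    by (intro sum.cong) (auto simp: Suc_diff_le qval_def qcoord_def)
  also have "\<dots> = (\<Sum>j\<le>Suc n. ?y ^ j / fact j * (qval S (Suc n - j) - beta (Suc n - j)))"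
    by (simp add: qval_def beta_0)
  also have "\<dots> = (\<Sum>j\<le>Suc n. ?y ^ j / fact j * qval S (Suc n - j)) - (fps_nth bern (Suc n) + pw (\<lambda>s. of_int s ^ n) {..<c} / fact n)"
    unfolding right_diff_distrib sum_subtractf b ..
  finally show ?thesis
    unfolding pw_shift_set(2)[OF S] by (simp add: add_divide_distrib)
qed

lemma beta_1: "beta 1 = 0"
  using beta_sum[of 1 1] by (simp add: beta_0)

lemma beta_2: "beta 2 = - 1/24"
proof -
  have "{..2::nat} = {0, 1, 2}" by auto
  then show ?thesis using beta_sum[of 2 1] by (simp add: beta_0 beta_1[unfolded One_nat_def] power2_eq_square fact_numeral field_simps)
qed

lemma ev_maya_sum: "ev_maya (sum F A) S = (\<Sum>a\<in>A. ev_maya (F a) S)"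
  by (simp add: ev_maya_def hev_sum rat_hom_id)

lemma ev_maya_power: "ev_maya (f ^ n) S = ev_maya f S ^ n"
  by (induction n) (simp_all add: ev_maya_1 ev_maya_mult)

lemma ev_maya_Qred:
  assumes "S \<in> mayas 0 E"
  shows "ev_maya (Qred k) S = qval S k"
proof (cases k)
  case 0
  then show ?thesis by (simp add: Qred_def Q_0 ev_maya_1 qval_def)
next
  case (Suc n)
  have "pw (\<lambda>_. 1 :: rat) S = of_int (pw (\<lambda>_. 1) S)" by (simp add: of_int_pw)
  then have "pw (\<lambda>_. 1 :: rat) S = 0" using assms by (simp add: mayas_def)
  then have "qcoord S 0 = 0" using beta_1 by (simp add: qcoord_def)
  then show ?thesis using Suc
    by (auto simp: Qred_def ev_maya_def hev_Q_Suc rat_hom_id qval_def)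
qed

text \<open>Substituting c - 1/2 for the indeterminate and evaluating on S is a ring homomorphism,
  so it suffices to compare on the variables, where it is \<open>shifted_qval\<close>.\<close>

lemma ev_maya_shift_poly:
  assumes S: "S \<in> mayas 0 E"
  shows "(\<Sum>d\<le>Polynomial.degree (shift_poly f). (of_int c - 1/2) ^ d * ev_maya (shift_coeff d f) S)
    = hev (\<lambda>c. c) (\<lambda>n. pw (\<lambda>s. of_int s ^ n) (shift_set c S) / fact n + fps_nth bern (Suc n)) f"
proof -
  let ?y = "of_int c - 1/2 :: rat"
  let ?h = "\<lambda>P. ev_maya (poly P (cst ?y)) S"
  have var: "?h (shift_var n) = pw (\<lambda>s. of_int s ^ n) (shift_set c S) / fact n + fps_nth bern (Suc n)" for n
  proof -
    have "?h (shift_var n) = (\<Sum>j\<le>Suc n. ?y ^ j / fact j * qval S (Suc n - j))"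
      unfolding shift_var_def poly_sum poly_monom ev_maya_sum
      by (simp add: ev_maya_mult ev_maya_cst ev_maya_power ev_maya_Qred[OF S] mult_ac)
    then show ?thesis using shifted_qval S by (simp add: mayas_def)
  qed
  have "?h (shift_poly f) = hev (\<lambda>c. ?h [:cst c:]) (\<lambda>n. ?h (shift_var n)) f"
    unfolding shift_poly_def
    by (rule hom_hev) (simp_all add: ev_maya_add ev_maya_mult ev_maya_0 ev_maya_1)
  also have "\<dots> = hev (\<lambda>c. c) (\<lambda>n. pw (\<lambda>s. of_int s ^ n) (shift_set c S) / fact n + fps_nth bern (Suc n)) f"
    unfolding var by (simp add: ev_maya_cst)
  finally have "?h (shift_poly f) = \<dots>" .
  moreover have "?h (shift_poly f) = (\<Sum>d\<le>Polynomial.degree (shift_poly f). ?y ^ d * ev_maya (shift_coeff d f) S)"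
    unfolding poly_altdef ev_maya_sum
    by (simp add: ev_maya_mult ev_maya_cst ev_maya_power shift_coeff_def mult_ac)
  ultimately show ?thesis by simp
qed

text \<open>
  \<open>theta 1\<close> is \<open>\<eta>\<^sup>3\<close> up to a constant and a fractional power of \<open>q\<close>.
\<close>

definition theta :: "nat \<Rightarrow> rat fps" where
  "theta d = Abs_fps (\<lambda>M. \<Sum>c | tri c = int M. int_sign c * (of_int c - 1/2) ^ d)"

text \<open>The signed sum over all bead sets of energy N is computed twice: sorted by charge it is
  a coefficient of the left side, and flipping site 0 shows that it vanishes.\<close>

lemma theta_sh_gf:
  assumes f: "no_Q1 f"
  shows "(\<Sum>d\<le>Polynomial.degree (shift_poly f). theta d * sh_gf (shift_coeff d f)) = 0"
proof (rule fps_ext)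
  fix N :: nat
  let ?D = "Polynomial.degree (shift_poly f)"
  let ?G = "\<lambda>T. hev (\<lambda>c. c) (\<lambda>n. pw (\<lambda>s. of_int s ^ n) T / fact n + fps_nth bern (Suc n)) f"
  let ?y = "\<lambda>c. of_int c - 1/2 :: rat"
  have fin: "finite {c. tri c = M}" for M
    by (rule finite_subset[OF _ finite_tri[of M]]) auto
  have "fps_nth (\<Sum>d\<le>?D. theta d * sh_gf (shift_coeff d f)) N
     = (\<Sum>d\<le>?D. \<Sum>M=0..N. \<Sum>c | tri c = int M. int_sign c * ?y c ^ d * (\<Sum>S\<in>mayas 0 (int (N - M)). ev_maya (shift_coeff d f) S))"
    unfolding fps_sum_nth by (simp only: fps_mult_nth sh_gf_maya theta_def fps_nth_Abs_fps sum_distrib_right)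
  also have "\<dots> = (\<Sum>M=0..N. \<Sum>c | tri c = int M. \<Sum>d\<le>?D. int_sign c * ?y c ^ d * (\<Sum>S\<in>mayas 0 (int (N - M)). ev_maya (shift_coeff d f) S))"
    by (subst sum.swap, intro sum.cong[OF refl], rule sum.swap)
  also have "\<dots> = (\<Sum>M=0..N. \<Sum>c | tri c = int M. int_sign c * (\<Sum>S\<in>mayas 0 (int N - tri c). ?G (shift_set c S)))"
  proof (rule sum.cong[OF refl], rule sum.cong[OF refl])
    fix M c assume M: "M \<in> {0..N}" and c: "c \<in> {c. tri c = int M}"
    have e: "int (N - M) = int N - tri c" using M c by (simp add: of_nat_diff)
    have "(\<Sum>d\<le>?D. int_sign c * ?y c ^ d * (\<Sum>S\<in>mayas 0 (int (N - M)). ev_maya (shift_coeff d f) S))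
       = (\<Sum>d\<le>?D. \<Sum>S\<in>mayas 0 (int N - tri c). int_sign c * (?y c ^ d * ev_maya (shift_coeff d f) S))"
      unfolding e sum_distrib_left by (simp only: mult.assoc)
    also have "\<dots> = (\<Sum>S\<in>mayas 0 (int N - tri c). int_sign c * (\<Sum>d\<le>?D. ?y c ^ d * ev_maya (shift_coeff d f) S))"
      unfolding sum_distrib_left by (rule sum.swap)
    also have "\<dots> = (\<Sum>S\<in>mayas 0 (int N - tri c). int_sign c * ?G (shift_set c S))"
    proof (rule sum.cong[OF refl])
      fix S assume "S \<in> mayas 0 (int N - tri c)"
      from ev_maya_shift_poly[OF this, where c = c and f = f]
      show "int_sign c * (\<Sum>d\<le>?D. ?y c ^ d * ev_maya (shift_coeff d f) S) = int_sign c * ?G (shift_set c S)"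
        by (simp only:)
    qed
    also have "\<dots> = int_sign c * (\<Sum>S\<in>mayas 0 (int N - tri c). ?G (shift_set c S))"
      by (rule sum_distrib_left[symmetric])
    finally show "(\<Sum>d\<le>?D. int_sign c * ?y c ^ d * (\<Sum>S\<in>mayas 0 (int (N - M)). ev_maya (shift_coeff d f) S))
      = int_sign c * (\<Sum>S\<in>mayas 0 (int N - tri c). ?G (shift_set c S))" .
  qed
  also have "\<dots> = (\<Sum>(M, c)\<in>(SIGMA M:{0..N}. {c. tri c = int M}). int_sign c * (\<Sum>S\<in>mayas 0 (int N - tri c). ?G (shift_set c S)))"
    using fin by (subst sum.Sigma) auto
  also have "\<dots> = (\<Sum>c | tri c \<le> int N. int_sign c * (\<Sum>S\<in>mayas 0 (int N - tri c). ?G (shift_set c S)))"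
    by (rule sum.reindex_bij_witness[of _ "\<lambda>c. (nat (tri c), c)" snd]) (use tri_nonneg in auto)
  also have "\<dots> = (\<Sum>(c, S)\<in>(SIGMA c:{c. tri c \<le> int N}. mayas 0 (int N - tri c)). int_sign c * ?G (shift_set c S))"
    unfolding sum_distrib_left using finite_tri finite_mayas by (subst sum.Sigma) auto
  also have "\<dots> = (\<Sum>p\<in>(SIGMA c:{c. tri c \<le> int N}. mayas 0 (int N - tri c)).
      int_sign (pw (\<lambda>_. 1) (case p of (c, S) \<Rightarrow> shift_set c S)) * ?G (case p of (c, S) \<Rightarrow> shift_set c S))"
  proof (rule sum.cong[OF refl], clarify)
    fix c S assume "S \<in> mayas 0 (int N - tri c)"
    then have "pw (\<lambda>_. 1 :: int) (shift_set c S) = c"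
      using shift_mayas[of S "int N - tri c" c] by (simp add: mayas_def)
    then show "int_sign c * ?G (shift_set c S) = int_sign (pw (\<lambda>_. 1) (shift_set c S)) * ?G (shift_set c S)" by simp
  qed
  also have "\<dots> = (\<Sum>T\<in>all_mayas (int N). int_sign (pw (\<lambda>_. 1) T) * ?G T)"
    by (rule sum.reindex_bij_betw[OF bij_shift_set])
  also have "\<dots> = 0"
  proof (rule toggle_sum)
    fix T :: "int set" assume T: "maya T" "0 \<notin> T"
    show "?G (insert 0 T) = ?G T"
      unfolding hev_def
    proof (intro sum.cong refl arg_cong2[of _ _ _ _ "(*)"])
      fix m assume m: "m \<in> Poly_Mapping.keys f"
      show "mon_val (\<lambda>n. pw (\<lambda>s. of_int s ^ n) (insert 0 T) / fact n + fps_nth bern (Suc n)) m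
        = mon_val (\<lambda>n. pw (\<lambda>s. of_int s ^ n) T / fact n + fps_nth bern (Suc n)) m"
        unfolding mon_val_def
      proof (rule prod.cong[OF refl])
        fix n assume "n \<in> Poly_Mapping.keys m"
        moreover have "Poly_Mapping.lookup m 0 = 0" using f m by (simp add: no_Q1_def)
        \<comment> \<open>At n = 0 the flipped bead would contribute 0^0 = 1, the change of charge;
          \<open>no_Q1\<close> excludes that variable.\<close>
        ultimately have "n \<noteq> 0" by (metis in_keys_iff)
        then show "(pw (\<lambda>s. of_int s ^ n) (insert 0 T) / fact n + fps_nth bern (Suc n)) ^ Poly_Mapping.lookup m n
          = (pw (\<lambda>s. of_int s ^ n) T / fact n + fps_nth bern (Suc n)) ^ Poly_Mapping.lookup m n"
          using pw_insert(2)[OF T, of "\<lambda>s. of_int s ^ n :: rat"] by (simp add: power_0_left)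
      qed
    qed
  qed
  finally show "fps_nth (\<Sum>d\<le>?D. theta d * sh_gf (shift_coeff d f)) N = fps_nth 0 N" by simp
qed

section \<open>The Bloch-Okounkov theorem\<close>

lemma tri_reflect: "tri (1 - c) = tri c"
  using two_tri[of "1 - c"] two_tri[of c] by (simp add: algebra_simps)

text \<open>The reflection c -> 1 - c preserves \<open>tri\<close>, negates c - 1/2 and flips the
  sign.\<close>

lemma theta_even:
  assumes "even d"
  shows "theta d = 0"
proof (rule fps_ext)
  fix M
  let ?t = "\<lambda>c. int_sign c * (of_int c - 1/2) ^ d"
  have "(\<Sum>c | tri c = int M. ?t c) = (\<Sum>c | tri c = int M. - ?t c)"
  proof (rule sum.reindex_bij_witness[of _ "\<lambda>c. 1 - c" "\<lambda>c. 1 - c"])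
    fix c
    have "(of_int (1 - c) - 1/2 :: rat) = - (of_int c - 1/2)" by simp
    then have "(of_int (1 - c) - 1/2 :: rat) ^ d = (of_int c - 1/2) ^ d"
      using assms by (metis power_minus_even)
    moreover have "int_sign (1 - c) = - int_sign c" by (simp add: int_sign_def)
    ultimately show "- ?t (1 - c) = ?t c" by simp
  qed (auto simp: tri_reflect)
  then show "fps_nth (theta d) M = fps_nth 0 M" by (simp add: theta_def sum_negf)
qed

text \<open>Since (c - 1/2)^2 = 2 \<open>tri c\<close> + 1/4, two more powers act as a differential
  operator in q.\<close>

lemma theta_heat: "theta (d + 2) = fps_const 2 * fps_XD (theta d) + fps_const (1/4) * theta d"
proof (rule fps_ext)
  fix M
  have "int_sign c * (of_int c - 1/2) ^ (d + 2) = (2 * of_nat M + 1/4) * (int_sign c * (of_int c - 1/2) ^ d)"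
    if "tri c = int M" for c
  proof -
    have "2 * of_nat M = (of_int (2 * tri c) :: rat)" using that by simp
    also have "\<dots> = of_int c * (of_int c - 1)" unfolding two_tri by simp
    finally have "(of_int c - 1/2) ^ 2 = (2 * of_nat M + 1/4 :: rat)"
      by (simp add: power2_eq_square algebra_simps)
    then show ?thesis unfolding power_add by simp
  qed
  then have "(\<Sum>c | tri c = int M. int_sign c * (of_int c - 1/2) ^ (d + 2))
    = (2 * of_nat M + 1/4) * (\<Sum>c | tri c = int M. int_sign c * (of_int c - 1/2) ^ d)"
    unfolding sum_distrib_left by (intro sum.cong) auto
  then show "fps_nth (theta (d + 2)) M = fps_nth (fps_const 2 * fps_XD (theta d) + fps_const (1/4) * theta d) M"
    by (simp add: theta_def distrib_right)
qed

lemma theta_1_nonzero: "theta 1 \<noteq> 0"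
proof -
  have "{c. tri c = 0} = {0, 1}"
  proof
    show "{c. tri c = 0} \<subseteq> {0, 1}"
    proof
      fix c assume "c \<in> {c. tri c = 0}"
      then have "c * (c - 1) = 0" using two_tri[of c] by simp
      then show "c \<in> {0, 1}" by auto
    qed
  qed (auto simp: tri_def)
  then have "fps_nth (theta 1) 0 = -1" by (simp add: theta_def int_sign_def)
  then show ?thesis by (metis fps_zero_nth zero_neq_neg_one)
qed

lemma theta_bracket:
  assumes "no_Q1 f"
  shows "(\<Sum>d\<le>Polynomial.degree (shift_poly f). theta d * bracket (shift_coeff d f)) = 0"
  using arg_cong[OF theta_sh_gf[OF assms], of "\<lambda>x. x * inverse (part_gf (\<lambda>_. 1))"]
  by (simp add: qbracket_part_gf sum_distrib_right mult.assoc)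

lemma theta_bracket_bound:
  assumes f: "pure w f"
  shows "(\<Sum>r\<le>w. theta (2 * r + 1) * bracket (shift_coeff (2 * r + 1) f)) = 0"
proof -
  let ?D = "Polynomial.degree (shift_poly f)"
  let ?F = "\<lambda>d. theta d * bracket (shift_coeff d f)"
  have z: "?F d = 0" if "?D < d \<or> w < d" for d
  proof -
    have "shift_coeff d f = 0"
      using that pure_shift_coeff(2)[of w f d] f by (auto simp: shift_coeff_def coeff_eq_0 pure_def)
    then show ?thesis by (simp add: bracket_0)
  qed
  have "0 = (\<Sum>d\<le>?D. ?F d)" using theta_bracket f by (simp add: pure_def)
  also have "\<dots> = (\<Sum>d\<le>max ?D (2 * w + 1). ?F d)"
    using z by (intro sum.mono_neutral_left) auto
  also have "\<dots> = (\<Sum>d\<le>2 * w + 1. ?F d)"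
    using z by (intro sum.mono_neutral_right) auto
  also have "\<dots> = (\<Sum>d\<in>(\<lambda>r. 2 * r + 1) ` {..w}. ?F d)"
  proof (rule sum.mono_neutral_right)
    show "\<forall>d\<in>{..2 * w + 1} - (\<lambda>r. 2 * r + 1) ` {..w}. ?F d = 0"
    proof
      fix d assume d: "d \<in> {..2 * w + 1} - (\<lambda>r. 2 * r + 1) ` {..w}"
      have "even d"
      proof (rule ccontr)
        assume "odd d"
        then obtain r where "d = 2 * r + 1" by (rule oddE)
        with d show False by auto
      qed
      then show "?F d = 0" by (simp add: theta_even)
    qed
  qed auto
  also have "\<dots> = (\<Sum>r\<le>w. ?F (2 * r + 1))"
    by (subst sum.reindex) (auto simp: inj_on_def)
  finally show ?thesis by simp
qed

lemma qval_2:
  assumes "S \<in> mayas 0 E"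
  shows "qval S 2 = of_int E - 1/24"
proof -
  have "pw (\<lambda>s. bpos s) S = of_int (pw (\<lambda>s. s) S) + 1/2 * of_int (pw (\<lambda>_. 1) S)"
    unfolding of_int_pw pw_cmult[symmetric] pw_add[symmetric] by simp
  then have "pw (\<lambda>s. bpos s) S = of_int E" using assms by (simp add: mayas_def)
  then show ?thesis by (simp add: qval_def numeral_2_eq_2 qcoord_def beta_2[unfolded numeral_2_eq_2])
qed

lemma card_hooks_sum:
  assumes S: "S \<in> mayas 0 (int n)"
  shows "(\<Sum>m=1..n. of_nat (card (hooks m S))) = (of_nat n :: rat)"
proof -
  obtain xs where xs: "xs \<in> partitions_of n" "beads xs = S"
    using bij_beads[of n] S by (metis bij_betw_imp_surj_on imageE)
  have "young xs = (SIGMA i:{..<length xs}. {..<xs ! i})" by (auto simp: young_def)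
  then have "card (young xs) = sum_list xs"
    by (simp add: sum_list_sum_nth atLeast0LessThan)
  then have "card (young xs) = n" using xs(1) by (simp add: partitions_of_def)
  then show ?thesis using sum_hook_length[OF xs(1), of "\<lambda>_. 1"] xs(2) by simp
qed

lemma drift_1:
  assumes S: "maya S"
  shows "drift 1 m r S = of_nat m"
proof -
  have "shifted_ev 1 m r z S = 1" for z by (simp add: shifted_ev_def hev_one rat_hom_id)
  then show ?thesis
    using addables_minus_hooks_power[OF S, of m 0] by (simp add: drift_def qval_def)
qed

text \<open>For f = 1 every drift equals m, so counting all cells of all partitions of n by hook
  length gives n p(n) as the convolution of sigma_1 with p.\<close>

lemma fps_XD_part_gf: "fps_XD (part_gf (\<lambda>_. 1)) = sigma_fps 1 * part_gf (\<lambda>_. 1)"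
proof (rule fps_ext)
  fix n
  let ?p = "\<lambda>n. of_nat (card (mayas 0 (int n))) :: rat"
  have p: "fps_nth (part_gf (\<lambda>_. 1)) i = ?p i" for i
    using part_gf_mayas[of "\<lambda>_. 1" i] by simp
  have "of_nat n * ?p n = (\<Sum>S\<in>mayas 0 (int n). \<Sum>m=1..n. of_nat (card (hooks m S)))"
    using card_hooks_sum by (simp add: mult.commute)
  also have "\<dots> = (\<Sum>m=1..n. \<Sum>S\<in>mayas 0 (int n). of_nat (card (hooks m S)) * ev_maya 1 S)"
    by (subst sum.swap) (simp add: ev_maya_1)
  also have "\<dots> = (\<Sum>m=1..n. \<Sum>t | 0 < t \<and> t * m \<le> n. of_nat m * ?p (n - t * m))"
  proof (rule sum.cong[OF refl])
    fix m assume "m \<in> {1..n}"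
    then have m: "0 < m" by simp
    show "(\<Sum>S\<in>mayas 0 (int n). of_nat (card (hooks m S)) * ev_maya 1 S) = (\<Sum>t | 0 < t \<and> t * m \<le> n. of_nat m * ?p (n - t * m))"
      unfolding hook_sum_formula[OF m] using drift_1
      by (intro sum.cong refl) (simp add: mayas_def mult.commute)
  qed
  also have "\<dots> = (\<Sum>i=0..n. \<Sum>(m, t)\<in>pairs i. of_nat m * ?p (n - i))"
    unfolding sum_pairs_le by (intro sum.cong refl) (auto simp: pairs_def mult.commute)
  also have "\<dots> = (\<Sum>i=0..n. fps_nth (sigma_fps 1) i * ?p (n - i))"
    unfolding sigma_fps_nth by (simp add: sum_distrib_right split_def)
  finally show "fps_nth (fps_XD (part_gf (\<lambda>_. 1))) n = fps_nth (sigma_fps 1 * part_gf (\<lambda>_. 1)) n"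
    by (simp add: p fps_mult_nth)
qed

lemma bracket_Q2: "bracket (Q 2) = Eis 2"
proof -
  let ?P = "part_gf (\<lambda>_. 1)"
  have "sh_gf (Q 2) = fps_XD ?P - fps_const (1/24) * ?P"
  proof (rule fps_ext)
    fix n
    have "fps_nth (sh_gf (Q 2)) n = (\<Sum>S\<in>mayas 0 (int n). of_nat n - 1/24)"
      unfolding sh_gf_maya
    proof (rule sum.cong[OF refl])
      fix S assume S: "S \<in> mayas 0 (int n)"
      show "ev_maya (Q 2) S = of_nat n - 1/24"
        using ev_maya_Qred[OF S, of 2] qval_2[OF S] by (simp add: Qred_def)
    qed
    then show "fps_nth (sh_gf (Q 2)) n = fps_nth (fps_XD ?P - fps_const (1/24) * ?P) n"
      using part_gf_mayas[of "\<lambda>_. 1" n] by (simp add: algebra_simps)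
  qed
  then have "sh_gf (Q 2) = (sigma_fps 1 - fps_const (1/24)) * ?P"
    by (simp add: fps_XD_part_gf left_diff_distrib)
  moreover have "?P * inverse ?P = 1"
  proof -
    have "sheval 1 = (\<lambda>_. 1)" by (intro ext sheval_one)
    then show ?thesis using bracket_1 unfolding qbracket_part_gf by simp
  qed
  ultimately have "bracket (Q 2) = sigma_fps 1 - fps_const (1/24)"
    by (simp add: qbracket_part_gf mult.assoc)
  also have "\<dots> = Eis 2"
    using Eis_split[of 2] by (simp add: geis_def eis_const_def bernc_values)
  finally show ?thesis .
qed

text \<open>The flip relation for Q_3: only Q_2 and the constant 1/6 survive, so <Q_2> = G_2
  determines \<open>theta 3\<close>. Together with \<open>theta_heat\<close> this amounts to the
  logarithmic derivative of \<open>theta 1\<close>.\<close>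

lemma theta_3: "theta 3 = fps_const (-6) * Eis 2 * theta 1"
proof -
  have sc: "shift_coeff 1 (Q 3) = Q 2" "shift_coeff 3 (Q 3) = cst (1/6)"
    using shift_coeff_Q[of 1 2] shift_coeff_Q[of 3 2]
    by (simp_all add: Qred_def cst_1 Q_0 fact_numeral numeral_3_eq_3 numeral_2_eq_2)
  have sc': "shift_coeff d (Q 3) = 0" if "3 < d" for d
    using shift_coeff_Q[of d 2] that by (simp add: numeral_3_eq_3 numeral_2_eq_2)
  have "(\<Sum>r\<le>3. theta (2 * r + 1) * bracket (shift_coeff (2 * r + 1) (Q 3))) = 0"
    by (rule theta_bracket_bound) (rule pure_Q, simp)
  moreover have "{..3::nat} = {0, 1, 2, 3}" by auto
  ultimately have "theta 1 * bracket (Q 2) + theta 3 * bracket (cst (1/6)) = 0"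
    by (simp add: sc' sc(1)[unfolded One_nat_def] sc bracket_0 numeral_3_eq_3[symmetric])
  moreover have "bracket (cst (1/6)) = fps_const (1/6)"
    using bracket_cst[of "1/6" 1] by (simp add: bracket_1)
  ultimately have e: "theta 3 * fps_const (1/6) = - (theta 1 * Eis 2)"
    by (simp add: bracket_Q2 eq_neg_iff_add_eq_0 add.commute)
  have "fps_const (1/6) * fps_const 6 = (1 :: rat fps)" by simp
  then have "theta 3 = (theta 3 * fps_const (1/6)) * fps_const 6"
    by (simp add: mult.assoc)
  also have "\<dots> = fps_const (-6) * Eis 2 * theta 1"
    unfolding e fps_const_neg[symmetric] by (simp only: mult_minus_left mult_minus_right mult_ac)
  finally show ?thesis .
qed

text \<open>Two more powers apply 2D + 1/4 with D = q d/dq. By \<open>theta_3\<close> this operator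
  multiplies \<open>theta 1\<close> by -6 G_2, so the quotient H passes to 2 D H - 6 G_2 H; the
  constant 1/4 is absorbed, which keeps the weight pure.\<close>

lemma theta_odd:
  "\<exists>H. H \<in> quasimodular (2 * r) \<and> theta (2 * r + 1) = H * theta 1"
proof (induction r)
  case 0
  show ?case using quasimodular_const[of 1] by (intro exI[of _ 1]) simp
next
  case (Suc r)
  then obtain H where H: "H \<in> quasimodular (2 * r)" "theta (2 * r + 1) = H * theta 1" by blast
  let ?H = "fps_const 2 * fps_XD H + fps_const (-6) * (Eis 2 * H)"
  have 1: "fps_const 2 * fps_XD (theta 1) + fps_const (1/4) * theta 1 = fps_const (-6) * Eis 2 * theta 1"
    using theta_heat[of 1] theta_3 by (simp add: numeral_3_eq_3)
  have "theta (2 * Suc r + 1) = fps_const 2 * fps_XD (H * theta 1) + fps_const (1/4) * (H * theta 1)"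
    using theta_heat[of "2 * r + 1"] H(2) by simp
  also have "\<dots> = fps_const 2 * fps_XD H * theta 1 + H * (fps_const 2 * fps_XD (theta 1) + fps_const (1/4) * theta 1)"
    unfolding fps_XD_mult by (simp only: algebra_simps)
  also have "\<dots> = ?H * theta 1"
    unfolding 1 by (simp only: algebra_simps)
  finally have "theta (2 * Suc r + 1) = ?H * theta 1" .
  moreover have "?H \<in> quasimodular (2 * Suc r)"
    using quasimodular_fps_XD[OF H(1)] quasimodular_mult[OF quasimodular_Eis_246(1) H(1)]
    by (auto intro!: quasimodular_add quasimodular_scale)
  ultimately show ?case by blast
qed

text \<open>Dividing the flip relation by \<open>theta 1\<close> isolates the bracket of
  \<open>delta F\<close>; the coefficients 2r + 1 of F with r > 0 have weight w - 2r < w or vanish,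
  so the induction reaches them.\<close>

lemma bracket_delta:
  assumes F: "pure (Suc w) F" and IH: "\<And>v h. v < w \<Longrightarrow> homogeneous v h \<Longrightarrow> bracket h \<in> quasimodular v"
  shows "bracket (delta F) \<in> quasimodular w"
proof -
  obtain H where H: "\<And>r. H r \<in> quasimodular (2 * r)" "\<And>r. theta (2 * r + 1) = H r * theta 1"
    using theta_odd by metis
  let ?b = "\<lambda>r. bracket (shift_coeff (2 * r + 1) F)"
  have "(\<Sum>r\<le>Suc w. theta (2 * r + 1) * ?b r) = theta 1 * bracket (delta F) + (\<Sum>r\<in>{1..Suc w}. theta (2 * r + 1) * ?b r)"
  proof -
    have "{..Suc w} = insert 0 {1..Suc w}" by auto
    then show ?thesis by simp
  qed
  also have "\<dots> = theta 1 * (bracket (delta F) + (\<Sum>r\<in>{1..Suc w}. H r * ?b r))"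
    unfolding H(2) distrib_left sum_distrib_left by (simp only: mult_ac)
  finally have "theta 1 * (bracket (delta F) + (\<Sum>r\<in>{1..Suc w}. H r * ?b r)) = 0"
    unfolding theta_bracket_bound[OF F] by (rule sym)
  then have "bracket (delta F) + (\<Sum>r\<in>{1..Suc w}. H r * ?b r) = 0"
    using theta_1_nonzero by (simp only: mult_eq_0_iff simp_thms)
  then have "bracket (delta F) = - (\<Sum>r\<in>{1..Suc w}. H r * ?b r)"
    by (rule eq_neg_iff_add_eq_0[THEN iffD2])
  note eq = this
  have "H r * ?b r \<in> quasimodular w" if r: "r \<in> {1..Suc w}" for r
  proof (cases "2 * r \<le> w")
    case True
    have "homogeneous (w - 2 * r) (shift_coeff (2 * r + 1) F)"
      using pure_shift_coeff(1)[of "Suc w" F "2 * r + 1"] F True by (simp add: pure_def)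
    then have "?b r \<in> quasimodular (w - 2 * r)" using r True by (intro IH) auto
    from quasimodular_mult[OF H(1)[of r] this] show ?thesis using True by simp
  next
    case False
    then have "shift_coeff (2 * r + 1) F = 0"
      using pure_shift_coeff(2)[of "Suc w" F "2 * r + 1"] F by (simp add: pure_def)
    then show ?thesis by (simp add: bracket_0 quasimodular_0)
  qed
  then show ?thesis
    unfolding eq by (intro quasimodular_uminus quasimodular_sum)
qed

text \<open>The primitive F has weight w + 1, yet induction on w is sound: beside
  \<open>delta F\<close>, the relation for F involves only coefficients of weight below w. Monomials
  containing Q_1 vanish on all partitions, and any other nonconstant monomial is Q_a times a pure
  factor with a \<ge> 2.\<close>

theorem bloch_okounkov: "homogeneous w f \<Longrightarrow> bracket f \<in> quasimodular w"
proof (induction w arbitrary: f rule: less_induct)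
  case (less w)
  have mon: "bracket (Poly_Mapping.single m c) \<in> quasimodular w" if m: "mon_weight m = w" for m c
  proof (cases "Poly_Mapping.lookup m 0 = 0")
    case False
    have "sheval (Poly_Mapping.single m c) xs = 0" for xs
    proof -
      have "Qfun 1 xs = 0" using beta_1 by (simp add: Qfun_def)
      then have "mon_val (\<lambda>n. Qfun (n + 1) xs) m = 0"
        unfolding mon_val_def using False by (intro prod_zero finite_keys bexI[of _ 0]) (auto simp: in_keys_iff)
      then show ?thesis by (simp add: sheval_hev hev_single rat_hom_id)
    qed
    then have "part_gf (sheval (Poly_Mapping.single m c)) = 0" by (intro fps_ext) (simp add: part_gf_def)
    then show ?thesis by (simp add: qbracket_part_gf quasimodular_0)
  next
    case True
    show ?thesis
    proof (cases "m = 0")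
      case True
      then have "bracket (Poly_Mapping.single m c) = fps_const c"
        using bracket_cst[of c 1] by (simp add: bracket_1 cst_def)
      then show ?thesis using True m quasimodular_const by simp
    next
      case False
      then obtain n where n: "n \<in> Poly_Mapping.keys m" by (metis all_not_in_conv keys_eq_empty)
      define m' where "m' = m - Poly_Mapping.single n 1"
      have mm: "Poly_Mapping.single n 1 + m' = m" unfolding m'_def by (rule monom_decompose[OF n])
      have n0: "n \<noteq> 0" using n True by (metis in_keys_iff)
      have w: "Suc n + mon_weight m' = w" using mon_weight_add[of "Poly_Mapping.single n 1" m'] unfolding mm using m by simp
      have "Poly_Mapping.lookup m' 0 = 0" using True by (simp add: m'_def lookup_minus)
      then have g: "pure (mon_weight m') (Poly_Mapping.single m' c)"
        by (simp add: pure_def no_Q1_def homogeneous_def)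
      have e: "Q (Suc n) * Poly_Mapping.single m' c = Poly_Mapping.single m c"
        unfolding Q_def using mm by (simp add: mult_single)
      obtain F where F: "pure (Suc n + mon_weight m' + 1) F" "delta F = Q (Suc n) * Poly_Mapping.single m' c"
        using delta_primitive[OF g, of "Suc n"] n0 by auto
      have "bracket (delta F) \<in> quasimodular w"
      proof (rule bracket_delta)
        show "pure (Suc w) F" using F(1) w by simp
        show "bracket h \<in> quasimodular v" if "v < w" "homogeneous v h" for v h
          using less.IH that by blast
      qed
      then show ?thesis unfolding F(2) e .
    qed
  qed
  have "bracket (sum F A) = (\<Sum>a\<in>A. bracket (F a))" for F and A :: "monom set"
    by (induction A rule: infinite_finite_induct) (auto simp: bracket_0 bracket_add)
  then have "bracket f = (\<Sum>m\<in>Poly_Mapping.keys f. bracket (Poly_Mapping.single m (Poly_Mapping.lookup f m)))"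
    using poly_mapping_sum_singles[of f] by metis
  also have "\<dots> \<in> quasimodular w"
    using less.prems by (intro quasimodular_sum mon) (simp add: homogeneous_def)
  finally show ?case .
qed

theorem theorem16p1:
  fixes f :: shsym and k :: nat
  assumes "homogeneous k f"
  shows "qbracket_star f \<in> quasimodular k \<and>
         finite {(i, j). 2 \<le> i \<and> rho_star i j f \<noteq> 0} \<and>
         qbracket_star f =
           (\<Sum>(i, j) | 2 \<le> i \<and> rho_star i j f \<noteq> 0.
              Eis_deriv i j * qbracket (sheval (rho_star i j f)))"
proof (intro conjI)
  have w: "weight_le k f" using assms by (rule homogeneous_weight_le)
  show "finite {(i, j). 2 \<le> i \<and> rho_star i j f \<noteq> 0}"
    by (rule finite_subset[OF rho_star_support[OF w]]) simp
  show formula: "qbracket_star f = (\<Sum>(i, j) | 2 \<le> i \<and> rho_star i j f \<noteq> 0. Eis_deriv i j * bracket (rho_star i j f))"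
    by (rule bracket_star_formula[OF w])
  show "qbracket_star f \<in> quasimodular k"
    unfolding formula
  proof (rule quasimodular_sum, clarify)
    fix i j assume i: "2 \<le> i" and nz: "rho_star i j f \<noteq> 0"
    \<comment> \<open>The extra term \<open>rho 0 (j + 1)\<close> at i = 2 also lowers the weight by
      2 (j + 1) = i + 2j, the weight of \<open>Eis_deriv i j\<close>.\<close>
    from rho_star_homogeneous[OF assms i, of j] nz
    have le: "i + 2 * j \<le> k" and h: "homogeneous (k - (i + 2 * j)) (rho_star i j f)" by (auto split: if_splits)
    from quasimodular_mult[OF quasimodular_Eis_deriv[OF i, of j] bloch_okounkov[OF h]]
    show "Eis_deriv i j * bracket (rho_star i j f) \<in> quasimodular k" using le by simp
  qed
qed

end
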